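(* Let $\lambda$ be an integer partition and let $w\in\mathfrak{S}_n$ (for some $n$) be a vexillary permutation of shape $\lambda$. (a) The lower intervals $[\varnothing,\lambda]$ in Young's lattice and $[e,w]$ in the right weak Bruhat order on $\mathfrak{S}_n$ satisfy $\mathbb{E}(Y_{[\varnothing,\lambda]})=\mathbb{E}(Y_{[e,w]})$. (b) If $w$ is either Grassmannian or inverse Grassmannian, then also $\mathbb{E}(X_{[\varnothing,\lambda]})=\mathbb{E}(X_{[e,w]})$. (c) If $\lambda=\delta_d\circ b^a$ is a rectangular staircase (for positive integers $d,a,b$) and $w$ is dominant, Grassmannian, or inverse Grassmannian, then the four posets $[\varnothing,\lambda]$, $[e,w]$, $[\varnothing,\lambda]^*$ and $[e,w]^*$ are all CDE, and in each case $$\mathbb{E}(X)=\mathbb{E}(Y)=\frac{(d-1)ab}{a+b}.$$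
   Context: For a finite poset $P$ and $p\in P$, the down-degree of $p$ is $\#\{q\in P: q\lessdot p\}$ (number of elements covered by $p$). $X_P$ is the down-degree random variable on $P$ with the uniform distribution. $Y_P$ is the down-degree random variable on $P$ with the distribution assigning to $p$ probability proportional to the number of maximal (inclusion-maximal) chains of $P$ containing $p$. $P$ is called CDE (coincidental down-degree expectations) if $\mathbb{E}(X_P)=\mathbb{E}(Y_P)$. $P^*$ denotes the dual poset. Young's lattice: partitions ordered by containment of Ferrers diagrams; $[\varnothing,\lambda]$ is the set of partitions $\mu\subseteq\lambda$. Right weak Bruhat order on $\mathfrak{S}_n$: the transitive closure of $u\lessdot w$ whenever $w=u\sigma_i$ with $\sigma_i=(i,i+1)$ and $u(i)<u(i+1)$ (i.e. $w$ is obtained from $u$ by swapping the entries in positions $i,i+1$ to create a descent); $e$ is the identity. The Lehmer code of $w$ is $c(w)=(c_1(w),c_2(w),\dots)$ with $c_i(w)=\#\{j>i: w(i)>w(j)\}$. A permutation is vexillary if it avoids $2143$ (no $i_1<i_2<i_3<i_4$ with $w(i_2)<w(i_1)<w(i_4)<w(i_3)$); the shape of a vexillary $w$ is the weakly decreasing rearrangement of $c(w)$. $w$ is dominant if it avoids $132$; Grassmannian if it has at most one descent ($w(i)>w(i+1)$ for at most one $i$); inverse Grassmannian if $w^{-1}$ is Grassmannian. The rectangular staircase $\delta_d\circ b^a$ is the partition obtained from the staircase $\delta_d=(d-1,d-2,\dots,1)$ by replacing each cell by an $a\times b$ block, i.e. the partition with $a$ parts equal to $(d-1)b$, then $a$ parts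 equal to $(d-2)b$, ..., then $a$ parts equal to $b$. *)

theory Defs
  imports
    "HOL-Probability.Probability_Mass_Function"
    "HOL-Combinatorics.Permutations"
begin

section \<open>Finite posets and down-degree expectations\<close>

text \<open>
  A poset is a reflexive order relation \<open>r\<close>, as in \<^theory>\<open>HOL.Order_Relation\<close>, with \<^term>\<open>Field r\<close>
  as its ground set; the dual poset is the converse \<^term>\<open>r\<inverse>\<close>.
\<close>

definition covered :: "('a \<times> 'a) set \<Rightarrow> 'a \<Rightarrow> 'a \<Rightarrow> bool" where
  "covered r q p \<longleftrightarrow> (q, p) \<in> r \<and> q \<noteq> p \<and>
     \<not> (\<exists>z. (q, z) \<in> r \<and> z \<noteq> q \<and> (z, p) \<in> r \<and> z \<noteq> p)"

definition down_degree :: "('a \<times> 'a) set \<Rightarrow> 'a \<Rightarrow> nat" where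
  "down_degree r p = card {q \<in> Field r. covered r q p}"

definition max_chains :: "('a \<times> 'a) set \<Rightarrow> 'a set set" where
  "max_chains r = {C \<in> Chains r. \<forall>D \<in> Chains r. C \<subseteq> D \<longrightarrow> D = C}"

definition chain_weight :: "('a \<times> 'a) set \<Rightarrow> 'a \<Rightarrow> nat" where
  "chain_weight r p = card {C \<in> max_chains r. p \<in> C}"

text \<open>
  That the following is a probability mass function on every finite nonempty poset is
  the lemma \<open>pmf_chain_pmf\<close> below.
\<close>

definition chain_pmf :: "('a \<times> 'a) set \<Rightarrow> 'a pmf" where
  "chain_pmf r = embed_pmf (\<lambda>p. real (chain_weight r p) / (\<Sum>q\<in>Field r. real (chain_weight r q)))"

definition expect_X :: "('a \<times> 'a) set \<Rightarrow> real" where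
  "expect_X r = measure_pmf.expectation (pmf_of_set (Field r)) (\<lambda>p. real (down_degree r p))"

definition expect_Y :: "('a \<times> 'a) set \<Rightarrow> real" where
  "expect_Y r = measure_pmf.expectation (chain_pmf r) (\<lambda>p. real (down_degree r p))"

definition CDE :: "('a \<times> 'a) set \<Rightarrow> bool" where
  "CDE r \<longleftrightarrow> expect_X r = expect_Y r"

definition interval :: "('a \<times> 'a) set \<Rightarrow> 'a \<Rightarrow> 'a \<Rightarrow> ('a \<times> 'a) set" where
  "interval r x y = Restr r {z. (x, z) \<in> r \<and> (z, y) \<in> r}"


section \<open>Partitions and Young's lattice\<close>

text \<open>A partition is the list of its positive parts, so the empty partition is \<^term>\<open>[]\<close>.\<close>

definition is_partition :: "nat list \<Rightarrow> bool" where
  "is_partition \<nu> \<longleftrightarrow> sorted_wrt (\<ge>) \<nu> \<and> 0 \<notin> set \<nu>"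

definition diagram :: "nat list \<Rightarrow> (nat \<times> nat) set" where
  "diagram \<nu> = {(i, j). i < length \<nu> \<and> j < \<nu> ! i}"

definition young :: "(nat list \<times> nat list) set" where
  "young = {(\<mu>, \<nu>). is_partition \<mu> \<and> is_partition \<nu> \<and> diagram \<mu> \<subseteq> diagram \<nu>}"

definition rect_staircase :: "nat \<Rightarrow> nat \<Rightarrow> nat \<Rightarrow> nat list" where
  "rect_staircase d a b = concat (map (\<lambda>k. replicate a (k * b)) (rev [1..<d]))"


section \<open>Permutations and the right weak order\<close>

text \<open>
  Elements of the symmetric group are functions \<^term>\<open>w\<close> with \<^term>\<open>w permutes {1..n}\<close>.
  The name \<open>transpose\<close> is qualified because matrix transposition is also in scope.
\<close>

definition weak_step :: "nat \<Rightarrow> ((nat \<Rightarrow> nat) \<times> (nat \<Rightarrow> nat)) set" where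
  "weak_step n = {(u, w). u permutes {1..n} \<and>
     (\<exists>i \<in> {1..<n}. u i < u (i + 1) \<and> w = u \<circ> Transposition.transpose i (i + 1))}"

definition weak_order :: "nat \<Rightarrow> ((nat \<Rightarrow> nat) \<times> (nat \<Rightarrow> nat)) set" where
  "weak_order n = Id_on {u. u permutes {1..n}} \<union> (weak_step n)\<^sup>+"

definition lehmer :: "nat \<Rightarrow> (nat \<Rightarrow> nat) \<Rightarrow> nat \<Rightarrow> nat" where
  "lehmer n w i = card {j \<in> {1..n}. i < j \<and> w j < w i}"

definition vexillary :: "nat \<Rightarrow> (nat \<Rightarrow> nat) \<Rightarrow> bool" where
  "vexillary n w \<longleftrightarrow> \<not> (\<exists>i1\<in>{1..n}. \<exists>i2\<in>{1..n}. \<exists>i3\<in>{1..n}. \<exists>i4\<in>{1..n}.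
     i1 < i2 \<and> i2 < i3 \<and> i3 < i4 \<and> w i2 < w i1 \<and> w i1 < w i4 \<and> w i4 < w i3)"

text \<open>The zeros of the Lehmer code are dropped, as partitions have positive parts.\<close>

definition shape :: "nat \<Rightarrow> (nat \<Rightarrow> nat) \<Rightarrow> nat list" where
  "shape n w = rev (sort (filter (\<lambda>c. c \<noteq> 0) (map (lehmer n w) [1..<n + 1])))"

definition dominant :: "nat \<Rightarrow> (nat \<Rightarrow> nat) \<Rightarrow> bool" where
  "dominant n w \<longleftrightarrow> \<not> (\<exists>i1\<in>{1..n}. \<exists>i2\<in>{1..n}. \<exists>i3\<in>{1..n}.
     i1 < i2 \<and> i2 < i3 \<and> w i1 < w i3 \<and> w i3 < w i2)"

definition grassmannian :: "nat \<Rightarrow> (nat \<Rightarrow> nat) \<Rightarrow> bool" where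
  "grassmannian n w \<longleftrightarrow> card {i \<in> {1..<n}. w i > w (i + 1)} \<le> 1"

definition inv_grassmannian :: "nat \<Rightarrow> (nat \<Rightarrow> nat) \<Rightarrow> bool" where
  "inv_grassmannian n w \<longleftrightarrow> grassmannian n (inv w)"


section \<open>Well-definedness\<close>

lemma Chains_subset_Field:
  assumes "C \<in> Chains r" shows "C \<subseteq> Field r"
  using assms by (auto simp: Chains_def Field_def)

lemma finite_max_chains:
  assumes "finite (Field r)" shows "finite (max_chains r)"
proof (rule finite_subset)
  show "max_chains r \<subseteq> Pow (Field r)"
    using Chains_subset_Field by (auto simp: max_chains_def)
qed (use assms in simp)

lemma chain_weight_outside:
  assumes "p \<notin> Field r" shows "chain_weight r p = 0"
proof -
  have "{C \<in> max_chains r. p \<in> C} = {}"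
    using assms Chains_subset_Field unfolding max_chains_def by blast
  then show ?thesis unfolding chain_weight_def by (simp only: card.empty)
qed

lemma chain_weight_pos:
  assumes fin: "finite (Field r)" and po: "Partial_order r" and p: "p \<in> Field r"
  shows "chain_weight r p > 0"
proof -
  let ?S = "{C \<in> Chains r. p \<in> C}"
  have "finite ?S"
    by (rule finite_subset[of _ "Pow (Field r)"]) (use Chains_subset_Field fin in auto)
  moreover have "{p} \<in> ?S"
    using po p by (auto simp: Chains_def partial_order_on_def preorder_on_def refl_on_def)
  ultimately obtain C where C: "C \<in> ?S" "\<forall>D\<in>?S. C \<subseteq> D \<longrightarrow> C = D"
    using finite_has_maximal[of ?S] by blast
  have "C \<in> {C \<in> max_chains r. p \<in> C}"
    using C unfolding max_chains_def by blast
  moreover have "finite {C \<in> max_chains r. p \<in> C}"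
    using finite_max_chains[OF fin] by simp
  ultimately show ?thesis
    unfolding chain_weight_def by (metis card_gt_0_iff empty_iff)
qed

lemma sum_chain_weight_pos:
  assumes "finite (Field r)" "Partial_order r" "Field r \<noteq> {}"
  shows "(\<Sum>q\<in>Field r. real (chain_weight r q)) > 0"
  by (rule sum_pos) (use assms in \<open>simp_all add: chain_weight_pos[OF assms(1,2)]\<close>)

lemma pmf_chain_pmf:
  assumes fin: "finite (Field r)" and po: "Partial_order r" and ne: "Field r \<noteq> {}"
  shows "pmf (chain_pmf r) p
    = real (chain_weight r p) / (\<Sum>q\<in>Field r. real (chain_weight r q))"
proof -
  define Z where "Z = (\<Sum>q\<in>Field r. real (chain_weight r q))"
  let ?f = "\<lambda>p. real (chain_weight r p) / Z"
  have Z: "Z > 0" unfolding Z_def by (rule sum_chain_weight_pos) fact+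
  have "(\<integral>\<^sup>+x. ennreal (?f x) \<partial>count_space UNIV) = (\<Sum>x\<in>Field r. ennreal (?f x))"
    by (rule nn_integral_count_space')
      (use fin Z chain_weight_outside[of _ r] in auto)
  also have "\<dots> = ennreal (\<Sum>x\<in>Field r. ?f x)"
    using Z by (intro sum_ennreal) auto
  also have "(\<Sum>x\<in>Field r. ?f x) = 1"
    using Z by (simp add: sum_divide_distrib[symmetric] Z_def)
  finally have "(\<integral>\<^sup>+x. ennreal (?f x) \<partial>count_space UNIV) = 1" by simp
  then have "pmf (embed_pmf ?f) p = ?f p"
    using Z by (intro pmf_embed_pmf) auto
  then show ?thesis by (simp add: chain_pmf_def Z_def)
qed

lemma expect_X_eq:
  assumes "finite (Field r)" "Field r \<noteq> {}"
  shows "expect_X r = (\<Sum>p\<in>Field r. real (down_degree r p)) / real (card (Field r))"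
  unfolding expect_X_def using assms by (simp add: integral_pmf_of_set)

lemma expect_Y_eq:
  assumes "finite (Field r)" "Partial_order r" "Field r \<noteq> {}"
  shows "expect_Y r = (\<Sum>p\<in>Field r. real (chain_weight r p) * real (down_degree r p))
    / (\<Sum>p\<in>Field r. real (chain_weight r p))"
proof -
  have "expect_Y r = (\<Sum>p\<in>Field r. pmf (chain_pmf r) p *\<^sub>R real (down_degree r p))"
    unfolding expect_Y_def
    by (rule integral_measure_pmf[OF assms(1)])
      (use chain_weight_outside in \<open>fastforce simp: set_pmf_iff pmf_chain_pmf[OF assms]\<close>)
  then show ?thesis
    by (simp add: pmf_chain_pmf[OF assms] sum_divide_distrib)
qed

lemma Partial_order_interval:
  assumes "Partial_order r" shows "Partial_order (interval r x y)"
  using assms unfolding interval_def by (rule Partial_order_Restr)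

lemma Field_interval:
  assumes "Partial_order r"
  shows "Field (interval r x y) = {z. (x, z) \<in> r \<and> (z, y) \<in> r}"
  using assms unfolding interval_def Field_def partial_order_on_def preorder_on_def refl_on_def
  by blast

lemma diagram_nth:
  assumes "diagram \<mu> \<subseteq> diagram \<nu>" "is_partition \<mu>" "i < length \<mu>"
  shows "i < length \<nu> \<and> \<mu> ! i \<le> \<nu> ! i"
proof -
  have "\<mu> ! i > 0" using assms(2,3) unfolding is_partition_def by (metis gr0I nth_mem)
  then have "(i, \<mu> ! i - 1) \<in> diagram \<mu>" using assms(3) by (simp add: diagram_def)
  then show ?thesis using assms(1) by (auto simp: diagram_def)
qed

lemma Field_young: "Field young = {\<nu>. is_partition \<nu>}"
  by (auto simp: Field_def young_def)

lemma Partial_order_young: "Partial_order young"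
proof -
  have "\<mu> = \<nu>" if "diagram \<mu> = diagram \<nu>" "is_partition \<mu>" "is_partition \<nu>" for \<mu> \<nu>
  proof -
    have 1: "i < length \<nu> \<and> \<mu> ! i \<le> \<nu> ! i" if "i < length \<mu>" for i
      using \<open>i < length \<mu>\<close> diagram_nth[of \<mu> \<nu> i]
        \<open>diagram \<mu> = diagram \<nu>\<close> \<open>is_partition \<mu>\<close> by blast
    have 2: "i < length \<mu> \<and> \<nu> ! i \<le> \<mu> ! i" if "i < length \<nu>" for i
      using \<open>i < length \<nu>\<close> diagram_nth[of \<nu> \<mu> i]
        \<open>diagram \<mu> = diagram \<nu>\<close> \<open>is_partition \<nu>\<close> by blast
    have "length \<mu> = length \<nu>" using 1 2 by (metis linorder_neqE_nat order_less_irrefl)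
    then show ?thesis using 1 2 by (metis nth_equalityI order_antisym)
  qed
  then show ?thesis
    unfolding partial_order_on_def preorder_on_def refl_on_def trans_def antisym_def Field_young
    by (auto simp: young_def)
qed

lemma Field_young_interval:
  "is_partition \<nu> \<Longrightarrow> Field (interval young [] \<nu>) = {\<mu>. (\<mu>, \<nu>) \<in> young}"
  by (auto simp: Field_interval[OF Partial_order_young])
     (auto simp: young_def is_partition_def diagram_def)

lemma finite_young_interval:
  assumes "is_partition \<nu>" shows "finite (Field (interval young [] \<nu>))"
proof (rule finite_subset)
  show "Field (interval young [] \<nu>)
      \<subseteq> {\<mu>. set \<mu> \<subseteq> {..sum_list \<nu>} \<and> length \<mu> \<le> length \<nu>}"
  proof safe
    fix \<mu> x assume "\<mu> \<in> Field (interval young [] \<nu>)"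
    then have \<mu>: "diagram \<mu> \<subseteq> diagram \<nu>" "is_partition \<mu>"
      using Field_young_interval[OF assms] by (auto simp: young_def)
    show "length \<mu> \<le> length \<nu>"
      using diagram_nth[OF \<mu>, of "length \<nu>"] by (metis linorder_not_less order_less_irrefl)
    show "x \<le> sum_list \<nu>" if x: "x \<in> set \<mu>"
    proof -
      obtain i where i: "i < length \<mu>" "x = \<mu> ! i"
        using x by (auto simp: in_set_conv_nth)
      show ?thesis
        using diagram_nth[OF \<mu> i(1)] elem_le_sum_list[of i \<nu>] i(2) by linarith
    qed
  qed
qed (simp add: finite_lists_length_le)

lemma weak_step_permutes:
  assumes "(u, w) \<in> weak_step n" shows "u permutes {1..n}" "w permutes {1..n}"
proof -
  obtain i where i: "u permutes {1..n}" "i \<in> {1..<n}" "w = u \<circ> Transposition.transpose i (i + 1)"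
    using assms by (auto simp: weak_step_def)
  then show "u permutes {1..n}" by simp
  have "Transposition.transpose i (i + 1) permutes {1..n}"
    using i(2) by (intro permutes_swap_id) auto
  then show "w permutes {1..n}" using i by (simp add: permutes_compose)
qed

lemma weak_step_decreases:
  assumes "(u, w) \<in> weak_step n"
  shows "(\<Sum>k\<in>{1..n}. int k * int (w k)) < (\<Sum>k\<in>{1..n}. int k * int (u k))"
proof -
  obtain i where i: "i \<in> {1..<n}" "u i < u (i + 1)" "w = u \<circ> Transposition.transpose i (i + 1)"
    using assms by (auto simp: weak_step_def)
  let ?R = "{1..n} - {i, i + 1}"
  have eq: "{1..n} = insert i (insert (i + 1) ?R)" using i(1) by auto
  have split: "(\<Sum>k\<in>{1..n}. f k) = f i + f (i + 1) + (\<Sum>k\<in>?R. f k)" for f :: "nat \<Rightarrow> int"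
    by (subst eq) simp
  have "(\<Sum>k\<in>?R. int k * int (w k)) = (\<Sum>k\<in>?R. int k * int (u k))"
    by (rule sum.cong) (auto simp: i(3) Transposition.transpose_def)
  moreover have "w i = u (i + 1)" "w (i + 1) = u i" by (simp_all add: i(3))
  ultimately show ?thesis
    using i(2) split[of "\<lambda>k. int k * int (w k)"] split[of "\<lambda>k. int k * int (u k)"]
    by (simp add: algebra_simps)
qed

lemma weak_trancl:
  assumes "(u, w) \<in> (weak_step n)\<^sup>+"
  shows "u permutes {1..n} \<and> w permutes {1..n} \<and>
    (\<Sum>k\<in>{1..n}. int k * int (w k)) < (\<Sum>k\<in>{1..n}. int k * int (u k))"
  using assms
proof (induction rule: trancl_induct)
  case (base w)
  then show ?case using weak_step_permutes weak_step_decreases by blast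
next
  case (step v w)
  then show ?case using weak_step_permutes weak_step_decreases by (meson order_less_trans)
qed

lemma Field_weak_order: "Field (weak_order n) = {u. u permutes {1..n}}"
  using weak_trancl by (fastforce simp: Field_def weak_order_def)

lemma Partial_order_weak_order: "Partial_order (weak_order n)"
proof -
  have "trans (weak_order n)"
    unfolding weak_order_def trans_def by (auto intro: trancl_trans)
  moreover have "antisym (weak_order n)"
    unfolding weak_order_def antisym_def by (auto dest!: weak_trancl)
  moreover have "refl_on (Field (weak_order n)) (weak_order n)"
    unfolding Field_weak_order refl_on_def by (auto simp: weak_order_def)
  moreover have "weak_order n \<subseteq> Field (weak_order n) \<times> Field (weak_order n)"
    by (auto simp: Field_def)
  ultimately show ?thesis by (simp add: partial_order_on_def preorder_on_def)
qed

lemma finite_weak_interval: "finite (Field (interval (weak_order n) u w))"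
proof (rule finite_subset)
  show "Field (interval (weak_order n) u w) \<subseteq> {v. v permutes {1..n}}"
    unfolding Field_interval[OF Partial_order_weak_order] Field_weak_order[symmetric]
    by (auto simp: Field_def)
qed (simp add: finite_permutations)

end

theory Submission
  imports Defs
begin

text \<open>
  Both sides of part (a) are ratios \<open>g / ((l + 1) f)\<close>, where \<open>f\<close> counts the maximal chains of the interval
  and \<open>g\<close> sums the down-degrees along them.  Write \<open>A\<close> for the operator that maps a permutation to the sum
  of its lower covers in the weak order and \<open>T\<close> for the signed sum of its upper Bruhat covers that move
  the entry at a fixed position \<open>r\<close>, to the right with sign \<open>+\<close> and to the left with sign \<open>-\<close>.  The only
  terms of the commutator of \<open>A\<close> and \<open>T\<close> come from neighbouring values, and they telescope to zero.  Hence \<open>f\<close>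
  vanishes on the image of \<open>T\<close>, and with a second-order correction so does \<open>g\<close>.  If there is exactly one
  cover on each side, the two covers have equal \<open>f\<close> and \<open>g\<close>.  For a vexillary permutation that
  contains 132 such a pair arises by turning a suitable occurrence of 132 into 213, which swaps two
  entries of the Lehmer code and moves the larger one to the left.  Iterating ends in a dominant permutation,
  which is determined by its shape.  The interval \<open>[{}, \<lambda>]\<close> itself is the weak interval below an
  inverse Grassmannian permutation of shape \<open>\<lambda>\<close>, which yields (a) and (b).

  For (c), the uniform and the chain distribution on \<open>[{}, \<lambda>]\<close> are toggle-symmetric: every cell is
  addable as often as it is removable.  Placing a rook on a cell of an outer block of the staircase shows that
  the expected number of removable cells in the row and in the column of the rook add up to one;
  averaging over the outer blocks gives the value.  The same rooks work for the uniform distribution below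
  a dominant permutation.
\<close>

section \<open>Bruhat covers and chains in the weak order\<close>

text \<open>The commutator argument is run on inverses. For v = \<open>inv w\<close> a step of the
  weak order multiplies on the left, so one operator exchanges values and the other exchanges
  positions. They commute except where both would exchange the same two entries, which is where the
  neighbouring values come from. For the down-degree sum the obstacle is that the Bruhat covers of v
  have different descent numbers. The defect of a cover equals a coefficient that arises when a
  descent step is commuted past two successive covers through the same position, the second with a
  closer partner. Adding these second-order sums makes descent number plus coefficient constant over
  all covers on both sides, and they vanish when each side has only one cover. Duals need no
  separate theory: the dual of the interval below w is isomorphic to the interval below
  \<open>inv w\<close>, and the uniform expectation is self-dual because it counts covering pairs.
  Grassmannian permutations are therefore handled through their inverses. Below a dominant
  permutation only the uniform distribution needs rooks, as the chain expectation comes from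
  (a).\<close>

abbreviation swap :: "'a \<Rightarrow> 'a \<Rightarrow> 'a \<Rightarrow> 'a" where
  "swap \<equiv> Transposition.transpose"

text \<open>
  Permutations are extended to the integers, as at the boundary of \<open>{1..n}\<close> the telescoping sums
  below would leave extra terms; \<open>K\<close> bounds the positions and values that matter.
\<close>

definition left_des :: "int \<Rightarrow> (int \<Rightarrow> int) \<Rightarrow> int set" where
  "left_des K v = {i \<in> {-K..K}. inv v (i + 1) < inv v i}"

text \<open>For a < b this is the covering relation of the Bruhat order between v and
  \<open>v \<circ> swap a b\<close>; the condition a < b is always supplied separately.\<close>

definition cover :: "(int \<Rightarrow> int) \<Rightarrow> int \<Rightarrow> int \<Rightarrow> bool" where
  "cover v a b \<longleftrightarrow> v a < v b \<and> (\<forall>p. a < p \<and> p < b \<longrightarrow> \<not> (v a < v p \<and> v p < v b))"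

lemma inv_comp_swap:
  assumes "bij v" shows "inv (v \<circ> swap a b) i = swap a b (inv v i)"
  using assms by (simp add: o_inv_distrib)

lemma coverD:
  "cover v a b \<Longrightarrow> v a < v b"
  "cover v a b \<Longrightarrow> a < p \<Longrightarrow> p < b \<Longrightarrow> v p \<le> v a \<or> v b \<le> v p"
  by (auto simp: cover_def not_less)

text \<open>Exchanging the values i, i + 1 and exchanging the positions a, b can interfere only
  through a value i or i + 1 at a or b. If exactly one of them is there and the other one lies
  strictly between a and b, both sides are false. If it lies outside, neither the relative order of
  i and i + 1 nor the cover condition changes.\<close>

lemma cover_des_iff:
  fixes v :: "int \<Rightarrow> int"
  assumes v: "bij v" and ab: "a < b" and i: "i \<in> {-K..K}"
    and ne: "{v a, v b} \<noteq> {i, i + 1}"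
  shows "cover v a b \<and> i \<in> left_des K (v \<circ> swap a b)
    \<longleftrightarrow> i \<in> left_des K v \<and> cover (swap i (i + 1) \<circ> v) a b"
proof -
  define j where "j = inv v i"
  define j' where "j' = inv v (i + 1)"
  have j: "v j = i" "v j' = i + 1"
    using v by (simp_all add: j_def j'_def bij_inv_eq_iff[symmetric] surj_f_inv_f bij_is_surj)
  have inj: "v p = v q \<longleftrightarrow> p = q" for p q using v by (meson bij_is_inj inj_eq)
  have jj: "j \<noteq> j'" using j by auto
  have L: "i \<in> left_des K v \<longleftrightarrow> j' < j" using i by (simp add: left_des_def j_def j'_def)
  have R: "i \<in> left_des K (v \<circ> swap a b) \<longleftrightarrow> swap a b j' < swap a b j"
    using i v by (simp add: left_des_def inv_comp_swap j_def j'_def)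
  have s: "(swap i (i + 1) \<circ> v) p = (if p = j then i + 1 else if p = j' then i else v p)" for p
    using j jj inj[of p j] inj[of p j'] by (auto simp: Transposition.transpose_def)
  have ne': "\<not> (a = j \<and> b = j')" "\<not> (a = j' \<and> b = j)" using ne j by auto
  have vp: "v p \<noteq> i" "v p \<noteq> i + 1" if "p \<noteq> j" "p \<noteq> j'" for p using that inj j by metis+
  have cs: "(a = j \<and> b \<noteq> j') \<or> (b = j \<and> a \<noteq> j') \<or> (a = j' \<and> b \<noteq> j) \<or> (b = j' \<and> a \<noteq> j)
    \<or> (a \<noteq> j \<and> a \<noteq> j' \<and> b \<noteq> j \<and> b \<noteq> j')" using ne' by blast
  let ?u = "swap i (i + 1) \<circ> v"
  from cs consider "a = j" "b \<noteq> j'" | "b = j" "a \<noteq> j'" | "a = j'" "b \<noteq> j" | "b = j'" "a \<noteq> j"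
    | "a \<noteq> j" "a \<noteq> j'" "b \<noteq> j" "b \<noteq> j'" by blast
  then show ?thesis
  proof cases
    case 1
    then have sw: "swap a b j' = j'" "swap a b j = b" using jj by (auto simp: transpose_apply_other)
    have y: "v b \<noteq> i" "v b \<noteq> i + 1" using vp[of b] 1 ab by auto
    have u: "?u a = i + 1" "?u b = v b" using 1 s[of a] s[of b] jj ab by auto
    show ?thesis
    proof (cases "a < j' \<and> j' < b")
      case True
      then show ?thesis unfolding L R sw using coverD(1)[of v a b] coverD(2)[of v a b j'] u j y s[of j']
          1 jj by auto
    next
      case False
      then have out: "p \<noteq> j" "p \<noteq> j'" if "a < p" "p < b" for p using that 1 by auto
      have "v a < v p \<and> v p < v b \<longleftrightarrow> i + 1 < ?u p \<and> ?u p < v b" if "a < p" "p < b" for p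
        using vp[OF out[OF that]] s[of p] out[OF that] j 1 by auto
      then have "cover v a b \<longleftrightarrow> v a < v b \<and> (\<forall>p. a < p \<and> p < b \<longrightarrow> \<not> (i + 1 < ?u p \<and> ?u p < v b))"
        unfolding cover_def by blast
      moreover have "v a < v b \<longleftrightarrow> i + 1 < v b" using y j 1 by auto
      moreover have "j' \<noteq> a" "j' \<noteq> b" using 1 jj by auto
      ultimately show ?thesis unfolding L R sw cover_def u using 1 False ab by auto
    qed
  next
    case 2
    then have sw: "swap a b j' = j'" "swap a b j = a" using jj by (auto simp: transpose_apply_other)
    have y: "v a \<noteq> i" "v a \<noteq> i + 1" using vp[of a] 2 ab by auto
    have u: "?u a = v a" "?u b = i + 1" using 2 s[of a] s[of b] jj ab by auto
    show ?thesis
    proof (cases "a < j' \<and> j' < b")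
      case True
      then show ?thesis unfolding L R sw using coverD(1)[of ?u a b] coverD(2)[of ?u a b j'] u j y s[of
          j'] 2 jj by auto
    next
      case False
      then have out: "p \<noteq> j" "p \<noteq> j'" if "a < p" "p < b" for p using that 2 by auto
      have "v a < v p \<and> v p < v b \<longleftrightarrow> v a < ?u p \<and> ?u p < i + 1" if "a < p" "p < b" for p
        using vp[OF out[OF that]] s[of p] out[OF that] j 2 by auto
      then have "cover v a b \<longleftrightarrow> v a < v b \<and> (\<forall>p. a < p \<and> p < b \<longrightarrow> \<not> (v a < ?u p \<and> ?u p < i + 1))"
        unfolding cover_def by blast
      moreover have "v a < v b \<longleftrightarrow> v a < i + 1" using y j 2 by auto
      moreover have "j' \<noteq> a" "j' \<noteq> b" using 2 jj by auto
      ultimately show ?thesis unfolding L R sw cover_def u using 2 False ab by auto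
    qed
  next
    case 3
    then have sw: "swap a b j' = b" "swap a b j = j" using jj by (auto simp: transpose_apply_other)
    have y: "v b \<noteq> i" "v b \<noteq> i + 1" using vp[of b] 3 ab by auto
    have u: "?u a = i" "?u b = v b" using 3 s[of a] s[of b] jj ab by auto
    show ?thesis
    proof (cases "a < j \<and> j < b")
      case True
      then show ?thesis unfolding L R sw using coverD(1)[of ?u a b] coverD(2)[of ?u a b j] u j y s[of j]
          3 jj by auto
    next
      case False
      then have out: "p \<noteq> j" "p \<noteq> j'" if "a < p" "p < b" for p using that 3 by auto
      have "v a < v p \<and> v p < v b \<longleftrightarrow> i < ?u p \<and> ?u p < v b" if "a < p" "p < b" for p
        using vp[OF out[OF that]] s[of p] out[OF that] j 3 by auto
      then have "cover v a b \<longleftrightarrow> v a < v b \<and> (\<forall>p. a < p \<and> p < b \<longrightarrow> \<not> (i < ?u p \<and> ?u p < v b))"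
        unfolding cover_def by blast
      moreover have "v a < v b \<longleftrightarrow> i < v b" using y j 3 by auto
      moreover have "j \<noteq> a" "j \<noteq> b" using 3 jj by auto
      ultimately show ?thesis unfolding L R sw cover_def u using 3 False ab by auto
    qed
  next
    case 4
    then have sw: "swap a b j' = a" "swap a b j = j" using jj by (auto simp: transpose_apply_other)
    have y: "v a \<noteq> i" "v a \<noteq> i + 1" using vp[of a] 4 ab by auto
    have u: "?u a = v a" "?u b = i" using 4 s[of a] s[of b] jj ab by auto
    show ?thesis
    proof (cases "a < j \<and> j < b")
      case True
      then show ?thesis unfolding L R sw using coverD(1)[of v a b] coverD(2)[of v a b j] u j y s[of j] 4
          jj by auto
    next
      case False
      then have out: "p \<noteq> j" "p \<noteq> j'" if "a < p" "p < b" for p using that 4 by auto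
      have "v a < v p \<and> v p < v b \<longleftrightarrow> v a < ?u p \<and> ?u p < i" if "a < p" "p < b" for p
        using vp[OF out[OF that]] s[of p] out[OF that] j 4 by auto
      then have "cover v a b \<longleftrightarrow> v a < v b \<and> (\<forall>p. a < p \<and> p < b \<longrightarrow> \<not> (v a < ?u p \<and> ?u p < i))"
        unfolding cover_def by blast
      moreover have "v a < v b \<longleftrightarrow> v a < i" using y j 4 by auto
      moreover have "j \<noteq> a" "j \<noteq> b" using 4 jj by auto
      ultimately show ?thesis unfolding L R sw cover_def u using 4 False ab by auto
    qed
  next
    case 5
    then have sw: "swap a b j = j" "swap a b j' = j'" by (auto simp: transpose_apply_other)
    have u: "?u a = v a" "?u b = v b" using s[of a] s[of b] 5 by auto
    have "(v a < v p \<and> v p < v b) \<longleftrightarrow> (v a < ?u p \<and> ?u p < v b)" for p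
    proof -
      have "?u p = v p \<or> v p = i \<and> ?u p = i + 1 \<or> v p = i + 1 \<and> ?u p = i"
        using s[of p] j by metis
      moreover have "v a \<noteq> i" "v a \<noteq> i + 1" "v b \<noteq> i" "v b \<noteq> i + 1"
        using vp[of a] vp[of b] 5 by blast+
      ultimately show ?thesis by presburger
    qed
    then show ?thesis unfolding L R sw cover_def u by blast
  qed
qed

lemma sum_left_des:
  fixes G :: "int \<Rightarrow> int"
  shows "(\<Sum>i\<in>left_des K u. G i) = (\<Sum>i\<in>{-K..K}. of_bool (i \<in> left_des K u) * G i)"
proof -
  have "(\<Sum>i\<in>left_des K u. of_bool (i \<in> left_des K u) * G i) = (\<Sum>i\<in>{-K..K}. of_bool (i \<in> left_des K u) * G i)"
    by (rule sum.mono_neutral_left) (auto simp: left_des_def)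
  then show ?thesis by simp
qed

definition adj_sign :: "(int \<Rightarrow> int) \<Rightarrow> int \<Rightarrow> int \<Rightarrow> int" where
  "adj_sign v a b = of_bool (v b = v a + 1) - of_bool (v b = v a - 1)"

text \<open>By \<open>cover_des_iff\<close> the terms agree except for the index i with {v a, v b} =
  {i, i + 1}. If v a = i, the exchange creates the descent i and the left side has an extra
  \<open>F v\<close>. If v a = i + 1, removing the descent i creates the cover and the extra
  \<open>F v\<close> is on the right. The sign records which of the two happens.\<close>

lemma cover_commute:
  fixes F :: "(int \<Rightarrow> int) \<Rightarrow> int"
  assumes v: "bij v" and ab: "a < b" and K: "\<bar>v a\<bar> \<le> K" "\<bar>v b\<bar> \<le> K"
  shows "of_bool (cover v a b) * (\<Sum>i\<in>left_des K (v \<circ> swap a b). F (swap i (i + 1) \<circ> (v \<circ> swap a b)))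
    = (\<Sum>i\<in>left_des K v. of_bool (cover (swap i (i + 1) \<circ> v) a b) * F (swap i (i + 1) \<circ> v \<circ> swap a b))
      + adj_sign v a b * F v"
proof -
  let ?I = "{-K..K}"
  let ?G = "\<lambda>i. F (swap i (i + 1) \<circ> (v \<circ> swap a b))"
  have fin: "finite ?I" by simp
  have pt: "of_bool (cover v a b \<and> i \<in> left_des K (v \<circ> swap a b)) * ?G i
     = of_bool (i \<in> left_des K v \<and> cover (swap i (i + 1) \<circ> v) a b) * ?G i
       + (of_bool (v a = i \<and> v b = i + 1) - of_bool (v a = i + 1 \<and> v b = i)) * F v"
    if i: "i \<in> ?I" for i
  proof (cases "{v a, v b} = {i, i + 1}")
    case False
    then have "\<not> (v a = i \<and> v b = i + 1)" "\<not> (v a = i + 1 \<and> v b = i)" by auto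
    then have "(of_bool (v a = i \<and> v b = i + 1) - of_bool (v a = i + 1 \<and> v b = i)) = (0::int)" by auto
    then show ?thesis using cover_des_iff[OF v ab i False] by simp
  next
    case True
    have inj: "v p = v q \<longleftrightarrow> p = q" for p q using v by (meson bij_is_inj inj_eq)
    have surj: "inv v (v p) = p" for p using v by (simp add: bij_is_inj)
    have G: "?G i = F v"
    proof -
      have "swap i (i + 1) \<circ> (v \<circ> swap a b) = v"
        using True ab by (auto simp: fun_eq_iff Transposition.transpose_def doubleton_eq_iff)
          (metis inj)+
      then show ?thesis by simp
    qed
    from True consider "v a = i" "v b = i + 1" | "v a = i + 1" "v b = i"
      by (auto simp: doubleton_eq_iff)
    then show ?thesis
    proof cases
      case 1
      have "inv v i = a" "inv v (i + 1) = b" using 1 surj by metis+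
      then have "i \<notin> left_des K v" "i \<in> left_des K (v \<circ> swap a b)"
        using ab i v by (auto simp: left_des_def inv_comp_swap)
      moreover have "cover v a b" using 1 by (auto simp: cover_def)
      ultimately show ?thesis using G 1 by simp
    next
      case 2
      have ii: "inv v i = b" "inv v (i + 1) = a" using 2 surj by metis+
      then have "i \<in> left_des K v" using ab i v by (auto simp: left_des_def inv_comp_swap)
      moreover have "\<not> cover v a b" using 2 by (auto simp: cover_def)
      moreover have "cover (swap i (i + 1) \<circ> v) a b" using 2 by (auto simp: cover_def)
      ultimately show ?thesis using G 2 by simp
    qed
  qed
  have "of_bool (cover v a b) * (\<Sum>i\<in>left_des K (v \<circ> swap a b). ?G i)
      = (\<Sum>i\<in>?I. of_bool (cover v a b \<and> i \<in> left_des K (v \<circ> swap a b)) * ?G i)"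
    unfolding sum_left_des by (simp add: sum_distrib_left of_bool_conj mult.assoc)
  also have "\<dots> = (\<Sum>i\<in>?I. of_bool (i \<in> left_des K v \<and> cover (swap i (i + 1) \<circ> v) a b) * ?G i
       + (of_bool (v a = i \<and> v b = i + 1) - of_bool (v a = i + 1 \<and> v b = i)) * F v)"
    by (rule sum.cong[OF refl]) (rule pt)
  also have "\<dots> = (\<Sum>i\<in>?I. of_bool (i \<in> left_des K v \<and> cover (swap i (i + 1) \<circ> v) a b) * ?G i)
       + (\<Sum>i\<in>?I. of_bool (v a = i \<and> v b = i + 1) - of_bool (v a = i + 1 \<and> v b = i)) * F v"
    by (simp only: sum.distrib sum_distrib_right)
  also have "(\<Sum>i\<in>?I. of_bool (i \<in> left_des K v \<and> cover (swap i (i + 1) \<circ> v) a b) * ?G i)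
     = (\<Sum>i\<in>left_des K v. of_bool (cover (swap i (i + 1) \<circ> v) a b) * F (swap i (i + 1) \<circ> v \<circ> swap a b))"
    unfolding sum_left_des by (simp add: of_bool_conj mult.assoc o_assoc)
  also have "(\<Sum>i\<in>?I. of_bool (v a = i \<and> v b = i + 1) - of_bool (v a = i + 1 \<and> v b = i)) = adj_sign v a b"
  proof -
    have "(\<Sum>i\<in>?I. of_bool (v a = i \<and> v b = i + 1)) = (of_bool (v b = v a + 1) :: int)"
      using K by (subst sum.mono_neutral_right[of _ "{v a}"]) auto
    moreover have "(\<Sum>i\<in>?I. of_bool (v a = i + 1 \<and> v b = i)) = (of_bool (v b = v a - 1) :: int)"
      using K by (subst sum.mono_neutral_right[of _ "{v b}"]) auto
    ultimately show ?thesis by (simp add: sum_subtractf adj_sign_def)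
  qed
  finally show ?thesis .
qed

text \<open>With x = v a and y = v b, only the order of x and y relative to their neighbouring
  values can change. The cover condition keeps x + 1 and y - 1 from lying strictly between a and b.
  A descent is lost for x - 1 and for y + 1 lying between, and one is gained if y = x + 1. For x =
  -K the index x - 1 is outside the range of \<open>left_des\<close>, so \<open>lo\<close> excludes
  that loss.\<close>

lemma card_left_des_cover:
  fixes v :: "int \<Rightarrow> int"
  assumes v: "bij v" and ab: "a < b" and c: "cover v a b" and K: "\<bar>v a\<bar> \<le> K" "\<bar>v b\<bar> \<le> K"
    and lo: "v a = -K \<Longrightarrow> inv v (-K - 1) < a"
  shows "int (card (left_des K (v \<circ> swap a b)))
      + of_bool (a < inv v (v a - 1) \<and> inv v (v a - 1) < b) + of_bool (a < inv v (v b + 1) \<and> inv v (v b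
          + 1) < b)
    = int (card (left_des K v)) + of_bool (v b = v a + 1)"
proof -
  let ?I = "{-K..K}"
  have inj: "v p = v q \<longleftrightarrow> p = q" for p q using v by (meson bij_is_inj inj_eq)
  have iv: "inv v (v p) = p" for p using v by (simp add: bij_is_inj)
  have vi: "v (inv v i) = i" for i using v by (simp add: bij_is_surj surj_f_inv_f)
  have xy: "v a < v b" using coverD(1)[OF c] .
  have cov: "v p \<le> v a \<or> v b \<le> v p" if "a < p" "p < b" for p using coverD(2)[OF c that] .
  have pt: "of_bool (i \<in> left_des K (v \<circ> swap a b)) + of_bool (i
      = v a - 1 \<and> a < inv v (v a - 1) \<and> inv v (v a - 1) < b)
      + of_bool (i = v b \<and> a < inv v (v b + 1) \<and> inv v (v b + 1) < b)
    = of_bool (i \<in> left_des K v) + (of_bool (i = v a \<and> v b = v a + 1) :: int)" if i: "i \<in> ?I" for i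
  proof -
    define j where "j = inv v i"
    define j' where "j' = inv v (i + 1)"
    have j: "v j = i" "v j' = i + 1" by (simp_all add: j_def j'_def vi)
    have jj: "j \<noteq> j'" using j by auto
    have L: "i \<in> left_des K v \<longleftrightarrow> j' < j" using i by (simp add: left_des_def j_def j'_def)
    have R: "i \<in> left_des K (v \<circ> swap a b) \<longleftrightarrow> swap a b j' < swap a b j"
      using i v by (simp add: left_des_def inv_comp_swap j_def j'_def)
    consider "j = a" "j' = b" | "j = a" "j' \<noteq> b" | "j' = a" | "j = b" | "j' = b" "j \<noteq> a"
      | "j \<noteq> a" "j \<noteq> b" "j' \<noteq> a" "j' \<noteq> b" by blast
    then show ?thesis
    proof cases
      case 1
      then show ?thesis unfolding L R using j ab by auto
    next
      case 2
      then have "swap a b j' = j'" "swap a b j = b" using jj by (auto simp: transpose_apply_other)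
      moreover have "v b \<noteq> v a + 1" using 2 j inj by metis
      moreover have "\<not> (a < j' \<and> j' < b)" using cov[of j'] 2 j xy calculation by auto
      ultimately show ?thesis unfolding L R using 2 j ab xy jj by auto
    next
      case 3
      then have "j \<noteq> b" using j xy by auto
      then have "swap a b j' = b" "swap a b j = j" using 3 jj by (auto simp: transpose_apply_other)
      moreover have "i = v a - 1" "inv v (v a - 1) = j" using 3 j j_def by auto
      ultimately show ?thesis unfolding L R using \<open>j \<noteq> b\<close> 3 ab xy jj by auto
    next
      case 4
      then have "j' \<noteq> a" using j xy by auto
      then have "swap a b j' = j'" "swap a b j = a" using 4 jj by (auto simp: transpose_apply_other)
      moreover have "i = v b" "inv v (v b + 1) = j'" using 4 j j'_def by auto
      ultimately show ?thesis unfolding L R using \<open>j' \<noteq> a\<close> 4 ab xy jj by auto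
    next
      case 5
      then have "swap a b j' = a" "swap a b j = j" using jj by (auto simp: transpose_apply_other)
      moreover have "v a \<noteq> i" using 5 j inj by metis
      moreover have "\<not> (a < j \<and> j < b)" using cov[of j] 5 j xy calculation by auto
      ultimately show ?thesis unfolding L R using 5 j ab xy jj by auto
    next
      case 6
      then have "swap a b j' = j'" "swap a b j = j" by (auto simp: transpose_apply_other)
      moreover have "i \<noteq> v a" "i \<noteq> v b" "i \<noteq> v a - 1"
        using 6 j inj by (metis diff_add_cancel)+
      ultimately show ?thesis unfolding L R by auto
    qed
  qed
  have C: "int (card (left_des K u)) = (\<Sum>i\<in>?I. of_bool (i \<in> left_des K u))" for u
    using sum_left_des[of "\<lambda>_. 1" K u] by simp
  have S: "(\<Sum>i\<in>?I. of_bool (i = k \<and> P)) = (of_bool P :: int)" if "k \<in> ?I" for k P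
    using that by (subst sum.mono_neutral_right[of _ "{k}"]) auto
  have S1: "(\<Sum>i\<in>?I. of_bool (i = v a - 1 \<and> a < inv v (v a - 1) \<and> inv v (v a - 1) < b))
      = (of_bool (a < inv v (v a - 1) \<and> inv v (v a - 1) < b) :: int)"
  proof (cases "v a = -K")
    case True
    then show ?thesis using lo by auto
  next
    case False
    then show ?thesis using K by (intro S) auto
  qed
  have I: "v a \<in> ?I" "v b \<in> ?I" using K by auto
  have "(\<Sum>i\<in>?I. of_bool (i \<in> left_des K (v \<circ> swap a b)) + of_bool (i
      = v a - 1 \<and> a < inv v (v a - 1) \<and> inv v (v a - 1) < b)
      + of_bool (i = v b \<and> a < inv v (v b + 1) \<and> inv v (v b + 1) < b))
    = (\<Sum>i\<in>?I. of_bool (i \<in> left_des K v) + (of_bool (i = v a \<and> v b = v a + 1) :: int))"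
    by (rule sum.cong[OF refl]) (rule pt)
  then show ?thesis
    unfolding sum.distrib C[symmetric] S1 S[OF I(1)] S[OF I(2)] .
qed

text \<open>
  In \<open>chain_count K m v\<close> the number \<open>m\<close> has to be the length of \<open>v\<close> (otherwise the count is \<open>0\<close>), and in
  \<open>des_count K m v\<close> it has to be the length plus one.
\<close>

primrec chain_count :: "int \<Rightarrow> nat \<Rightarrow> (int \<Rightarrow> int) \<Rightarrow> int" where
  "chain_count K 0 v = of_bool (v = id)"
| "chain_count K (Suc m) v = (\<Sum>i\<in>left_des K v. chain_count K m (swap i (i + 1) \<circ> v))"

primrec des_count :: "int \<Rightarrow> nat \<Rightarrow> (int \<Rightarrow> int) \<Rightarrow> int" where
  "des_count K 0 v = 0"
| "des_count K (Suc m) v = int (card (left_des K v)) * chain_count K m v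
     + (\<Sum>i\<in>left_des K v. des_count K m (swap i (i + 1) \<circ> v))"

section \<open>Sums over covers and their commutators with a descent step\<close>

definition pair_cover :: "(int \<Rightarrow> int) \<Rightarrow> int \<times> int \<Rightarrow> bool" where
  "pair_cover v p = cover v (fst p) (snd p)"

definition pair_swap :: "(int \<Rightarrow> int) \<Rightarrow> int \<times> int \<Rightarrow> int \<Rightarrow> int" where
  "pair_swap v p = v \<circ> swap (fst p) (snd p)"

definition pair_sign :: "(int \<Rightarrow> int) \<Rightarrow> int \<times> int \<Rightarrow> int" where
  "pair_sign v p = adj_sign v (fst p) (snd p)"

definition cover_sum :: "(int \<times> int) set \<Rightarrow> ((int \<Rightarrow> int) \<Rightarrow> int) \<Rightarrow> (int \<Rightarrow> int) \<Rightarrow> int" where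
  "cover_sum P F v = (\<Sum>p\<in>P. of_bool (pair_cover v p) * F (pair_swap v p))"

text \<open>The second-order correction. It is introduced for its commutator: this is a sum over
  single covers, whose weights compensate for the different descent numbers of the covers.\<close>

definition cover_sum2 :: "(int \<times> int) set \<Rightarrow> (int \<times> int \<Rightarrow> (int \<times> int) set) \<Rightarrow> ((int \<Rightarrow> int) \<Rightarrow> int) \<Rightarrow> (int \<Rightarrow>
    int) \<Rightarrow> int" where
  "cover_sum2 P Q F v = (\<Sum>p\<in>P. of_bool (pair_cover v p) * cover_sum (Q p) F (pair_swap v p))"

lemma pair_commute:
  fixes F :: "(int \<Rightarrow> int) \<Rightarrow> int"
  assumes "v permutes {-K..K}" and "p \<in> {-K..K} \<times> {-K..K}" "fst p < snd p"
  shows "of_bool (pair_cover v p) * (\<Sum>i\<in>left_des K (pair_swap v p). F (swap i (i + 1) \<circ> pair_swap v p))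
    = (\<Sum>i\<in>left_des K v. of_bool (pair_cover (swap i (i + 1) \<circ> v) p) * F (pair_swap (swap i (i + 1) \<circ> v) p))
      + pair_sign v p * F v"
proof -
  have "\<bar>v x\<bar> \<le> K" if "x \<in> {-K..K}" for x
    using permutes_in_image[OF assms(1), of x] that by auto
  then show ?thesis unfolding pair_cover_def pair_swap_def pair_sign_def
    using assms by (intro cover_commute) (auto simp: permutes_bij)
qed

lemma cover_sum_step:
  assumes v: "v permutes {-K..K}" and P: "P \<subseteq> {-K..K} \<times> {-K..K}" "\<And>p. p \<in> P \<Longrightarrow> fst p < snd p"
  shows "cover_sum P (\<lambda>u. \<Sum>i\<in>left_des K u. F (swap i (i + 1) \<circ> u)) v
    = (\<Sum>i\<in>left_des K v. cover_sum P F (swap i (i + 1) \<circ> v)) + (\<Sum>p\<in>P. pair_sign v p) * F v"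
proof -
  have "cover_sum P (\<lambda>u. \<Sum>i\<in>left_des K u. F (swap i (i + 1) \<circ> u)) v
    = (\<Sum>p\<in>P. (\<Sum>i\<in>left_des K v. of_bool (pair_cover (swap i (i + 1) \<circ> v) p) * F (pair_swap (swap i (i
        + 1) \<circ> v) p))
      + pair_sign v p * F v)"
    unfolding cover_sum_def by (rule sum.cong[OF refl], rule pair_commute[OF v]) (use P in auto)
  also have "\<dots> = (\<Sum>i\<in>left_des K v. cover_sum P F (swap i (i + 1) \<circ> v)) + (\<Sum>p\<in>P. pair_sign v p) * F v"
    unfolding cover_sum_def sum.distrib sum_distrib_right[symmetric] by (simp only: sum.swap[of _ P])
  finally show ?thesis .
qed

lemma pair_swap_permutes:
  assumes "v permutes {-K..K}" "p \<in> {-K..K} \<times> {-K..K}"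
  shows "pair_swap v p permutes {-K..(K::int)}"
  using assms unfolding pair_swap_def
  by (intro permutes_compose permutes_swap_id) auto

text \<open>Both covers are commuted in turn. A sign from the inner pair p' leaves the outer cover
  p. A sign from the outer pair p'' leaves a sum over the inner pairs, which is reindexed by its
  inner pair p. So every p collects the signs of the pairs inside it, after the exchange, and of the
  pairs that contain it, before the exchange.\<close>

lemma cover_sum2_step:
  assumes v: "v permutes {-K..K}" and P: "P \<subseteq> {-K..K} \<times> {-K..K}" "\<And>p. p \<in> P \<Longrightarrow> fst p < snd p"
    and Q: "\<And>p. p \<in> P \<Longrightarrow> Q p \<subseteq> P"
  shows "cover_sum2 P Q (\<lambda>u. \<Sum>i\<in>left_des K u. F (swap i (i + 1) \<circ> u)) v
    = (\<Sum>i\<in>left_des K v. cover_sum2 P Q F (swap i (i + 1) \<circ> v))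

      + (\<Sum>p\<in>P. of_bool (pair_cover v p) * F (pair_swap v p) *
          ((\<Sum>p'\<in>Q p. pair_sign (pair_swap v p) p') + (\<Sum>p''\<in>{p''\<in>P. p \<in> Q p''}. pair_sign v p'')))"
proof -
  have finP: "finite P" using P(1) finite_subset by fastforce
  have Q': "Q p \<subseteq> {-K..K} \<times> {-K..K}" "p' \<in> Q p \<Longrightarrow> fst p' < snd p'" if "p \<in> P" for p p'
    using Q[OF that] P by blast+
  have P': "pair_swap v p permutes {-K..K}" if "p \<in> P" for p
    using pair_swap_permutes[OF v] that P(1) by blast
  have "cover_sum2 P Q (\<lambda>u. \<Sum>i\<in>left_des K u. F (swap i (i + 1) \<circ> u)) v
    = (\<Sum>p\<in>P. of_bool (pair_cover v p) * ((\<Sum>i\<in>left_des K (pair_swap v p). cover_sum (Q p) F (swap i (i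
        + 1) \<circ> pair_swap v p))
       + (\<Sum>p'\<in>Q p. pair_sign (pair_swap v p) p') * F (pair_swap v p)))"
    unfolding cover_sum2_def
    by (intro sum.cong[OF refl] arg_cong2[of _ _ _ _ "(*)"] cover_sum_step[OF P' Q'(1) Q'(2)] refl)
  also have "\<dots> = (\<Sum>p\<in>P. (\<Sum>i\<in>left_des K v. of_bool (pair_cover (swap i (i
      + 1) \<circ> v) p) * cover_sum (Q p) F (pair_swap (swap i (i + 1) \<circ> v) p))
       + pair_sign v p * cover_sum (Q p) F v
       + of_bool (pair_cover v p) * F (pair_swap v p) * (\<Sum>p'\<in>Q p. pair_sign (pair_swap v p) p'))"
  proof (rule sum.cong[OF refl])
    fix p assume p: "p \<in> P"
    then have p': "p \<in> {-K..K} \<times> {-K..K}" using P by blast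
    show "of_bool (pair_cover v p) * ((\<Sum>i\<in>left_des K (pair_swap v p). cover_sum (Q p) F (swap i (i
        + 1) \<circ> pair_swap v p))
       + (\<Sum>p'\<in>Q p. pair_sign (pair_swap v p) p') * F (pair_swap v p))
      = (\<Sum>i\<in>left_des K v. of_bool (pair_cover (swap i (i + 1) \<circ> v) p) * cover_sum (Q p) F (pair_swap
          (swap i (i + 1) \<circ> v) p))
       + pair_sign v p * cover_sum (Q p) F v
       + of_bool (pair_cover v p) * F (pair_swap v p) * (\<Sum>p'\<in>Q p. pair_sign (pair_swap v p) p')"
      unfolding pair_commute[OF v p' P(2)[OF p], of "cover_sum (Q p) F", symmetric]
      by (simp add: algebra_simps)
  qed
  also have "\<dots> = (\<Sum>i\<in>left_des K v. cover_sum2 P Q F (swap i (i + 1) \<circ> v))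
      + (\<Sum>p\<in>P. pair_sign v p * cover_sum (Q p) F v)
      + (\<Sum>p\<in>P. of_bool (pair_cover v p) * F (pair_swap v p) * (\<Sum>p'\<in>Q p. pair_sign (pair_swap v p) p'))"
    unfolding cover_sum2_def sum.distrib by (simp only: sum.swap[of _ P])
  also have "(\<Sum>p\<in>P. pair_sign v p * cover_sum (Q p) F v)
     = (\<Sum>p\<in>P. \<Sum>p'\<in>P. of_bool (p' \<in> Q p) * pair_sign v p * (of_bool (pair_cover v p') * F (pair_swap v p')))"
  proof (rule sum.cong[OF refl])
    fix p assume p: "p \<in> P"
    have "cover_sum (Q p) F v = (\<Sum>p'\<in>Q p. of_bool (p' \<in> Q p) * (of_bool (pair_cover v p') * F (pair_swap
        v p')))"
      unfolding cover_sum_def by (rule sum.cong) auto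
    also have "\<dots> = (\<Sum>p'\<in>P. of_bool (p' \<in> Q p) * (of_bool (pair_cover v p') * F (pair_swap v p')))"
      using Q[OF p] finP by (intro sum.mono_neutral_left) auto
    finally show "pair_sign v p * cover_sum (Q p) F v
       = (\<Sum>p'\<in>P. of_bool (p' \<in> Q p) * pair_sign v p * (of_bool (pair_cover v p') * F (pair_swap v p')))"
      by (simp add: sum_distrib_left algebra_simps)
  qed
  also have "\<dots> = (\<Sum>p'\<in>P. \<Sum>p\<in>P. of_bool (p' \<in> Q p) * pair_sign v p * (of_bool (pair_cover v p') * F
      (pair_swap v p')))"
    by (rule sum.swap)
  also have "\<dots> = (\<Sum>p\<in>P. of_bool (pair_cover v p) * F (pair_swap v p) * (\<Sum>p''\<in>{p''\<in>P. p \<in> Q p''}.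
      pair_sign v p''))"
  proof (rule sum.cong[OF refl])
    fix p' assume "p' \<in> P"
    have "(\<Sum>p''\<in>{p''\<in>P. p' \<in> Q p''}. pair_sign v p'') = (\<Sum>p\<in>P. of_bool (p' \<in> Q p) * pair_sign v p)"
      unfolding sum.inter_filter[OF finP] by (rule sum.cong) auto
    then show "(\<Sum>p\<in>P. of_bool (p' \<in> Q p) * pair_sign v p * (of_bool (pair_cover v p') * F (pair_swap v p')))
      = of_bool (pair_cover v p') * F (pair_swap v p') * (\<Sum>p''\<in>{p''\<in>P. p' \<in> Q p''}. pair_sign v p'')"
      by (simp add: sum_distrib_left sum_distrib_right algebra_simps)
  qed
  finally show ?thesis
    unfolding distrib_left sum.distrib by (simp only: add.commute add.left_commute add.assoc)
qed

text \<open>Outside the window v is the identity, so a value in the window and one outside never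
  form a descent.\<close>

lemma left_des_permutes:
  assumes v: "v permutes {-M..M}" and i: "i \<in> left_des K v"
  shows "swap i (i + 1) \<circ> v permutes {-M..M}"
proof -
  have inv_v: "inv v permutes {-M..M}" using v by (rule permutes_inv)
  have d: "inv v (i + 1) < inv v i" using i by (simp add: left_des_def)
  have fix_out: "inv v x = x" if "x \<notin> {-M..M}" for x using permutes_not_in[OF inv_v that] .
  have mem: "inv v x \<in> {-M..M} \<longleftrightarrow> x \<in> {-M..M}" for x using permutes_in_image[OF inv_v] .
  have "i \<in> {-M..M} \<and> i + 1 \<in> {-M..M}"
  proof (rule ccontr)
    assume a: "\<not> (i \<in> {-M..M} \<and> i + 1 \<in> {-M..M})"
    show False using a d fix_out[of i] fix_out[of "i + 1"] mem[of i] mem[of "i + 1"]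
      by (cases "i \<in> {-M..M}"; cases "i + 1 \<in> {-M..M}") auto
  qed
  then show ?thesis using v by (intro permutes_compose permutes_swap_id) auto
qed

lemma pair_swap_not_id:
  assumes "fst p < snd p" "pair_cover v p" shows "pair_swap v p \<noteq> id"
proof
  assume "pair_swap v p = id"
  then have "v (fst p) = snd p" "v (snd p) = fst p"
    unfolding pair_swap_def by (metis comp_apply id_apply transpose_apply_first transpose_apply_second)+
  then show False using assms coverD(1)[of v "fst p" "snd p"] unfolding pair_cover_def by auto
qed

section \<open>Covers through a fixed position, to the right and to the left\<close>

definition pairs_right :: "int \<Rightarrow> int \<Rightarrow> (int \<times> int) set" where
  "pairs_right K r = {r} \<times> {r<..K}"

definition pairs_left :: "int \<Rightarrow> int \<Rightarrow> (int \<times> int) set" where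
  "pairs_left K r = {-K..<r} \<times> {r}"

definition next_right :: "int \<times> int \<Rightarrow> (int \<times> int) set" where
  "next_right p = {fst p} \<times> {fst p<..<snd p}"

definition next_left :: "int \<times> int \<Rightarrow> (int \<times> int) set" where
  "next_left p = {fst p<..<snd p} \<times> {snd p}"

text \<open>
  The neighbouring values contribute this same sign on the right and on the left of \<open>r\<close>.
\<close>

definition side_sign :: "(int \<Rightarrow> int) \<Rightarrow> int \<Rightarrow> int" where
  "side_sign v r = of_bool (r < inv v (v r + 1)) - of_bool (r < inv v (v r - 1))"

lemma sum_eq_val:
  fixes v :: "int \<Rightarrow> int"
  assumes "bij v" "finite A"
  shows "(\<Sum>s\<in>A. of_bool (v s = t)) = (of_bool (inv v t \<in> A) :: int)"
proof -
  have "v s = t \<longleftrightarrow> s = inv v t" for s using assms(1) by (metis bij_inv_eq_iff)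
  then show ?thesis using assms(2) by (simp add: of_bool_def sum.delta)
qed

lemma sum_row:
  fixes f :: "'a \<times> 'b \<Rightarrow> int"
  shows "(\<Sum>p\<in>{a} \<times> B. f p) = (\<Sum>b\<in>B. f (a, b))"
  by (rule sum.reindex_cong[of "Pair a"]) (auto simp: inj_on_def)

lemma sum_column:
  fixes f :: "'a \<times> 'b \<Rightarrow> int"
  shows "(\<Sum>p\<in>A \<times> {b}. f p) = (\<Sum>a\<in>A. f (a, b))"
  by (rule sum.reindex_cong[of "\<lambda>a. (a, b)"]) (auto simp: inj_on_def)

context
  fixes v :: "int \<Rightarrow> int" and M K r :: int
  assumes v: "v permutes {-M..M}" and r: "\<bar>r\<bar> \<le> M" and MK: "M < K"
begin

lemma window_bij: "bij v" using v by (rule permutes_bij)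

lemma window_permutes: "v permutes {-K..K}" by (rule permutes_subset[OF v]) (use MK in auto)

lemma window_value_bound: "\<bar>v r\<bar> \<le> M"
  using permutes_in_image[OF v, of r] r by auto

lemma window_inv_bound: "\<bar>x\<bar> \<le> K \<Longrightarrow> \<bar>inv v x\<bar> \<le> K"
  using permutes_in_image[OF permutes_inv[OF window_permutes], of x] by auto

lemma window_bound: "\<bar>x\<bar> \<le> K \<Longrightarrow> \<bar>v x\<bar> \<le> K"
  using permutes_in_image[OF window_permutes, of x] by auto

lemma window_inv_eq_iff: "inv v x = p \<longleftrightarrow> x = v p" using window_bij by (metis bij_inv_eq_iff)

text \<open>The strict inequality M < K leaves room for both neighbours of the value
  \<open>v r\<close>, so the sums over the window miss neither of them.\<close>

lemma inv_neighbour_bound: "\<bar>inv v (v r + 1)\<bar> \<le> K" "\<bar>inv v (v r - 1)\<bar> \<le> K"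
  by (intro window_inv_bound; use window_value_bound MK in linarith)+

lemma sign_right: "(\<Sum>p\<in>pairs_right K r. pair_sign v p) = side_sign v r"
proof -
  have "(\<Sum>p\<in>pairs_right K r. pair_sign v p) = (\<Sum>s\<in>{r<..K}. of_bool (v s = v r + 1) - of_bool (v s = v r - 1))"
    unfolding pairs_right_def by (simp add: sum_row pair_sign_def adj_sign_def)
  also have "\<dots> = of_bool (inv v (v r + 1) \<in> {r<..K}) - of_bool (inv v (v r - 1) \<in> {r<..K})"
    unfolding sum_subtractf by (simp only: sum_eq_val[OF window_bij finite_greaterThanAtMost_int])
  finally show ?thesis
    using inv_neighbour_bound by (auto simp: side_sign_def)
qed

text \<open>Each of the two neighbouring values is on exactly one side of r. Replacing "left" by
  "not right" in both terms changes them by the same constant and reverses the signs, so the value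
  is the one from the right.\<close>

lemma sign_left: "(\<Sum>p\<in>pairs_left K r. pair_sign v p) = side_sign v r"
proof -
  have "(\<Sum>p\<in>pairs_left K r. pair_sign v p) = (\<Sum>s\<in>{-K..<r}. of_bool (v s = v r - 1) - of_bool (v s = v r + 1))"
    unfolding pairs_left_def
    unfolding sum_column pair_sign_def adj_sign_def fst_conv snd_conv
    by (intro sum.cong refl) (auto simp: of_bool_def)
  also have "\<dots> = of_bool (inv v (v r - 1) \<in> {-K..<r}) - of_bool (inv v (v r + 1) \<in> {-K..<r})"
    unfolding sum_subtractf by (simp only: sum_eq_val[OF window_bij finite_atLeastLessThan_int])
  finally show ?thesis
    using inv_neighbour_bound window_inv_eq_iff[of "v r + 1" r] window_inv_eq_iff[of "v r - 1" r]
    by (auto simp: side_sign_def)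
qed

text \<open>Let x = v r and y = v s. The cover loses a descent for x - 1 and for y + 1 between r and
  s, and gains one if y = x + 1. The inner pairs restore the term of y + 1, because y is now at r.
  The pairs with a farther partner supply x + 1 and x - 1 beyond s. What is left are the signs of x
  + 1 and x - 1 over the whole right side, which do not depend on s.\<close>

lemma des_right:
  assumes p: "p \<in> pairs_right K r" and c: "pair_cover v p"
  shows "int (card (left_des K (pair_swap v p))) + (\<Sum>p'\<in>next_right p. pair_sign (pair_swap v p) p')
    + (\<Sum>p''\<in>{p''\<in>pairs_right K r. p \<in> next_right p''}. pair_sign v p'')
    = int (card (left_des K v)) + side_sign v r"
proof -
  obtain s where s: "p = (r, s)" "r < s" "s \<le> K" using p by (auto simp: pairs_right_def)
  have c: "cover v r s" using c s by (simp add: pair_cover_def)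
  define x where "x = v r"
  define y where "y = v s"
  have xy: "x < y" "\<bar>x\<bar> \<le> M" "\<bar>y\<bar> \<le> K"
    using coverD(1)[OF c] window_value_bound window_bound[of s] s r MK by (auto simp: x_def y_def)
  have cov: "\<not> (r < inv v z \<and> inv v z < s)" if "x < z" "z < y" for z
    using coverD(2)[OF c, of "inv v z"] that window_inv_eq_iff[of z "inv v z"] by (auto simp: x_def y_def)
  have 1: "int (card (left_des K (pair_swap v p))) + of_bool (r < inv v (x - 1) \<and> inv v (x - 1) < s)
      + of_bool (r < inv v (y + 1) \<and> inv v (y + 1) < s) = int (card (left_des K v)) + of_bool (y = x + 1)"
    unfolding pair_swap_def s fst_conv snd_conv x_def y_def
    by (rule card_left_des_cover[OF window_bij s(2) c]) (use xy MK in \<open>auto simp: x_def y_def\<close>)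
  have "(\<Sum>p'\<in>next_right p. pair_sign (pair_swap v p) p') = (\<Sum>s'\<in>{r<..<s}. of_bool (v s'
      = y + 1) - of_bool (v s' = y - 1))"
    unfolding next_right_def s fst_conv snd_conv sum_row
    using s(2) by (auto simp: pair_sign_def adj_sign_def pair_swap_def transpose_apply_other y_def s
        intro!: sum.cong)
  also have "\<dots> = of_bool (inv v (y + 1) \<in> {r<..<s}) - of_bool (inv v (y - 1) \<in> {r<..<s})"
    unfolding sum_subtractf by (simp only: sum_eq_val[OF window_bij finite_greaterThanLessThan_int])
  \<comment> \<open>The value y - 1 is x itself or is kept out of the gap by the cover
    condition.\<close>
  also have "\<dots> = of_bool (inv v (y + 1) \<in> {r<..<s})"
    using cov[of "y - 1"] xy window_inv_eq_iff[of "y - 1" r] by (cases "y - 1 = x") (auto simp: x_def)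
  finally have 2: "(\<Sum>p'\<in>next_right p. pair_sign (pair_swap v p) p')
      = of_bool (r < inv v (y + 1) \<and> inv v (y + 1) < s)"
    by auto
  have "{p''\<in>pairs_right K r. p \<in> next_right p''} = {r} \<times> {s<..K}"
    using s by (auto simp: pairs_right_def next_right_def)
  then have "(\<Sum>p''\<in>{p''\<in>pairs_right K r. p \<in> next_right p''}. pair_sign v p'')
    = (\<Sum>s'\<in>{s<..K}. of_bool (v s' = x + 1) - of_bool (v s' = x - 1))"
    by (simp add: sum_row pair_sign_def adj_sign_def x_def)
  also have "\<dots> = of_bool (inv v (x + 1) \<in> {s<..K}) - of_bool (inv v (x - 1) \<in> {s<..K})"
    unfolding sum_subtractf by (simp only: sum_eq_val[OF window_bij finite_greaterThanAtMost_int])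
  finally have 3: "(\<Sum>p''\<in>{p''\<in>pairs_right K r. p \<in> next_right p''}. pair_sign v p'')
    = of_bool (s < inv v (x + 1)) - of_bool (s < inv v (x - 1))"
    using inv_neighbour_bound by (auto simp: x_def)
  have "side_sign v r = of_bool (y = x + 1) - of_bool (r < inv v (x - 1) \<and> inv v (x - 1) < s)
      + of_bool (s < inv v (x + 1)) - of_bool (s < inv v (x - 1))"
    using cov[of "x + 1"] window_inv_eq_iff[of "x + 1" s] window_inv_eq_iff[of "x - 1" s] s(2) xy
    unfolding side_sign_def x_def[symmetric] y_def[symmetric] by (auto simp: of_bool_def)
  then show ?thesis using 1 2 3 by linarith
qed

text \<open>Mirror image of \<open>des_right\<close>: now the smaller value y comes from the left,
  and the inner pairs restore the term of y - 1.\<close>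

lemma des_left:
  assumes p: "p \<in> pairs_left K r" and c: "pair_cover v p"
  shows "int (card (left_des K (pair_swap v p))) + (\<Sum>p'\<in>next_left p. pair_sign (pair_swap v p) p')
    + (\<Sum>p''\<in>{p''\<in>pairs_left K r. p \<in> next_left p''}. pair_sign v p'')
    = int (card (left_des K v)) + side_sign v r"
proof -
  obtain q where q: "p = (q, r)" "q < r" "-K \<le> q" using p by (auto simp: pairs_left_def)
  have c: "cover v q r" using c q by (simp add: pair_cover_def)
  define x where "x = v r"
  define y where "y = v q"
  have xy: "y < x" "\<bar>x\<bar> \<le> M" "\<bar>y\<bar> \<le> K"
    using coverD(1)[OF c] window_value_bound window_bound[of q] q r MK by (auto simp: x_def y_def)
  have cov: "\<not> (q < inv v z \<and> inv v z < r)" if "y < z" "z < x" for z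
    using coverD(2)[OF c, of "inv v z"] that window_inv_eq_iff[of z "inv v z"] by (auto simp: x_def y_def)
  \<comment> \<open>Here the smaller value may be -K, so the boundary condition of
    \<open>card_left_des_cover\<close> is not vacuous; it holds since -K - 1 is a fixed point left
    of the window.\<close>
  have lo: "inv v (-K - 1) = -K - 1"
    by (rule permutes_not_in[OF permutes_inv[OF window_permutes]]) auto
  have 1: "int (card (left_des K (pair_swap v p))) + of_bool (q < inv v (y - 1) \<and> inv v (y - 1) < r)
      + of_bool (q < inv v (x + 1) \<and> inv v (x + 1) < r) = int (card (left_des K v)) + of_bool (x = y + 1)"
    unfolding pair_swap_def q fst_conv snd_conv x_def y_def
    by (rule card_left_des_cover[OF window_bij q(2) c]) (use xy MK lo q in \<open>auto simp: x_def y_def\<close>)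
  have "(\<Sum>p'\<in>next_left p. pair_sign (pair_swap v p) p') = (\<Sum>s'\<in>{q<..<r}. of_bool (v s'
      = y - 1) - of_bool (v s' = y + 1))"
    unfolding next_left_def q fst_conv snd_conv sum_column
    using q(2) by (auto simp: pair_sign_def adj_sign_def pair_swap_def transpose_apply_other y_def q
        intro!: sum.cong)
  also have "\<dots> = of_bool (inv v (y - 1) \<in> {q<..<r}) - of_bool (inv v (y + 1) \<in> {q<..<r})"
    unfolding sum_subtractf by (simp only: sum_eq_val[OF window_bij finite_greaterThanLessThan_int])
  also have "\<dots> = of_bool (inv v (y - 1) \<in> {q<..<r})"
    using cov[of "y + 1"] xy window_inv_eq_iff[of "y + 1" r] by (cases "y + 1 = x") (auto simp: x_def)
  finally have 2: "(\<Sum>p'\<in>next_left p. pair_sign (pair_swap v p) p')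
      = of_bool (q < inv v (y - 1) \<and> inv v (y - 1) < r)"
    by auto
  have "{p''\<in>pairs_left K r. p \<in> next_left p''} = {-K..<q} \<times> {r}"
    using q by (auto simp: pairs_left_def next_left_def)
  then have "(\<Sum>p''\<in>{p''\<in>pairs_left K r. p \<in> next_left p''}. pair_sign v p'')
    = (\<Sum>s'\<in>{-K..<q}. of_bool (v s' = x - 1) - of_bool (v s' = x + 1))"
    by (auto simp: sum_column pair_sign_def adj_sign_def x_def intro!: sum.cong)
  also have "\<dots> = of_bool (inv v (x - 1) \<in> {-K..<q}) - of_bool (inv v (x + 1) \<in> {-K..<q})"
    unfolding sum_subtractf by (simp only: sum_eq_val[OF window_bij finite_atLeastLessThan_int])
  finally have 3: "(\<Sum>p''\<in>{p''\<in>pairs_left K r. p \<in> next_left p''}. pair_sign v p'')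
    = of_bool (inv v (x - 1) < q) - of_bool (inv v (x + 1) < q)"
    using inv_neighbour_bound by (auto simp: x_def)
  have "side_sign v r = of_bool (x = y + 1) - of_bool (q < inv v (x + 1) \<and> inv v (x + 1) < r)
      + of_bool (inv v (x - 1) < q) - of_bool (inv v (x + 1) < q)"
    using cov[of "x - 1"] window_inv_eq_iff[of "x + 1" q] window_inv_eq_iff[of "x - 1" q] q(2) xy
      window_inv_eq_iff[of "x + 1" r] window_inv_eq_iff[of "x - 1" r]
    unfolding side_sign_def x_def[symmetric] y_def[symmetric] by (auto simp: of_bool_def)
  then show ?thesis using 1 2 3 by linarith
qed

end

lemma cover_sum_chain_count_0:
  assumes "\<And>p. p \<in> P \<Longrightarrow> fst p < snd p"
  shows "cover_sum P (chain_count K 0) v = 0"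
  unfolding cover_sum_def using assms pair_swap_not_id by (intro sum.neutral) fastforce

lemma chain_count_Suc: "chain_count K (Suc m) = (\<lambda>u. \<Sum>i\<in>left_des K u. chain_count K m (swap i (i + 1) \<circ> u))"
  by auto

lemma pairs_subset:
  assumes "\<bar>r\<bar> \<le> K"
  shows "pairs_right K r \<subseteq> {-K..K} \<times> {-K..K}" "pairs_left K r \<subseteq> {-K..K} \<times> {-K..K}"
    "p \<in> pairs_right K r \<Longrightarrow> fst p < snd p" "p \<in> pairs_left K r \<Longrightarrow> fst p < snd p"
    "p \<in> pairs_right K r \<Longrightarrow> next_right p \<subseteq> pairs_right K r"
    "p \<in> pairs_left K r \<Longrightarrow> next_left p \<subseteq> pairs_left K r"
  using assms by (auto simp: pairs_right_def pairs_left_def next_right_def next_left_def)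

text \<open>Induction on m: on either side a descent step commutes with the sum over covers up to
  the same term \<open>side_sign v r * chain_count K m v\<close>.\<close>

lemma cover_sum_balance:
  assumes "v permutes {-M..M}" "\<bar>r\<bar> \<le> M" "M < K"
  shows "cover_sum (pairs_right K r) (chain_count K m) v = cover_sum (pairs_left K r) (chain_count K m) v"
  using assms(1)
proof (induction m arbitrary: v)
  case 0
  have rK: "\<bar>r\<bar> \<le> K" using assms by simp
  show ?case using pairs_subset(3,4)[OF rK] by (simp add: cover_sum_chain_count_0 del: chain_count.simps)
next
  case (Suc m)
  have rK: "\<bar>r\<bar> \<le> K" using assms by simp
  have vK: "v permutes {-K..K}" using window_permutes[OF Suc.prems assms(2,3)] .
  have "(\<Sum>i\<in>left_des K v. cover_sum (pairs_right K r) (chain_count K m) (swap i (i + 1) \<circ> v))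
    = (\<Sum>i\<in>left_des K v. cover_sum (pairs_left K r) (chain_count K m) (swap i (i + 1) \<circ> v))"
    by (intro sum.cong refl Suc.IH left_des_permutes[OF Suc.prems])
  then show ?case unfolding chain_count_Suc
    using cover_sum_step[OF vK pairs_subset(1,3)[OF rK], of "chain_count K m"]
      cover_sum_step[OF vK pairs_subset(2,4)[OF rK], of "chain_count K m"]
      sign_right[OF Suc.prems assms(2,3)] sign_left[OF Suc.prems assms(2,3)]
    by simp
qed

lemma cover_sum_add: "cover_sum P (\<lambda>u. F u + G u) v = cover_sum P F v + cover_sum P G v"
  by (simp add: cover_sum_def distrib_left sum.distrib)

text \<open>The commutator of the second-order sum gives each cover exactly the weight that
  \<open>d\<close> adds to its descent number. Hence all descent numbers of covers can be replaced
  by the constant on the right of \<open>d\<close>, which leaves the sum.\<close>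

lemma des_count_step:
  assumes v: "v permutes {-K..K}" and P: "P \<subseteq> {-K..K} \<times> {-K..K}" "\<And>p. p \<in> P \<Longrightarrow> fst p < snd p"
    and Q: "\<And>p. p \<in> P \<Longrightarrow> Q p \<subseteq> P"
    and c: "(\<Sum>p\<in>P. pair_sign v p) = c"
    and d: "\<And>p. p \<in> P \<Longrightarrow> pair_cover v p \<Longrightarrow>
      int (card (left_des K (pair_swap v p))) + (\<Sum>p'\<in>Q p. pair_sign (pair_swap v p) p')
       + (\<Sum>p''\<in>{p''\<in>P. p \<in> Q p''}. pair_sign v p'') = int (card (left_des K v)) + c"
  shows "cover_sum P (des_count K (Suc m)) v + cover_sum2 P Q (chain_count K (Suc m)) v
    = (\<Sum>i\<in>left_des K v. cover_sum P (des_count K m) (swap i (i + 1) \<circ> v)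
          + cover_sum2 P Q (chain_count K m) (swap i (i + 1) \<circ> v))
      + c * des_count K m v + (int (card (left_des K v)) + c) * cover_sum P (chain_count K m) v"
proof -
  let ?F = "chain_count K m"
  let ?k = "\<lambda>p. (\<Sum>p'\<in>Q p. pair_sign (pair_swap v p) p') + (\<Sum>p''\<in>{p''\<in>P. p \<in> Q p''}. pair_sign v p'')"
  have D: "des_count K (Suc m) = (\<lambda>u. int (card (left_des K u)) * ?F u
      + (\<Sum>i\<in>left_des K u. des_count K m (swap i (i + 1) \<circ> u)))"
    by auto
  have "cover_sum P (\<lambda>u. int (card (left_des K u)) * ?F u) v
      + (\<Sum>p\<in>P. of_bool (pair_cover v p) * ?F (pair_swap v p) * ?k p)
    = (\<Sum>p\<in>P. of_bool (pair_cover v p) * ?F (pair_swap v p) * (int (card (left_des K (pair_swap v p))) + ?k p))"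
    unfolding cover_sum_def sum.distrib[symmetric] by (intro sum.cong refl) (simp add: algebra_simps)
  also have "\<dots> = (\<Sum>p\<in>P. of_bool (pair_cover v p) * ?F (pair_swap v p) * (int (card (left_des K v)) + c))"
  proof (rule sum.cong[OF refl])
    fix p assume "p \<in> P"
    then show "of_bool (pair_cover v p) * ?F (pair_swap v p) * (int (card (left_des K (pair_swap v p))) + ?k p)
      = of_bool (pair_cover v p) * ?F (pair_swap v p) * (int (card (left_des K v)) + c)"
      using d[of p] by (cases "pair_cover v p") (simp_all add: add.assoc)
  qed
  also have "\<dots> = (int (card (left_des K v)) + c) * cover_sum P ?F v"
    unfolding cover_sum_def sum_distrib_left by (intro sum.cong refl) (simp add: algebra_simps)
  finally have "cover_sum P (\<lambda>u. int (card (left_des K u)) * ?F u) v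
      + (\<Sum>p\<in>P. of_bool (pair_cover v p) * ?F (pair_swap v p) * ?k p)
    = (int (card (left_des K v)) + c) * cover_sum P ?F v" .
  moreover have "cover_sum P (\<lambda>u. \<Sum>i\<in>left_des K u. des_count K m (swap i (i + 1) \<circ> u)) v
    = (\<Sum>i\<in>left_des K v. cover_sum P (des_count K m) (swap i (i + 1) \<circ> v)) + c * des_count K m v"
    using cover_sum_step[OF v P(1), of "des_count K m"] P(2) c by simp
  moreover note cover_sum2_step[OF v P(1), of Q ?F]
  ultimately show ?thesis
    unfolding D cover_sum_add chain_count_Suc sum.distrib using P(2) Q by simp
qed

text \<open>The same induction with \<open>des_count_step\<close>: its coefficients agree on both
  sides by \<open>des_right\<close> and \<open>des_left\<close>, and its term in
  \<open>chain_count\<close> is settled by \<open>cover_sum_balance\<close>.\<close>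

lemma des_sum_balance:
  assumes "v permutes {-M..M}" "\<bar>r\<bar> \<le> M" "M < K"
  shows "cover_sum (pairs_right K r) (des_count K m) v + cover_sum2 (pairs_right K r) next_right
      (chain_count K m) v
    = cover_sum (pairs_left K r) (des_count K m) v + cover_sum2 (pairs_left K r) next_left (chain_count K m) v"
  using assms(1)
proof (induction m arbitrary: v)
  case 0
  have rK: "\<bar>r\<bar> \<le> K" using assms by simp
  have z: "cover_sum2 P Q (chain_count K 0) v = 0"
    if "\<And>p. p \<in> P \<Longrightarrow> fst p < snd p" "\<And>p. p \<in> P \<Longrightarrow> Q p \<subseteq> P" for P Q
  proof -
    have "cover_sum (Q p) (chain_count K 0) u = 0" if "p \<in> P" for p u
      by (rule cover_sum_chain_count_0) (use \<open>\<And>p. p \<in> P \<Longrightarrow> fst p < snd p\<close> \<open>\<And>p. p \<in> P \<Longrightarrow> Q p \<subseteq> P\<close> that in blast)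
    then show ?thesis unfolding cover_sum2_def by (intro sum.neutral) simp
  qed
  have "cover_sum P (des_count K 0) v = 0" for P by (simp add: cover_sum_def)
  moreover have "cover_sum2 (pairs_right K r) next_right (chain_count K 0) v = 0"
    by (rule z) (use pairs_subset[OF rK] in blast)+
  moreover have "cover_sum2 (pairs_left K r) next_left (chain_count K 0) v = 0"
    by (rule z) (use pairs_subset[OF rK] in blast)+
  ultimately show ?case by (simp only:)
next
  case (Suc m)
  have rK: "\<bar>r\<bar> \<le> K" using assms by simp
  have vK: "v permutes {-K..K}" using window_permutes[OF Suc.prems assms(2,3)] .
  have IH: "(\<Sum>i\<in>left_des K v. cover_sum (pairs_right K r) (des_count K m) (swap i (i + 1) \<circ> v)
        + cover_sum2 (pairs_right K r) next_right (chain_count K m) (swap i (i + 1) \<circ> v))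
    = (\<Sum>i\<in>left_des K v. cover_sum (pairs_left K r) (des_count K m) (swap i (i + 1) \<circ> v)
        + cover_sum2 (pairs_left K r) next_left (chain_count K m) (swap i (i + 1) \<circ> v))"
    by (intro sum.cong refl Suc.IH left_des_permutes[OF Suc.prems])
  show ?case
    unfolding des_count_step[OF vK pairs_subset(1,3,5)[OF rK] sign_right[OF Suc.prems assms(2,3)]
        des_right[OF Suc.prems assms(2,3)], simplified]
      des_count_step[OF vK pairs_subset(2,4,6)[OF rK] sign_left[OF Suc.prems assms(2,3)] des_left[OF
          Suc.prems assms(2,3)], simplified]
      IH cover_sum_balance[OF Suc.prems assms(2,3)] ..
qed

text \<open>\<open>NE\<close> leaves c as the only partner for a cover of b to the right, and
  \<open>SW\<close> leaves a as the only one to the left. So each first-order sum in the two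
  balances has a single term, and the second-order sums are empty.\<close>

lemma counts_transition:
  assumes V: "V permutes {-M..M}" and M: "\<bar>a\<bar> \<le> M" "\<bar>b\<bar> \<le> M" "\<bar>c\<bar> \<le> M" "M < K"
    and ord: "a < b" "b < c" "V a < V b" "V b < V c"
    and NE: "\<And>p. b < p \<Longrightarrow> V b < V p \<Longrightarrow> c \<le> p \<and> V c \<le> V p"
    and SW: "\<And>p. p < b \<Longrightarrow> V p < V b \<Longrightarrow> p \<le> a \<and> V p \<le> V a"
  shows "chain_count K m (V \<circ> swap b c) = chain_count K m (V \<circ> swap a b)"
    and "des_count K m (V \<circ> swap b c) = des_count K m (V \<circ> swap a b)"
proof -
  have inj: "V p = V q \<longleftrightarrow> p = q" for p q using V by (metis permutes_inj inj_eq)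
  have covR: "cover V b s \<longleftrightarrow> s = c" if "b < s" for s
  proof
    assume s: "cover V b s"
    then have "c \<le> s" "V c \<le> V s" using NE[OF that] coverD(1)[OF s] by auto
    then show "s = c" using coverD(2)[OF s, of c] ord inj[of c s] by force
  next
    show "s = c \<Longrightarrow> cover V b s" using ord NE by (force simp: cover_def)
  qed
  have covL: "cover V q b \<longleftrightarrow> q = a" if "q < b" for q
  proof
    assume s: "cover V q b"
    then have "q \<le> a" "V q \<le> V a" using SW[OF that] coverD(1)[OF s] by auto
    then show "q = a" using coverD(2)[OF s, of a] ord inj[of a q] by force
  next
    show "q = a \<Longrightarrow> cover V q b" using ord SW by (force simp: cover_def)
  qed
  have R: "pair_cover V p \<longleftrightarrow> p = (b, c)" if "p \<in> pairs_right K b" for p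
    using that covR by (auto simp: pairs_right_def pair_cover_def)
  have L: "pair_cover V p \<longleftrightarrow> p = (a, b)" if "p \<in> pairs_left K b" for p
    using that covL by (auto simp: pairs_left_def pair_cover_def)
  have Rin: "(b, c) \<in> pairs_right K b" and Lin: "(a, b) \<in> pairs_left K b"
    using M ord by (auto simp: pairs_right_def pairs_left_def)
  have fin: "finite (pairs_right K b)" "finite (pairs_left K b)"
    by (simp_all add: pairs_right_def pairs_left_def)
  have single: "(\<Sum>p\<in>P. of_bool (pair_cover V p) * G p) = G p0"
    if "finite P" "p0 \<in> P" "\<And>p. p \<in> P \<Longrightarrow> pair_cover V p \<longleftrightarrow> p = p0" for P p0 and G :: "_ \<Rightarrow> int"
    using that by (subst sum.mono_neutral_right[of _ "{p0}"]) auto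
  have sumR: "(\<Sum>p\<in>pairs_right K b. of_bool (pair_cover V p) * G p) = G (b, c)" for G :: "_ \<Rightarrow> int"
    by (rule single[OF fin(1) Rin R])
  have sumL: "(\<Sum>p\<in>pairs_left K b. of_bool (pair_cover V p) * G p) = G (a, b)" for G :: "_ \<Rightarrow> int"
    by (rule single[OF fin(2) Lin L])
  \<comment> \<open>After the exchange b carries \<open>V c\<close>. A second cover with a closer s
    would need \<open>V s\<close> above \<open>V c\<close>, hence above \<open>V b\<close>, which
    \<open>NE\<close> forbids for s < c.\<close>
  have "\<not> cover (V \<circ> swap b c) b s" if "b < s" "s < c" for s
    using NE[of s] that ord by (auto simp: cover_def transpose_apply_other)
  then have R2: "cover_sum2 (pairs_right K b) next_right F V = 0" for F
    unfolding cover_sum2_def sumR cover_sum_def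
    by (intro sum.neutral) (auto simp: next_right_def pair_swap_def pair_cover_def)
  have "\<not> cover (V \<circ> swap a b) q b" if "a < q" "q < b" for q
    using SW[of q] that ord by (auto simp: cover_def transpose_apply_other)
  then have L2: "cover_sum2 (pairs_left K b) next_left F V = 0" for F
    unfolding cover_sum2_def sumL cover_sum_def
    by (intro sum.neutral) (auto simp: next_left_def pair_swap_def pair_cover_def)
  show "chain_count K m (V \<circ> swap b c) = chain_count K m (V \<circ> swap a b)"
    using cover_sum_balance[OF V M(2,4), of m] unfolding cover_sum_def sumR sumL by (simp add: pair_swap_def)
  show "des_count K m (V \<circ> swap b c) = des_count K m (V \<circ> swap a b)"
    using des_sum_balance[OF V M(2,4), of m] unfolding R2 L2 cover_sum_def sumR sumL
        by (simp add: pair_swap_def)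
qed

section \<open>Isomorphisms and duals of finite posets\<close>

definition poset_iso :: "('a \<times> 'a) set \<Rightarrow> ('b \<times> 'b) set \<Rightarrow> ('a \<Rightarrow> 'b) \<Rightarrow> bool" where
  "poset_iso r s f \<longleftrightarrow> bij_betw f (Field r) (Field s) \<and>
     (\<forall>x\<in>Field r. \<forall>y\<in>Field r. (x, y) \<in> r \<longleftrightarrow> (f x, f y) \<in> s)"

lemma poset_iso_converse: "poset_iso r s f \<Longrightarrow> poset_iso (r\<inverse>) (s\<inverse>) f"
  by (auto simp: poset_iso_def)

lemma covered_Field: "covered r q p \<Longrightarrow> q \<in> Field r \<and> p \<in> Field r"
  by (auto simp: covered_def Field_def)

lemma poset_iso_covered:
  assumes f: "poset_iso r s f" and xy: "x \<in> Field r" "y \<in> Field r"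
  shows "covered s (f x) (f y) \<longleftrightarrow> covered r x y"
proof -
  have inj: "inj_on f (Field r)" and im: "f ` Field r = Field s"
    using f by (auto simp: poset_iso_def bij_betw_def)
  have r: "(x, y) \<in> r \<longleftrightarrow> (f x, f y) \<in> s" if "x \<in> Field r" "y \<in> Field r" for x y
    using f that by (auto simp: poset_iso_def)
  have ne: "f x = f y \<longleftrightarrow> x = y" if "x \<in> Field r" "y \<in> Field r" for x y
    using inj that by (auto dest: inj_onD)
  have "(\<exists>z. (f x, z) \<in> s \<and> z \<noteq> f x \<and> (z, f y) \<in> s \<and> z \<noteq> f y)
    \<longleftrightarrow> (\<exists>z\<in>Field s. (f x, z) \<in> s \<and> z \<noteq> f x \<and> (z, f y) \<in> s \<and> z \<noteq> f y)"
    by (auto intro: FieldI2)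
  also have "\<dots> \<longleftrightarrow> (\<exists>z\<in>Field r. (f x, f z) \<in> s \<and> f z \<noteq> f x \<and> (f z, f y) \<in> s \<and> f z \<noteq> f y)"
    unfolding im[symmetric] by blast
  also have "\<dots> \<longleftrightarrow> (\<exists>z\<in>Field r. (x, z) \<in> r \<and> z \<noteq> x \<and> (z, y) \<in> r \<and> z \<noteq> y)"
    using r ne xy by (intro bex_cong refl) auto
  also have "\<dots> \<longleftrightarrow> (\<exists>z. (x, z) \<in> r \<and> z \<noteq> x \<and> (z, y) \<in> r \<and> z \<noteq> y)"
    by (auto intro: FieldI2)
  finally show ?thesis unfolding covered_def using r ne xy by auto
qed

lemma poset_iso_down_degree:
  assumes f: "poset_iso r s f" and x: "x \<in> Field r"
  shows "down_degree s (f x) = down_degree r x"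
proof -
  have inj: "inj_on f (Field r)" and im: "f ` Field r = Field s"
    using f by (auto simp: poset_iso_def bij_betw_def)
  have "{q \<in> Field s. covered s q (f x)} = f ` {q \<in> Field r. covered r q x}"
    unfolding im[symmetric] using poset_iso_covered[OF f _ x] by auto
  then show ?thesis unfolding down_degree_def
    by (simp add: card_image inj_on_subset[OF inj])
qed

lemma poset_iso_chain_image:
  assumes f: "poset_iso r s f" and C: "C \<subseteq> Field r"
  shows "f ` C \<in> Chains s \<longleftrightarrow> C \<in> Chains r"
proof -
  have "(x, y) \<in> r \<longleftrightarrow> (f x, f y) \<in> s" if "x \<in> C" "y \<in> C" for x y
    using f that C by (auto simp: poset_iso_def)
  then show ?thesis by (auto simp: Chains_def)
qed

lemma poset_iso_max_chains:
  assumes f: "poset_iso r s f"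
  shows "max_chains s = image f ` max_chains r"
proof -
  have inj: "inj_on f (Field r)" and im: "f ` Field r = Field s"
    using f by (auto simp: poset_iso_def bij_betw_def)
  have ch: "f ` C \<in> Chains s \<longleftrightarrow> C \<in> Chains r" if "C \<subseteq> Field r" for C
    by (rule poset_iso_chain_image[OF f that])
  have sub: "f ` C \<subseteq> f ` D \<longleftrightarrow> C \<subseteq> D" "f ` C = f ` D \<longleftrightarrow> C = D"
    if "C \<subseteq> Field r" "D \<subseteq> Field r" for C D
    using that inj by (auto simp: inj_on_image_eq_iff inj_on_image_subset_iff)
  have "Chains s = image f ` Chains r"
  proof
    show "Chains s \<subseteq> image f ` Chains r"
    proof
      fix D assume D: "D \<in> Chains s"
      then obtain C where C: "C \<subseteq> Field r" "D = f ` C"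
        using Chains_subset_Field[OF D] im by (metis subset_imageE)
      then show "D \<in> image f ` Chains r" using D ch by auto
    qed
  qed (use ch Chains_subset_Field in blast)
  then have K: "Chains s = image f ` Chains r" .
  show ?thesis
  proof (intro equalityI subsetI)
    fix D assume D: "D \<in> max_chains s"
    then obtain C where C: "C \<in> Chains r" "D = f ` C" unfolding max_chains_def K by auto
    have "E = C" if "E \<in> Chains r" "C \<subseteq> E" for E
    proof -
      have "f ` E = f ` C" using D C that unfolding max_chains_def K by auto
      then show ?thesis using sub(2) C(1) that(1) Chains_subset_Field by metis
    qed
    then show "D \<in> image f ` max_chains r" using C by (auto simp: max_chains_def)
  next
    fix D assume "D \<in> image f ` max_chains r"
    then obtain C where C: "C \<in> max_chains r" "D = f ` C" by auto
    have "E = D" if E: "E \<in> Chains s" "D \<subseteq> E" for E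
    proof -
      obtain E' where E': "E' \<in> Chains r" "E = f ` E'" using E(1) unfolding K by blast
      have "C \<in> Chains r" using C by (simp add: max_chains_def)
      then have "C \<subseteq> E'" using sub(1)[of C E'] E' E(2) C(2) Chains_subset_Field by metis
      then show ?thesis using C E' by (auto simp: max_chains_def)
    qed
    then show "D \<in> max_chains s" using C K by (auto simp: max_chains_def)
  qed
qed

lemma poset_iso_chain_weight:
  assumes f: "poset_iso r s f" and x: "x \<in> Field r"
  shows "chain_weight s (f x) = chain_weight r x"
proof -
  have inj: "inj_on f (Field r)" using f by (auto simp: poset_iso_def bij_betw_def)
  have sub: "C \<subseteq> Field r" if "C \<in> max_chains r" for C
    using that Chains_subset_Field by (auto simp: max_chains_def)
  have "{C \<in> max_chains s. f x \<in> C} = image f ` {C \<in> max_chains r. x \<in> C}"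
    unfolding poset_iso_max_chains[OF f] using inj_on_image_mem_iff[OF inj x sub] by blast
  moreover have "inj_on (image f) {C \<in> max_chains r. x \<in> C}"
    using sub by (intro inj_onI) (simp add: inj_on_image_eq_iff[OF inj])
  ultimately show ?thesis unfolding chain_weight_def by (simp add: card_image)
qed

lemma poset_iso_expect:
  assumes f: "poset_iso r s f" and fin: "finite (Field r)" and ne: "Field r \<noteq> {}"
    and po: "Partial_order r" "Partial_order s"
  shows "expect_X s = expect_X r" "expect_Y s = expect_Y r"
proof -
  have bij: "bij_betw f (Field r) (Field s)" using f by (simp add: poset_iso_def)
  have fin': "finite (Field s)" and ne': "Field s \<noteq> {}"
    using bij_betw_finite[OF bij] fin bij_betw_imp_surj_on[OF bij] ne by auto
  have S: "(\<Sum>p\<in>Field s. h p) = (\<Sum>p\<in>Field r. h (f p))" for h :: "_ \<Rightarrow> real"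
    by (rule sum.reindex_bij_betw[OF bij, symmetric])
  show "expect_X s = expect_X r"
    unfolding expect_X_eq[OF fin ne] expect_X_eq[OF fin' ne'] S bij_betw_same_card[OF bij]
    using poset_iso_down_degree[OF f] by simp
  show "expect_Y s = expect_Y r"
    unfolding expect_Y_eq[OF fin po(1) ne] expect_Y_eq[OF fin' po(2) ne'] S
    using poset_iso_down_degree[OF f] poset_iso_chain_weight[OF f] by simp
qed

lemma Chains_converse: "Chains (r\<inverse>) = Chains r"
  by (auto simp: Chains_def)

lemma chain_weight_converse: "chain_weight (r\<inverse>) = chain_weight r"
  by (simp add: fun_eq_iff chain_weight_def max_chains_def Chains_converse)

lemma covered_converse: "covered (r\<inverse>) q p \<longleftrightarrow> covered r p q"
  by (auto simp: covered_def)

text \<open>Both numerators count the covering pairs, once by the upper and once by the lower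
  element.\<close>

lemma expect_X_converse:
  assumes "finite (Field r)" "Field r \<noteq> {}"
  shows "expect_X (r\<inverse>) = expect_X r"
proof -
  have "(\<Sum>p\<in>Field r. down_degree (r\<inverse>) p) = (\<Sum>p\<in>Field r. down_degree r p)"
    unfolding down_degree_def covered_converse Field_converse
    using sum.swap[of "\<lambda>p q. of_bool (covered r p q) :: nat" "Field r" "Field r"] assms(1)
    by (simp add: Int_def)
  then have "(\<Sum>p\<in>Field r. real (down_degree (r\<inverse>) p)) = (\<Sum>p\<in>Field r. real (down_degree r p))"
    by (metis of_nat_sum)
  then show ?thesis using assms by (simp add: expect_X_eq)
qed

section \<open>Maximal chains of intervals\<close>

lemma interval_converse: "interval (r\<inverse>) y x = (interval r x y)\<inverse>"
  by (auto simp: interval_def)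

definition chain_num :: "('a \<times> 'a) set \<Rightarrow> 'a \<Rightarrow> 'a \<Rightarrow> nat" where
  "chain_num r x y = card (max_chains (interval r x y))"

lemma chain_num_converse: "chain_num (r\<inverse>) y x = chain_num r x y"
  by (simp add: chain_num_def interval_converse max_chains_def Chains_converse)

locale finite_poset =
  fixes r :: "('a \<times> 'a) set"
  assumes po: "Partial_order r" and fin: "finite (Field r)"
begin

lemma refl_r: "x \<in> Field r \<Longrightarrow> (x, x) \<in> r"
  using po by (auto simp: partial_order_on_def preorder_on_def refl_on_def)

lemma trans_r: "(x, y) \<in> r \<Longrightarrow> (y, z) \<in> r \<Longrightarrow> (x, z) \<in> r"
  using po by (meson partial_order_on_def preorder_on_def transD)

lemma refl_fst: "(x, y) \<in> r \<Longrightarrow> (x, x) \<in> r" and refl_snd: "(x, y) \<in> r \<Longrightarrow> (y, y) \<in> r"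
  by (simp_all add: refl_r FieldI1 FieldI2)

lemma antisym_r: "(x, y) \<in> r \<Longrightarrow> (y, x) \<in> r \<Longrightarrow> x = y"
  using po by (meson partial_order_on_def antisymD)

lemma Field_r: "(x, y) \<in> r \<Longrightarrow> x \<in> Field r" "(x, y) \<in> r \<Longrightarrow> y \<in> Field r"
  by (auto simp: Field_def)

lemma converse_finite_poset: "finite_poset (r\<inverse>)"
  by unfold_locales (use po fin in auto)

lemma finite_interval: "finite (Field (interval r x y))"
  by (rule finite_subset[OF _ fin]) (auto simp: interval_def Field_def)

text \<open>Maximality needs to be tested only against the addition of a single element.\<close>

lemma max_chain_iff:
  "C \<in> max_chains (interval r x y) \<longleftrightarrow>
    (\<forall>a\<in>C. (x, a) \<in> r \<and> (a, y) \<in> r) \<and> (\<forall>a\<in>C. \<forall>b\<in>C. (a, b) \<in> r \<or> (b, a) \<in> r) \<and>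
    (\<forall>a. (x, a) \<in> r \<and> (a, y) \<in> r \<and> (\<forall>b\<in>C. (a, b) \<in> r \<or> (b, a) \<in> r) \<longrightarrow> a \<in> C)" (is "_ \<longleftrightarrow> ?R C")
proof -
  have ch: "C \<in> Chains (interval r x y) \<longleftrightarrow>
    (\<forall>a\<in>C. (x, a) \<in> r \<and> (a, y) \<in> r) \<and> (\<forall>a\<in>C. \<forall>b\<in>C. (a, b) \<in> r \<or> (b, a) \<in> r)" for C
    by (auto simp: Chains_def interval_def)
  show ?thesis
  proof
    assume C: "C \<in> max_chains (interval r x y)"
    then have c: "C \<in> Chains (interval r x y)" by (simp add: max_chains_def)
    have "a \<in> C" if a: "(x, a) \<in> r" "(a, y) \<in> r" "\<forall>b\<in>C. (a, b) \<in> r \<or> (b, a) \<in> r" for a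
    proof -
      have "insert a C \<in> Chains (interval r x y)"
        using c a refl_snd[OF a(1)] unfolding ch by blast
      then show "a \<in> C" using C unfolding max_chains_def by blast
    qed
    then show "?R C" using c unfolding ch by blast
  next
    assume R: "?R C"
    have "D = C" if "D \<in> Chains (interval r x y)" "C \<subseteq> D" for D
    proof -
      have "a \<in> C" if "a \<in> D" for a
        using R \<open>D \<in> _\<close> \<open>C \<subseteq> D\<close> that unfolding ch by blast
      then show ?thesis using \<open>C \<subseteq> D\<close> by blast
    qed
    moreover have "C \<in> Chains (interval r x y)" using R unfolding ch by blast
    ultimately show "C \<in> max_chains (interval r x y)"
      unfolding max_chains_def by blast
  qed
qed

lemma finite_max_chain: "C \<in> max_chains (interval r x y) \<Longrightarrow> finite C"
  using Chains_subset_Field finite_interval finite_subset by (fastforce simp: max_chains_def)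

lemma ends_in_max_chain:
  assumes "C \<in> max_chains (interval r x y)" "(x, y) \<in> r"
  shows "x \<in> C" "y \<in> C"
  using assms refl_fst[OF assms(2)] refl_snd[OF assms(2)] unfolding max_chain_iff by blast+

lemma finite_chain_greatest:
  "finite C \<Longrightarrow> C \<noteq> {} \<Longrightarrow> \<forall>a\<in>C. \<forall>b\<in>C. (a, b) \<in> r \<or> (b, a) \<in> r \<Longrightarrow> \<exists>z\<in>C. \<forall>a\<in>C. (a, z) \<in> r"
proof (induction rule: finite_ne_induct)
  case (insert c C)
  then obtain z where z: "z \<in> C" "\<forall>a\<in>C. (a, z) \<in> r" by blast
  then show ?case using insert.prems trans_r by (cases "(c, z) \<in> r") (metis insertCI insertE)+
qed auto

text \<open>Once y is deleted from a maximal chain, its greatest remaining element z is covered by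
  y: an element strictly between z and y would be comparable to the whole chain and hence belong to
  it.\<close>

lemma max_chains_insert:
  assumes xy: "(x, y) \<in> r" "x \<noteq> y"
  shows "max_chains (interval r x y)
    = (\<Union>z\<in>{z. covered r z y \<and> (x, z) \<in> r}. insert y ` max_chains (interval r x z))"
proof (intro equalityI subsetI)
  fix C assume C: "C \<in> max_chains (interval r x y)"
  have xC: "x \<in> C" "y \<in> C" using ends_in_max_chain[OF C xy(1)] by auto
  have Cp: "\<And>a. a \<in> C \<Longrightarrow> (x, a) \<in> r \<and> (a, y) \<in> r" "\<And>a b. a \<in> C \<Longrightarrow> b \<in> C \<Longrightarrow> (a, b) \<in> r \<or> (b, a) \<in> r"
    "\<And>a. (x, a) \<in> r \<Longrightarrow> (a, y) \<in> r \<Longrightarrow> \<forall>b\<in>C. (a, b) \<in> r \<or> (b, a) \<in> r \<Longrightarrow> a \<in> C"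
    using C unfolding max_chain_iff by blast+
  have "\<exists>z\<in>C - {y}. \<forall>a\<in>C - {y}. (a, z) \<in> r"
    by (rule finite_chain_greatest) (use finite_max_chain[OF C] xC xy Cp(2) in auto)
  then obtain z where z: "z \<in> C" "z \<noteq> y" "\<And>a. a \<in> C \<Longrightarrow> a \<noteq> y \<Longrightarrow> (a, z) \<in> r" by auto
  have xz: "(x, z) \<in> r" "(z, y) \<in> r" using Cp(1)[OF z(1)] by auto
  have "covered r z y"
    unfolding covered_def
  proof (intro conjI notI)
    assume "\<exists>t. (z, t) \<in> r \<and> t \<noteq> z \<and> (t, y) \<in> r \<and> t \<noteq> y"
    then obtain t where t: "(z, t) \<in> r" "t \<noteq> z" "(t, y) \<in> r" "t \<noteq> y" by blast
    have "t \<in> C" by (rule Cp(3)) (use t xz z trans_r in blast)+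
    then show False using t z(3) antisym_r by blast
  qed (use xz z in auto)
  moreover have "C - {y} \<in> max_chains (interval r x z)"
    unfolding max_chain_iff
  proof (intro conjI ballI allI impI)
    fix a assume a: "(x, a) \<in> r \<and> (a, z) \<in> r \<and> (\<forall>b\<in>C - {y}. (a, b) \<in> r \<or> (b, a) \<in> r)"
    then have ay: "(a, y) \<in> r" "a \<noteq> y" using xz z(2) trans_r antisym_r by blast+
    then show "a \<in> C - {y}" using Cp(3)[of a] a by blast
  qed (use Cp z xz in auto)
  moreover have "C = insert y (C - {y})" using xC by blast
  ultimately show "C \<in> (\<Union>z\<in>{z. covered r z y \<and> (x, z) \<in> r}. insert y ` max_chains (interval r x z))"
    using xz by blast
next
  fix C assume "C \<in> (\<Union>z\<in>{z. covered r z y \<and> (x, z) \<in> r}. insert y ` max_chains (interval r x z))"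
  then obtain z D where z: "covered r z y" "(x, z) \<in> r" and D: "D \<in> max_chains (interval r x z)"
    and C: "C = insert y D" by blast
  have zy: "(z, y) \<in> r" "z \<noteq> y" and cov: "\<And>t. (z, t) \<in> r \<Longrightarrow> (t, y) \<in> r \<Longrightarrow> t = z \<or> t = y"
    using z(1) unfolding covered_def by blast+
  have Dp: "\<And>a. a \<in> D \<Longrightarrow> (x, a) \<in> r \<and> (a, z) \<in> r" "\<And>a b. a \<in> D \<Longrightarrow> b \<in> D \<Longrightarrow> (a, b) \<in> r \<or> (b, a) \<in> r"
    "\<And>a. (x, a) \<in> r \<Longrightarrow> (a, z) \<in> r \<Longrightarrow> \<forall>b\<in>D. (a, b) \<in> r \<or> (b, a) \<in> r \<Longrightarrow> a \<in> D"
    using D unfolding max_chain_iff by blast+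
  have zD: "z \<in> D" using ends_in_max_chain[OF D z(2)] by auto
  have Dy: "\<And>a. a \<in> D \<Longrightarrow> (a, y) \<in> r" using Dp(1) zy trans_r by blast
  have yy: "(y, y) \<in> r" using refl_snd[OF zy(1)] .
  show "C \<in> max_chains (interval r x y)" unfolding max_chain_iff C
  proof (intro conjI ballI allI impI)
    fix a assume a: "(x, a) \<in> r \<and> (a, y) \<in> r \<and> (\<forall>b\<in>insert y D. (a, b) \<in> r \<or> (b, a) \<in> r)"
    show "a \<in> insert y D"
    proof (cases "a = y")
      case False
      have "(a, z) \<in> r" using a zD cov[of a] False refl_snd[OF z(2)] by blast
      then show ?thesis using Dp(3) a by blast
    qed simp
  qed (use xy Dp Dy yy in auto)
qed

text \<open>Keeping track of p makes the recursion serve twice: for p = x it counts all maximal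
  chains, and for general p it gives the factorisation of the chain weight.\<close>

lemma card_max_chains_through:
  assumes xy: "(x, y) \<in> r" and p: "p \<noteq> y" "(x, p) \<in> r" "(p, y) \<in> r"
  shows "card {C \<in> max_chains (interval r x y). p \<in> C}
    = (\<Sum>z\<in>{z. covered r z y \<and> (p, z) \<in> r}. card {C \<in> max_chains (interval r x z). p \<in> C})"
proof -
  let ?Z = "{z. covered r z y \<and> (p, z) \<in> r}"
  have ne: "x \<noteq> y" using p antisym_r by blast
  have finZ: "finite ?Z" by (rule finite_subset[OF _ fin]) (auto dest: covered_Field)
  have y_notin: "y \<notin> C" if "C \<in> max_chains (interval r x z)" "covered r z y" for C z
    using that antisym_r unfolding max_chain_iff covered_def by blast
  have bound: "(c, z) \<in> r" if "C \<in> max_chains (interval r x z)" "c \<in> C" for C z c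
    using that unfolding max_chain_iff by blast
  have eq: "{C \<in> max_chains (interval r x y). p \<in> C}
    = (\<Union>z\<in>?Z. insert y ` {C \<in> max_chains (interval r x z). p \<in> C})"
  proof (intro equalityI subsetI)
    fix C assume "C \<in> {C \<in> max_chains (interval r x y). p \<in> C}"
    then obtain z D where z: "covered r z y" "(x, z) \<in> r" "D \<in> max_chains (interval r x z)"
      "C = insert y D" "p \<in> C" unfolding max_chains_insert[OF xy ne] by auto
    then have "p \<in> D" using p by simp
    then show "C \<in> (\<Union>z\<in>?Z. insert y ` {C \<in> max_chains (interval r x z). p \<in> C})"
      using z bound[OF z(3)] by auto
  next
    fix C assume "C \<in> (\<Union>z\<in>?Z. insert y ` {C \<in> max_chains (interval r x z). p \<in> C})"
    then obtain z D where z: "covered r z y" "(p, z) \<in> r" "D \<in> max_chains (interval r x z)"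
      "C = insert y D" "p \<in> D" by auto
    then show "C \<in> {C \<in> max_chains (interval r x y). p \<in> C}"
      unfolding max_chains_insert[OF xy ne] using trans_r[OF p(2) z(2)] by auto
  qed
  have inj: "inj_on (insert y) {C \<in> max_chains (interval r x z). p \<in> C}" if "z \<in> ?Z" for z
  proof (rule inj_onI)
    fix C D assume C: "C \<in> {C \<in> max_chains (interval r x z). p \<in> C}"
      and D: "D \<in> {C \<in> max_chains (interval r x z). p \<in> C}" and e: "insert y C = insert y D"
    have "y \<notin> C" "y \<notin> D" using y_notin[of _ z] C D that by auto
    then show "C = D" using e insert_ident[of y C D] by simp
  qed
  have disj: "insert y ` {C \<in> max_chains (interval r x z). p \<in> C} \<inter> insert y ` {C \<in> max_chains (interval
      r x z'). p \<in> C} = {}"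
    if zz: "z \<in> ?Z" "z' \<in> ?Z" "z \<noteq> z'" for z z'
  proof (rule ccontr)
    assume "\<not> ?thesis"
    then obtain C C' where C: "C \<in> max_chains (interval r x z)" "C' \<in> max_chains (interval r x z')"
        "insert y C = insert y C'"
      by blast
    have "y \<notin> C" "y \<notin> C'" using y_notin[OF C(1)] y_notin[OF C(2)] zz by auto
    then have eq: "C = C'" using C(3) insert_ident[of y C C'] by simp
    have "(x, z) \<in> r" "(x, z') \<in> r" using zz trans_r[OF p(2)] by auto
    then have "z \<in> C" "z' \<in> C'" using ends_in_max_chain(2)[OF C(1)] ends_in_max_chain(2)[OF C(2)] by auto
    then have "(z, z') \<in> r" "(z', z) \<in> r" using eq bound[OF C(1)] bound[OF C(2)] by auto
    then show False using zz(3) antisym_r by blast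
  qed
  have "card {C \<in> max_chains (interval r x y). p \<in> C}
    = (\<Sum>z\<in>?Z. card (insert y ` {C \<in> max_chains (interval r x z). p \<in> C}))"
    unfolding eq
    by (rule card_UN_disjoint[OF finZ]) (use disj finite_max_chains[OF finite_interval] in auto)
  also have "\<dots> = (\<Sum>z\<in>?Z. card {C \<in> max_chains (interval r x z). p \<in> C})"
    by (intro sum.cong refl card_image inj)
  finally show ?thesis .
qed

lemma chain_num_self: "x \<in> Field r \<Longrightarrow> chain_num r x x = 1"
proof -
  assume x: "x \<in> Field r"
  have "C = {x}" if "C \<in> max_chains (interval r x x)" for C
    using ends_in_max_chain[OF that refl_r[OF x]] that antisym_r unfolding max_chain_iff by blast
  moreover have "{x} \<in> max_chains (interval r x x)"
    unfolding max_chain_iff using refl_r[OF x] antisym_r by blast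
  ultimately have "max_chains (interval r x x) = {{x}}" by blast
  then show ?thesis by (simp add: chain_num_def)
qed

lemma chain_num_rec:
  assumes "(x, y) \<in> r" "x \<noteq> y"
  shows "chain_num r x y = (\<Sum>z\<in>{z. covered r z y \<and> (x, z) \<in> r}. chain_num r x z)"
proof -
  have all: "{C \<in> max_chains (interval r x z). x \<in> C} = max_chains (interval r x z)" if "(x, z) \<in> r" for z
    using ends_in_max_chain that by blast
  show ?thesis
    using card_max_chains_through[OF assms(1) assms(2) refl_fst[OF assms(1)] assms(1)] all assms(1)
    by (simp add: chain_num_def)
qed

lemma chain_num_rec_up:
  assumes "(x, y) \<in> r" "x \<noteq> y"
  shows "chain_num r x y = (\<Sum>z\<in>{z. covered r x z \<and> (z, y) \<in> r}. chain_num r z y)"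
proof -
  interpret c: finite_poset "r\<inverse>" by (rule converse_finite_poset)
  show ?thesis using c.chain_num_rec[of y x] assms by (simp add: chain_num_converse covered_converse)
qed

lemma interval_induct [consumes 1, case_names step]:
  assumes "(x, y) \<in> r"
    and "\<And>y. (x, y) \<in> r \<Longrightarrow> (\<And>z. covered r z y \<Longrightarrow> (x, z) \<in> r \<Longrightarrow> P z) \<Longrightarrow> P y"
  shows "P y"
  using assms(1)
proof (induction "card {t. (x, t) \<in> r \<and> (t, y) \<in> r}" arbitrary: y rule: less_induct)
  case less
  show ?case
  proof (rule assms(2)[OF less.prems])
    fix z assume z: "covered r z y" "(x, z) \<in> r"
    have zy: "(z, y) \<in> r" "z \<noteq> y" using z by (auto simp: covered_def)
    have fy: "(y, y) \<in> r" using refl_snd[OF zy(1)] .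
    have "{t. (x, t) \<in> r \<and> (t, z) \<in> r} \<subset> {t. (x, t) \<in> r \<and> (t, y) \<in> r}"
      using less.prems zy fy trans_r antisym_r by blast
    moreover have "finite {t. (x, t) \<in> r \<and> (t, y) \<in> r}"
      by (rule finite_subset[OF _ fin]) (use Field_r in blast)
    ultimately show "P z" using less.hyps[OF psubset_card_mono z(2)] by blast
  qed
qed

text \<open>Induction on y with p fixed: both sides satisfy the same recursion over the elements
  covered by y, so chains need not be cut at p.\<close>

lemma chain_weight_interval:
  assumes "(x, p) \<in> r" "(p, y) \<in> r"
  shows "chain_weight (interval r x y) p = chain_num r x p * chain_num r p y"
  using assms(2)
proof (induction rule: interval_induct)
  case (step y)
  have xy: "(x, y) \<in> r" using assms(1) step(1) trans_r by blast
  show ?case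
  proof (cases "p = y")
    case True
    have "{C \<in> max_chains (interval r x y). y \<in> C} = max_chains (interval r x y)"
      using ends_in_max_chain[OF _ xy] by blast
    then show ?thesis using True chain_num_self[of y] Field_r(2)[OF xy]
      by (simp add: chain_weight_def chain_num_def)
  next
    case False
    have "chain_weight (interval r x y) p
      = (\<Sum>z\<in>{z. covered r z y \<and> (p, z) \<in> r}. chain_weight (interval r x z) p)"
      unfolding chain_weight_def by (rule card_max_chains_through[OF xy False assms(1) step(1)])
    also have "\<dots> = (\<Sum>z\<in>{z. covered r z y \<and> (p, z) \<in> r}. chain_num r x p * chain_num r p z)"
      by (intro sum.cong refl step) auto
    also have "\<dots> = chain_num r x p * chain_num r p y"
      by (simp add: chain_num_rec[OF step(1) False] sum_distrib_left)
    finally show ?thesis .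
  qed
qed

text \<open>The total of h along all maximal chains of the interval, grouped by the elements of the
  chains.\<close>

definition chain_sum :: "('a \<Rightarrow> real) \<Rightarrow> 'a \<Rightarrow> 'a \<Rightarrow> real" where
  "chain_sum h x y = (\<Sum>p\<in>{p. (x, p) \<in> r \<and> (p, y) \<in> r}. real (chain_num r x p * chain_num r p y) * h p)"

text \<open>The top y contributes the first term. For any other p the chains from p to y are sorted
  by their last step, and exchanging the sums collects them by z. This is the recursive shape of
  \<open>des_count\<close>.\<close>

lemma chain_sum_rec:
  assumes xy: "(x, y) \<in> r"
  shows "chain_sum h x y = real (chain_num r x y) * h y + (\<Sum>z\<in>{z. covered r z y \<and> (x, z) \<in> r}. chain_sum h x z)"
proof -
  let ?I = "\<lambda>y. {p. (x, p) \<in> r \<and> (p, y) \<in> r}"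
  let ?Z = "{z. covered r z y \<and> (x, z) \<in> r}"
  have finI: "finite (?I y)" for y by (rule finite_subset[OF _ fin]) (use Field_r in blast)
  have finZ: "finite ?Z" by (rule finite_subset[OF _ fin]) (auto dest: covered_Field)
  have yI: "y \<in> ?I y" using xy refl_snd[OF xy] by blast
  have "chain_sum h x y = real (chain_num r x y) * h y
     + (\<Sum>p\<in>?I y - {y}. real (chain_num r x p * chain_num r p y) * h p)"
    unfolding chain_sum_def sum.remove[OF finI yI] using chain_num_self[of y] Field_r(2)[OF xy] by simp
  also have "(\<Sum>p\<in>?I y - {y}. real (chain_num r x p * chain_num r p y) * h p)
    = (\<Sum>p\<in>?I y - {y}. \<Sum>z\<in>{z \<in> ?Z. (p, z) \<in> r}. real (chain_num r x p * chain_num r p z) * h p)"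
  proof (rule sum.cong[OF refl])
    fix p assume p: "p \<in> ?I y - {y}"
    have "{z \<in> ?Z. (p, z) \<in> r} = {z. covered r z y \<and> (p, z) \<in> r}" using p trans_r by blast
    then show "real (chain_num r x p * chain_num r p y) * h p
      = (\<Sum>z\<in>{z \<in> ?Z. (p, z) \<in> r}. real (chain_num r x p * chain_num r p z) * h p)"
      using p chain_num_rec[of p y] by (simp add: sum_distrib_left sum_distrib_right)
  qed
  also have "\<dots> = (\<Sum>z\<in>?Z. \<Sum>p\<in>{p \<in> ?I y - {y}. (p, z) \<in> r}. real (chain_num r x p * chain_num r p z) * h p)"
    by (rule sum.swap_restrict) (use finI finZ in auto)
  also have "\<dots> = (\<Sum>z\<in>?Z. chain_sum h x z)"
  proof (rule sum.cong[OF refl])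
    fix z assume z: "z \<in> ?Z"
    have "{p \<in> ?I y - {y}. (p, z) \<in> r} = ?I z"
      using z trans_r antisym_r unfolding covered_def by blast
    then show "(\<Sum>p\<in>{p \<in> ?I y - {y}. (p, z) \<in> r}. real (chain_num r x p * chain_num r p z) * h p)
        = chain_sum h x z"
      by (simp add: chain_sum_def)
  qed
  finally show ?thesis .
qed

lemma covered_interval:
  assumes "(x, p) \<in> r" "(p, y) \<in> r"
  shows "covered (interval r x y) q p \<longleftrightarrow> covered r q p \<and> (x, q) \<in> r"
  using assms trans_r unfolding covered_def interval_def by blast

lemma down_degree_interval:
  assumes "(x, p) \<in> r" "(p, y) \<in> r"
  shows "down_degree (interval r x y) p = card {q. covered r q p \<and> (x, q) \<in> r}"
proof -
  have "{q \<in> Field (interval r x y). covered (interval r x y) q p} = {q. covered r q p \<and> (x, q) \<in> r}"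
    using covered_interval[OF assms] covered_Field by fast
  then show ?thesis by (simp add: down_degree_def)
qed

lemma expect_Y_interval:
  assumes xy: "(x, y) \<in> r"
  shows "expect_Y (interval r x y) = chain_sum (\<lambda>p. real (card {q. covered r q p \<and> (x, q) \<in> r})) x y
     / chain_sum (\<lambda>_. 1) x y"
proof -
  have F: "Field (interval r x y) = {p. (x, p) \<in> r \<and> (p, y) \<in> r}" by (rule Field_interval[OF po])
  have ne: "Field (interval r x y) \<noteq> {}" unfolding F using xy refl_snd[OF xy] by blast
  show ?thesis
    unfolding expect_Y_eq[OF finite_interval Partial_order_interval[OF po] ne] chain_sum_def F
    by (intro arg_cong2[of _ _ _ _ "(/)"] sum.cong refl) (auto simp: chain_weight_interval down_degree_interval)
qed

end

section \<open>The weak order\<close>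

text \<open>Inversions are recorded by values and not by positions: exchanging an adjacent ascent
  then adds a single pair and changes no other, so that the right weak order becomes
  containment.\<close>

definition inversions :: "(nat \<Rightarrow> nat) \<Rightarrow> (nat \<times> nat) set" where
  "inversions u = {(a, b). a < b \<and> inv u b < inv u a}"

lemma mem_inversions: "(a, b) \<in> inversions u \<longleftrightarrow> a < b \<and> inv u b < inv u a"
  by (simp add: inversions_def)

lemma inversions_id: "inversions id = {}"
  by (auto simp: inversions_def)

lemma inversions_subset:
  assumes "u permutes {1..n}" shows "inversions u \<subseteq> {1..n} \<times> {1..n}"
proof clarify
  fix a b assume ab: "(a, b) \<in> inversions u"
  have i: "inv u permutes {1..n}" using assms by (rule permutes_inv)
  have x: "inv u x = x" if "x \<notin> {1..n}" for x using permutes_not_in[OF i that] .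
  have y: "inv u x \<in> {1..n} \<longleftrightarrow> x \<in> {1..n}" for x using permutes_in_image[OF i] .
  show "a \<in> {1..n} \<and> b \<in> {1..n}"
    using ab x[of a] x[of b] y[of a] y[of b] unfolding mem_inversions
    by (cases "a \<in> {1..n}"; cases "b \<in> {1..n}") auto
qed

lemma finite_inversions: "u permutes {1..n} \<Longrightarrow> finite (inversions u)"
  using inversions_subset finite_subset by blast

lemma inversions_swap:
  assumes u: "bij u" and i: "u i < u (i + 1)"
  shows "inversions (u \<circ> swap i (i + 1)) = insert (u i, u (i + 1)) (inversions u)"
    and "(u i, u (i + 1)) \<notin> inversions u"
proof -
  have iv: "inv u (u x) = x" and vi: "u (inv u x) = x" for x
    using u by (simp_all add: bij_is_inj bij_is_surj surj_f_inv_f)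
  have s: "inv (u \<circ> swap i (i + 1)) x = swap i (i + 1) (inv u x)" for x
    using u by (simp add: o_inv_distrib)
  show "(u i, u (i + 1)) \<notin> inversions u" by (simp add: mem_inversions iv)
  have "a < b \<and> swap i (i + 1) (inv u b) < swap i (i + 1) (inv u a)
    \<longleftrightarrow> (a = u i \<and> b = u (i + 1)) \<or> (a < b \<and> inv u b < inv u a)" for a b
  proof (cases "(inv u a = i \<and> inv u b = i + 1) \<or> (inv u a = i + 1 \<and> inv u b = i)")
    case True
    then have "(a = u i \<and> b = u (i + 1)) \<or> (a = u (i + 1) \<and> b = u i)" by (metis vi)
    then show ?thesis
    proof
      assume ab: "a = u i \<and> b = u (i + 1)"
      then show ?thesis using i by (simp add: iv)
    next
      assume ab: "a = u (i + 1) \<and> b = u i"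
      then have "\<not> a < b" "\<not> (a = u i \<and> b = u (i + 1))" using i by auto
      then show ?thesis by blast
    qed
  next
    case False
    then have "\<not> (a = u i \<and> b = u (i + 1))" using iv by auto
    moreover have "swap i (i + 1) x < swap i (i + 1) y \<longleftrightarrow> x < y"
      if "\<not> (x = i \<and> y = i + 1)" "\<not> (x = i + 1 \<and> y = i)" for x y
      using that by (auto simp: Transposition.transpose_def)
    ultimately show ?thesis using False by blast
  qed
  then show "inversions (u \<circ> swap i (i + 1)) = insert (u i, u (i + 1)) (inversions u)"
    unfolding inversions_def s by auto
qed

text \<open>Such an f lies above the identity pointwise, and both have the same sum over
  {1..n}.\<close>

lemma increasing_permutation_id:
  assumes f: "f permutes {1..n::nat}" and inc: "\<And>i. i \<in> {1..<n} \<Longrightarrow> f i < f (i + 1)"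
  shows "f = id"
proof -
  have ge: "i \<le> f i" if "i \<le> n" for i
    using that
  proof (induction i)
    case (Suc i)
    show ?case
    proof (cases "i = 0")
      case True
      then show ?thesis using permutes_in_image[OF f, of 1] Suc.prems by auto
    next
      case False
      then show ?thesis using Suc inc[of i] by fastforce
    qed
  qed simp
  have "(\<Sum>i\<in>{1..n}. f i) = (\<Sum>i\<in>{1..n}. i)"
    using sum.permute[OF f, of id] by (simp add: comp_def)
  then have "f i = i" if "i \<in> {1..n}" for i
    using sum_mono_inv[of id "{1..n}" f i] that ge by force
  then show ?thesis using permutes_not_in[OF f] by (auto simp: fun_eq_iff)
qed

text \<open>Otherwise \<open>inv w \<circ> u\<close> would increase at every position and be the
  identity.\<close>

lemma exists_ascent_in_inversions:
  assumes u: "u permutes {1..n}" and w: "w permutes {1..n}" and sub: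
      "inversions u \<subseteq> inversions w" and ne: "u \<noteq> w"
  shows "\<exists>i\<in>{1..<n}. u i < u (i + 1) \<and> (u i, u (i + 1)) \<in> inversions w"
proof (rule ccontr)
  assume a: "\<not> ?thesis"
  have iv: "inv u (u x) = x" for x using u permutes_inverses(2) by metis
  have injw: "inv w x = inv w y \<longleftrightarrow> x = y" for x y
    using permutes_inj[OF permutes_inv[OF w]] by (simp add: inj_eq)
  have inju: "u x = u y \<longleftrightarrow> x = y" for x y using permutes_inj[OF u] by (simp add: inj_eq)
  have "inv w \<circ> u = id"
  proof (rule increasing_permutation_id)
    show "inv w \<circ> u permutes {1..n}" using u w by (simp add: permutes_compose permutes_inv)
    fix i assume i: "i \<in> {1..<n}"
    show "(inv w \<circ> u) i < (inv w \<circ> u) (i + 1)"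
    proof (cases "u i < u (i + 1)")
      case True
      then have "\<not> inv w (u (i + 1)) < inv w (u i)" using a i by (auto simp: mem_inversions)
      then show ?thesis using injw[of "u i" "u (i + 1)"] True by auto
    next
      case False
      then have "u (i + 1) < u i" using inju[of i "i + 1"] by auto
      then have "(u (i + 1), u i) \<in> inversions u" by (simp add: mem_inversions iv)
      then have "(u (i + 1), u i) \<in> inversions w" using sub by blast
      then show ?thesis by (simp add: mem_inversions)
    qed
  qed
  then have "w \<circ> (inv w \<circ> u) = w" by simp
  moreover have "w \<circ> (inv w \<circ> u) = u" using permutes_inverses(1)[OF w] by (simp add: fun_eq_iff)
  ultimately show False using ne by simp
qed

lemma inversions_inject:
  assumes u: "u permutes {1..n}" and w: "w permutes {1..n}" and eq: "inversions u = inversions w"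
  shows "u = w"
proof (rule ccontr)
  assume "u \<noteq> w"
  then obtain i where "u i < u (i + 1)" "(u i, u (i + 1)) \<in> inversions u"
    using exists_ascent_in_inversions[OF u w] eq by auto
  then show False using inversions_swap(2) permutes_bij[OF u] by blast
qed

lemma weak_step_inversions:
  assumes "(u, w) \<in> weak_step n"
  shows "\<exists>x. x \<notin> inversions u \<and> inversions w = insert x (inversions u)"
proof -
  obtain i where i: "u permutes {1..n}" "u i < u (i + 1)" "w = u \<circ> swap i (i + 1)"
    using assms by (auto simp: weak_step_def)
  show ?thesis using inversions_swap[OF permutes_bij[OF i(1)] i(2)] i(3) by blast
qed

lemma weak_order_iff:
  "(u, w) \<in> weak_order n \<longleftrightarrow> u permutes {1..n} \<and> w permutes {1..n} \<and> inversions u \<subseteq> inversions w"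
proof
  assume "(u, w) \<in> weak_order n"
  moreover have "inversions u \<subseteq> inversions w" if "(u, w) \<in> (weak_step n)\<^sup>+"
    using that by (induction rule: trancl_induct) (use weak_step_inversions in blast)+
  ultimately show "u permutes {1..n} \<and> w permutes {1..n} \<and> inversions u \<subseteq> inversions w"
    using weak_trancl unfolding weak_order_def by auto
next
  assume "u permutes {1..n} \<and> w permutes {1..n} \<and> inversions u \<subseteq> inversions w"
  then show "(u, w) \<in> weak_order n"
  proof (induction "card (inversions w - inversions u)" arbitrary: u rule: less_induct)
    case less
    then have u: "u permutes {1..n}" and w: "w permutes {1..n}" and sub: "inversions u \<subseteq> inversions w" by auto
    show ?case
    proof (cases "u = w")
      case True
      then show ?thesis using u unfolding weak_order_def by blast
    next
      case False
      then obtain i where i: "i \<in> {1..<n}" "u i < u (i + 1)" "(u i, u (i + 1)) \<in> inversions w"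
        using exists_ascent_in_inversions[OF u w sub] by blast
      define u' where "u' = u \<circ> swap i (i + 1)"
      have step: "(u, u') \<in> weak_step n" using u i by (auto simp: weak_step_def u'_def)
      have inv': "inversions u' = insert (u i, u (i + 1)) (inversions u)" "(u i, u (i + 1)) \<notin> inversions u"
        using inversions_swap[OF permutes_bij[OF u] i(2)] by (auto simp: u'_def)
      have "inversions w - inversions u' \<subset> inversions w - inversions u" using inv' i(3) by blast
      then have "card (inversions w - inversions u') < card (inversions w - inversions u)"
        using finite_inversions[OF w] by (intro psubset_card_mono) auto
      moreover have "u' permutes {1..n}" using weak_step_permutes[OF step] by simp
      ultimately have "(u', w) \<in> weak_order n" using less.hyps[of u'] w sub inv' i(3) by auto
      then show ?thesis using step unfolding weak_order_def by (auto intro: trancl_into_trancl2)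
    qed
  qed
qed

lemma covered_weak_order: "covered (weak_order n) q p \<longleftrightarrow> (q, p) \<in> weak_step n"
proof
  assume c: "covered (weak_order n) q p"
  then have "(q, p) \<in> (weak_step n)\<^sup>+" by (auto simp: covered_def weak_order_def)
  then obtain v where v: "(q, v) \<in> weak_step n" "v = p \<or> (v, p) \<in> (weak_step n)\<^sup>+"
    by (meson tranclD rtranclD)
  have "q \<noteq> v" using weak_step_decreases[OF v(1)] by auto
  moreover have "(q, v) \<in> weak_order n" "v \<noteq> p \<Longrightarrow> (v, p) \<in> weak_order n"
    using v by (auto simp: weak_order_def)
  ultimately show "(q, p) \<in> weak_step n" using c v(1) by (auto simp: covered_def)
next
  assume s: "(q, p) \<in> weak_step n"
  then obtain x where x: "x \<notin> inversions q" "inversions p = insert x (inversions q)"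
    using weak_step_inversions by blast
  have "z = q \<or> z = p" if z: "(q, z) \<in> weak_order n" "(z, p) \<in> weak_order n" for z
  proof -
    have "inversions z = inversions q \<or> inversions z = inversions p"
    proof -
      have "inversions q \<subseteq> inversions z" "inversions z \<subseteq> insert x (inversions q)"
        using z x unfolding weak_order_iff by auto
      then show ?thesis unfolding x(2) by (cases "x \<in> inversions z") auto
    qed
    then show ?thesis using inversions_inject z unfolding weak_order_iff by blast
  qed
  moreover have "(q, p) \<in> weak_order n" using s by (auto simp: weak_order_def)
  moreover have "q \<noteq> p" using x by auto
  ultimately show "covered (weak_order n) q p" by (auto simp: covered_def)
qed

definition descents :: "nat \<Rightarrow> (nat \<Rightarrow> nat) \<Rightarrow> nat set" where
  "descents n w = {i \<in> {1..<n}. w (i + 1) < w i}"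

lemma lower_covers_weak_order:
  assumes w: "w permutes {1..n}"
  shows "{q. covered (weak_order n) q w} = (\<lambda>i. w \<circ> swap i (i + 1)) ` descents n w"
    and "inj_on (\<lambda>i. w \<circ> swap i (i + 1)) (descents n w)"
proof -
  have sw: "w \<circ> swap i (i + 1) permutes {1..n}" if "i \<in> {1..<n}" for i
    using w that by (intro permutes_compose permutes_swap_id) auto
  have invol: "(u \<circ> swap i (i + 1)) \<circ> swap i (i + 1) = u" for u :: "nat \<Rightarrow> nat" and i
    by (simp add: o_assoc[symmetric])
  show "{q. covered (weak_order n) q w} = (\<lambda>i. w \<circ> swap i (i + 1)) ` descents n w"
  proof (intro equalityI subsetI)
    fix q assume "q \<in> {q. covered (weak_order n) q w}"
    then obtain i where i: "i \<in> {1..<n}" "q i < q (i + 1)" "w = q \<circ> swap i (i + 1)"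
      unfolding covered_weak_order by (auto simp: weak_step_def)
    have "q = w \<circ> swap i (i + 1)" using i(3) invol by simp
    moreover have "i \<in> descents n w" using i by (auto simp: descents_def)
    ultimately show "q \<in> (\<lambda>i. w \<circ> swap i (i + 1)) ` descents n w" by blast
  next
    fix q assume "q \<in> (\<lambda>i. w \<circ> swap i (i + 1)) ` descents n w"
    then obtain i where i: "i \<in> {1..<n}" "w (i + 1) < w i" "q = w \<circ> swap i (i + 1)"
      by (auto simp: descents_def)
    have "q i < q (i + 1)" "w = q \<circ> swap i (i + 1)" using i(2) unfolding i(3) invol by simp_all
    then have "(q, w) \<in> weak_step n"
      unfolding weak_step_def mem_Collect_eq case_prod_conv
      using sw[OF i(1)] i(1) unfolding i(3)[symmetric] by blast
    then show "q \<in> {q. covered (weak_order n) q w}" unfolding covered_weak_order by simp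
  qed
  show "inj_on (\<lambda>i. w \<circ> swap i (i + 1)) (descents n w)"
  proof (rule inj_onI)
    fix i j assume ij: "i \<in> descents n w" "j \<in> descents n w" "w \<circ> swap i (i + 1) = w \<circ> swap j (j + 1)"
    have "swap i (i + 1) = swap j (j + 1)"
      using ij(3) permutes_inj[OF w] by (simp add: fun_eq_iff inj_eq)
    then have "swap i (i + 1) i = swap j (j + 1) i" "swap i (i + 1) (i + 1)
        = swap j (j + 1) (i + 1)" by simp_all
    then show "i = j" by (auto simp: Transposition.transpose_def split: if_splits)
  qed
qed

lemma finite_poset_weak_order: "finite_poset (weak_order n)"
  proof
  show "Partial_order (weak_order n)" by (rule Partial_order_weak_order)
  show "finite (Field (weak_order n))" unfolding Field_weak_order by (rule finite_permutations) simp
qed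

lemma id_weak_order: "(id, w) \<in> weak_order n \<longleftrightarrow> w permutes {1..n}"
  by (auto simp: weak_order_iff inversions_id permutes_id)

lemma descents_nonempty:
  assumes w: "w permutes {1..n}" "w \<noteq> id" shows "descents n w \<noteq> {}"
proof
  assume "descents n w = {}"
  then have "w i < w (i + 1)" if "i \<in> {1..<n}" for i
  proof -
    have "w i \<noteq> w (i + 1)" using inj_eq[OF permutes_inj[OF w(1)], of i "i + 1"] by simp
    moreover have "\<not> w (i + 1) < w i" using \<open>descents n w = {}\<close> that by (auto simp: descents_def)
    ultimately show ?thesis by simp
  qed
  then show False using increasing_permutation_id[OF w(1)] w(2) by blast
qed

lemma descent_swap:
  assumes w: "w permutes {1..n}" and i: "i \<in> descents n w"
  shows "w \<circ> swap i (i + 1) permutes {1..n}" "card (inversions w)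
      = Suc (card (inversions (w \<circ> swap i (i + 1))))"
proof -
  have "covered (weak_order n) (w \<circ> swap i (i + 1)) w"
    using lower_covers_weak_order(1)[OF w] i by blast
  then have s: "(w \<circ> swap i (i + 1), w) \<in> weak_step n" unfolding covered_weak_order .
  show p: "w \<circ> swap i (i + 1) permutes {1..n}" using weak_step_permutes[OF s] by simp
  show "card (inversions w) = Suc (card (inversions (w \<circ> swap i (i + 1))))"
    using weak_step_inversions[OF s] finite_inversions[OF p] by auto
qed

lemma weak_order_recursion:
  assumes w: "w permutes {1..n}"
  shows "w \<noteq> id \<Longrightarrow> chain_num (weak_order n) id w = (\<Sum>i\<in>descents n w. chain_num (weak_order n) id (w \<circ>
      swap i (i + 1)))"
    and "finite_poset.chain_sum (weak_order n) h id w = real (chain_num (weak_order n) id w) * h w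
      + (\<Sum>i\<in>descents n w. finite_poset.chain_sum (weak_order n) h id (w \<circ> swap i (i + 1)))"
proof -
  interpret finite_poset "weak_order n" by (rule finite_poset_weak_order)
  have cov: "{z. covered (weak_order n) z w \<and> (id, z) \<in> weak_order n} = (\<lambda>i. w \<circ> swap i (i + 1)) ` descents n w"
    unfolding lower_covers_weak_order(1)[OF w, symmetric] covered_weak_order id_weak_order
    using weak_step_permutes by blast
  have idw: "(id, w) \<in> weak_order n" using w by (simp add: id_weak_order)
  show "w \<noteq> id \<Longrightarrow> chain_num (weak_order n) id w = (\<Sum>i\<in>descents n w. chain_num (weak_order n) id (w \<circ> swap
      i (i + 1)))"
    using chain_num_rec[OF idw] unfolding cov sum.reindex[OF lower_covers_weak_order(2)[OF w]] by simp
  show "chain_sum h id w = real (chain_num (weak_order n) id w) * h w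
      + (\<Sum>i\<in>descents n w. chain_sum h id (w \<circ> swap i (i + 1)))"
    using chain_sum_rec[OF idw, of h] unfolding cov sum.reindex[OF lower_covers_weak_order(2)[OF w]] by simp
qed

section \<open>Transfer of the weak order to permutations of the integers\<close>

definition lift_int :: "(nat \<Rightarrow> nat) \<Rightarrow> int \<Rightarrow> int" where
  "lift_int w k = (if k < 0 then k else int (w (nat k)))"

lemma lift_int_comp: "lift_int (u \<circ> w) = lift_int u \<circ> lift_int w"
  by (auto simp: lift_int_def fun_eq_iff)

lemma lift_int_id: "lift_int id = id"
  by (auto simp: lift_int_def fun_eq_iff)

lemma lift_int_swap: "lift_int (swap a b) = swap (int a) (int b)"
  by (auto simp: lift_int_def fun_eq_iff Transposition.transpose_def nat_eq_iff)

lemma inv_lift_int: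
  assumes "bij w" shows "bij (lift_int w)" "inv (lift_int w) = lift_int (inv w)"
proof -
  have 1: "lift_int w \<circ> lift_int (inv w) = id" "lift_int (inv w) \<circ> lift_int w = id"
    using assms by (simp_all add: lift_int_comp[symmetric] lift_int_id bij_is_surj bij_is_inj
        surj_iff[THEN iffD1] inj_iff[THEN iffD1])
  show "bij (lift_int w)" using o_bij[OF 1(2) 1(1)] .
  show "inv (lift_int w) = lift_int (inv w)" using inv_unique_comp[OF 1] .
qed

lemma lift_int_permutes:
  assumes "w permutes {1..n}" shows "lift_int w permutes {- int n..int n}"
proof -
  have "lift_int w x = x" if "x \<notin> {- int n..int n}" for x
  proof (cases "x < 0")
    case False
    then have "nat x \<notin> {1..n}" using that by (auto simp: nat_le_iff)
    then show ?thesis using permutes_not_in[OF assms] False by (simp add: lift_int_def)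
  qed (simp add: lift_int_def)
  moreover have "\<exists>!x. lift_int w x = y" for y
    using inv_lift_int(1)[OF permutes_bij[OF assms]] by (metis bij_pointE)
  ultimately show ?thesis unfolding permutes_def by blast
qed

text \<open>The lift is taken of \<open>inv w\<close> because \<open>left_des\<close> looks at
  adjacent values, whereas the right weak order exchanges adjacent positions. The larger window
  brings no new descents, as w is the identity outside {1..n}.\<close>

lemma left_des_lift:
  assumes w: "w permutes {1..n}" and K: "int n \<le> K"
  shows "left_des K (lift_int (inv w)) = int ` descents n w"
proof -
  have b: "bij w" using w by (rule permutes_bij)
  have v: "inv (lift_int (inv w)) = lift_int w"
    using inv_lift_int(2)[OF bij_imp_bij_inv[OF b]] b by (simp add: inv_inv_eq)
  have out: "w x = x" if "x \<notin> {1..n}" for x using permutes_not_in[OF w that] .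
  have mem: "w x \<in> {1..n} \<longleftrightarrow> x \<in> {1..n}" for x using permutes_in_image[OF w] .
  have lt: "w (Suc k) < w k \<Longrightarrow> k \<in> {1..<n}" for k
    using out[of k] out[of "Suc k"] mem[of k] mem[of "Suc k"]
    by (cases "k \<in> {1..n}"; cases "Suc k \<in> {1..n}") auto
  have "lift_int w (i + 1) < lift_int w i \<longleftrightarrow> i \<in> int ` descents n w" for i
  proof (cases "i < 0")
    case True
    then show ?thesis by (auto simp: lift_int_def)
  next
    case False
    then obtain k where k: "i = int k" by (metis nonneg_int_cases not_less)
    have "lift_int w (i + 1) < lift_int w i \<longleftrightarrow> w (Suc k) < w k"
      unfolding k lift_int_def by (simp add: nat_add_distrib)
    also have "\<dots> \<longleftrightarrow> k \<in> descents n w" using lt by (auto simp: descents_def)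
    finally show ?thesis unfolding k by auto
  qed
  moreover have "descents n w \<subseteq> {1..<n}" by (auto simp: descents_def)
  ultimately show ?thesis unfolding left_des_def v using K by force
qed

lemma lift_int_inv_swap:
  assumes "bij w"
  shows "swap (int i) (int i + 1) \<circ> lift_int (inv w) = lift_int (inv (w \<circ> swap i (i + 1)))"
proof -
  have "inv (w \<circ> swap i (i + 1)) = swap i (i + 1) \<circ> inv w" using assms by (simp add: o_inv_distrib)
  then show ?thesis by (simp add: lift_int_comp lift_int_swap add.commute)
qed

lemma sum_left_des_lift:
  assumes w: "w permutes {1..n}" and K: "int n \<le> K"
  shows "(\<Sum>i\<in>left_des K (lift_int (inv w)). F (swap i (i + 1) \<circ> lift_int (inv w)))
    = (\<Sum>i\<in>descents n w. F (lift_int (inv (w \<circ> swap i (i + 1)))))"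
  unfolding left_des_lift[OF w K] by (subst sum.reindex) (simp_all add: lift_int_inv_swap[OF
      permutes_bij[OF w]])

text \<open>One induction on the number of inversions proves all four claims, since the four
  quantities obey recursions over the same descents. The factor in the third claim is the number of
  elements on a maximal chain, one more than the number of inversions of w.\<close>

lemma counts_weak_order:
  assumes w: "w permutes {1..n}" and K: "int n \<le> K"
  shows "chain_count K (card (inversions w)) (lift_int (inv w)) = int (chain_num (weak_order n) id w)"
    and "real_of_int (des_count K (Suc (card (inversions w))) (lift_int (inv w)))
      = finite_poset.chain_sum (weak_order n) (\<lambda>w. real (card (descents n w))) id w"
    and "finite_poset.chain_sum (weak_order n) (\<lambda>_. 1) id w = real (Suc (card (inversions w))) * real
        (chain_num (weak_order n) id w)"
    and "chain_num (weak_order n) id w > 0"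
proof -
  interpret finite_poset "weak_order n" by (rule finite_poset_weak_order)
  have "chain_count K (card (inversions w)) (lift_int (inv w)) = int (chain_num (weak_order n) id w)
    \<and> real_of_int (des_count K (Suc (card (inversions w))) (lift_int (inv w)))
      = chain_sum (\<lambda>w. real (card (descents n w))) id w
    \<and> chain_sum (\<lambda>_. 1) id w = real (Suc (card (inversions w))) * real (chain_num (weak_order n) id w)
    \<and> chain_num (weak_order n) id w > 0"
    using w
  proof (induction "card (inversions w)" arbitrary: w rule: less_induct)
    case less
    note w = less.prems
    have IH: "chain_count K (card (inversions u)) (lift_int (inv u)) = int (chain_num (weak_order n) id u)"
      "real_of_int (des_count K (Suc (card (inversions u))) (lift_int (inv u)))
          = chain_sum (\<lambda>w. real (card (descents n w))) id u"
      "chain_sum (\<lambda>_. 1) id u = real (Suc (card (inversions u))) * real (chain_num (weak_order n) id u)"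
      "chain_num (weak_order n) id u > 0" "card (inversions w) = Suc (card (inversions u))"
      if "i \<in> descents n w" "u = w \<circ> swap i (i + 1)" for i u
      using less.hyps[of u] descent_swap[OF w that(1)] that(2) by auto
    define L where "L = card (inversions w)"
    show ?case
    proof (cases "w = id")
      case True
      have d: "descents n w = {}" using True by (auto simp: descents_def)
      have l: "card (inversions w) = 0" using True by (simp add: inversions_id)
      have f: "chain_num (weak_order n) id w = 1"
        using True chain_num_self Field_weak_order permutes_id by auto
      show ?thesis
        unfolding l weak_order_recursion(2)[OF w] des_count.simps sum_left_des_lift[OF w K] d f
        using True d left_des_lift[OF w K] by (simp add: lift_int_id)
    next
      case False
      obtain j where "j \<in> descents n w" using descents_nonempty[OF w False] by blast
      then obtain l where l: "card (inversions w) = Suc l" using IH(5) by blast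
      have lu: "card (inversions (w \<circ> swap i (i + 1))) = l" if "i \<in> descents n w" for i
        using IH(5)[OF that refl] l by simp
      have c1: "chain_count K (Suc l) (lift_int (inv w)) = int (chain_num (weak_order n) id w)"
        unfolding chain_count.simps sum_left_des_lift[OF w K] weak_order_recursion(1)[OF w False] of_nat_sum
        using IH(1)[OF _ refl] lu by (intro sum.cong refl) simp
      have c2: "real_of_int (des_count K (Suc (Suc l)) (lift_int (inv w)))
          = chain_sum (\<lambda>w. real (card (descents n w))) id w"
        unfolding des_count.simps(2)[of K "Suc l"] sum_left_des_lift[OF w K] weak_order_recursion(2)[OF
            w] c1 of_int_add of_int_sum
        using IH(2)[OF _ refl] lu left_des_lift[OF w K]
        by (simp add: card_image del: des_count.simps)
      have c3: "chain_sum (\<lambda>_. 1) id w = real (Suc (Suc l)) * real (chain_num (weak_order n) id w)"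
      proof -
        have "(\<Sum>i\<in>descents n w. chain_sum (\<lambda>_. 1) id (w \<circ> swap i (i + 1)))
           = (\<Sum>i\<in>descents n w. real (Suc l) * real (chain_num (weak_order n) id (w \<circ> swap i (i + 1))))"
          using IH(3)[OF _ refl] lu by (intro sum.cong refl) simp
        also have "\<dots> = real (Suc l) * real (chain_num (weak_order n) id w)"
          unfolding weak_order_recursion(1)[OF w False] by (simp add: sum_distrib_left)
        finally show ?thesis unfolding weak_order_recursion(2)[OF w] by (simp add: algebra_simps)
      qed
      have c4: "chain_num (weak_order n) id w > 0"
        unfolding weak_order_recursion(1)[OF w False]
        by (rule sum_pos) (use IH(4)[OF _ refl] descents_nonempty[OF w False] in \<open>auto simp: descents_def\<close>)
      show ?thesis unfolding l using c1 c2 c3 c4 by blast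
    qed
  qed
  then show "chain_count K (card (inversions w)) (lift_int (inv w)) = int (chain_num (weak_order n) id w)"
    "real_of_int (des_count K (Suc (card (inversions w))) (lift_int (inv w)))
      = chain_sum (\<lambda>w. real (card (descents n w))) id w"
    "chain_sum (\<lambda>_. 1) id w = real (Suc (card (inversions w))) * real (chain_num (weak_order n) id w)"
    "chain_num (weak_order n) id w > 0" by auto
qed

lemma card_lower_covers_weak_order:
  assumes w: "w permutes {1..n}"
  shows "card {q. covered (weak_order n) q w \<and> (id, q) \<in> weak_order n} = card (descents n w)"
proof -
  have "{q. covered (weak_order n) q w \<and> (id, q) \<in> weak_order n} = {q. covered (weak_order n) q w}"
    unfolding covered_weak_order id_weak_order using weak_step_permutes by blast
  then show ?thesis
    unfolding lower_covers_weak_order(1)[OF w] using card_image[OF lower_covers_weak_order(2)[OF w]] by simp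
qed

lemma expect_Y_weak_order:
  assumes w: "w permutes {1..n}" and K: "int n \<le> K"
  shows "expect_Y (interval (weak_order n) id w)
    = real_of_int (des_count K (Suc (card (inversions w))) (lift_int (inv w)))
      / (real (Suc (card (inversions w))) * real_of_int (chain_count K (card (inversions w)) (lift_int
          (inv w))))"
proof -
  interpret finite_poset "weak_order n" by (rule finite_poset_weak_order)
  have "chain_sum (\<lambda>p. real (card {q. covered (weak_order n) q p \<and> (id, q) \<in> weak_order n})) id w
    = chain_sum (\<lambda>p. real (card (descents n p))) id w"
    unfolding chain_sum_def
    by (intro sum.cong refl) (simp only: mem_Collect_eq id_weak_order[THEN iffD1] card_lower_covers_weak_order)
  then show ?thesis
    unfolding expect_Y_interval[OF id_weak_order[THEN iffD2, OF w]]
    by (simp only: counts_weak_order[OF w K] of_int_of_nat_eq)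
qed

section \<open>Reduction of vexillary to dominant permutations\<close>

lemma sort_filter_mset:
  fixes xs ys :: "nat list"
  assumes "mset xs = mset ys"
  shows "sort (filter P xs) = sort (filter P ys)"
  using assms by (metis mset_filter sorted_list_of_multiset_mset)

lemma mset_map_interval: "mset (map f [1..<n + 1]) = image_mset f (mset_set {1..n})"
proof -
  have "mset [1..<n + 1] = mset_set {1..n}"
    by (metis Suc_eq_plus1 atLeastLessThanSuc_atLeastAtMost mset_upt)
  then show ?thesis by simp
qed

lemma shape_permuted_code:
  assumes s: "s permutes {1..n}" and "lehmer n w' = lehmer n w \<circ> s"
  shows "shape n w' = shape n w"
proof -
  have "mset (map (lehmer n w') [1..<n + 1]) = image_mset (lehmer n w) (image_mset s (mset_set {1..n}))"
    unfolding mset_map_interval assms(2) by (simp add: multiset.map_comp)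
  also have "image_mset s (mset_set {1..n}) = mset_set {1..n}"
    using image_mset_mset_set[OF permutes_inj_on[OF s]] permutes_image[OF s] by simp
  finally have "mset (map (lehmer n w') [1..<n + 1]) = mset (map (lehmer n w) [1..<n + 1])"
    unfolding mset_map_interval .
  from sort_filter_mset[OF this] show ?thesis unfolding shape_def by simp
qed

lemma sum_list_shape:
  "sum_list (shape n w) = (\<Sum>i\<in>{1..n}. lehmer n w i)"
proof -
  have "sum_list (shape n w) = sum_mset (filter_mset (\<lambda>c. c \<noteq> 0) (image_mset (lehmer n w) (mset_set {1..n})))"
    unfolding shape_def mset_map_interval[symmetric]
    by (metis mset_filter mset_rev mset_sort sum_mset_sum_list)
  also have "\<dots> = sum_mset (image_mset (lehmer n w) (mset_set {1..n}))"
  proof -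
    have "sum_mset (filter_mset (\<lambda>c. c \<noteq> 0) M) = sum_mset M" for M :: "nat multiset"
      by (induction M) auto
    then show ?thesis .
  qed
  finally show ?thesis by (simp add: sum_unfold_sum_mset)
qed

lemma card_inversions_shape:
  assumes w: "w permutes {1..n}"
  shows "card (inversions w) = sum_list (shape n w)"
proof -
  have iv: "inv w (w x) = x" for x using permutes_inverses(2)[OF w] .
  have vi: "w (inv w x) = x" for x using permutes_inverses(1)[OF w] .
  let ?S = "SIGMA i:{1..n}. {j \<in> {1..n}. i < j \<and> w j < w i}"
  have "bij_betw (\<lambda>(i, j). (w j, w i)) ?S (inversions w)"
  proof (rule bij_betwI[where g = "\<lambda>(a, b). (inv w b, inv w a)"])
    show "(\<lambda>(i, j). (w j, w i)) \<in> ?S \<rightarrow> inversions w" by (auto simp: mem_inversions iv)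
    have im: "inv w x \<in> {1..n} \<longleftrightarrow> x \<in> {1..n}" for x using permutes_in_image[OF permutes_inv[OF w]] .
    show "(\<lambda>(a, b). (inv w b, inv w a)) \<in> inversions w \<rightarrow> ?S"
    proof
      fix p assume p: "p \<in> inversions w"
      obtain a b where ab: "p = (a, b)" by force
      have "a \<in> {1..n}" "b \<in> {1..n}" "a < b" "inv w b < inv w a"
        using subsetD[OF inversions_subset[OF w] p] p unfolding ab by (auto simp: mem_inversions)
      then show "(\<lambda>(a, b). (inv w b, inv w a)) p \<in> ?S" using im[of a] im[of b] ab by (simp add: vi)
    qed
  qed (auto simp: iv vi)
  then have "card (inversions w) = card ?S" by (rule bij_betw_same_card[symmetric])
  also have "\<dots> = (\<Sum>i\<in>{1..n}. lehmer n w i)" by (simp add: lehmer_def)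
  finally show ?thesis by (simp add: sum_list_shape)
qed

lemma card_Collect_bij:
  assumes "bij f" "\<And>j. P j \<longleftrightarrow> R (f j)" shows "card {j. P j} = card {j. R j}"
proof -
  have "f ` {j. P j} = {j. R j}"
  proof (intro equalityI subsetI)
    fix x assume "x \<in> {j. R j}"
    moreover obtain j where "x = f j" using bij_is_surj[OF assms(1)] by (rule surjE)
    ultimately show "x \<in> f ` {j. P j}" using assms(2)[of j] by blast
  qed (use assms(2) in blast)
  then show ?thesis using card_image[of f "{j. P j}"] bij_is_inj[OF assms(1)] inj_on_subset
      by (metis subset_UNIV)
qed

text \<open>
  The assumptions \<open>H1\<close> to \<open>H4\<close> say that after exchanging the values \<open>w r\<close> and \<open>w s\<close> the entry at \<open>r\<close> has only
  one Bruhat cover on each side; \<open>H5\<close> is only needed to stay vexillary.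
\<close>

locale transition =
  fixes n :: nat and w :: "nat \<Rightarrow> nat" and q r s :: nat
  assumes w: "w permutes {1..n}" and vex: "vexillary n w"
    and q1: "1 \<le> q" and sn: "s \<le> n" and ord: "q < r" "r < s" "w q < w s" "w s < w r"
    and H1: "\<And>p. q < p \<Longrightarrow> p < r \<Longrightarrow> w s < w p"
    and H2: "\<And>p. p < q \<Longrightarrow> w p < w q \<or> w s < w p"
    and H3: "\<And>p. r < p \<Longrightarrow> p < s \<Longrightarrow> w p < w s"
    and H4: "\<And>p. s < p \<Longrightarrow> w p < w s \<or> w r < w p"
    and H5: "\<And>i j k. 1 \<le> i \<Longrightarrow> r < j \<Longrightarrow> i < j \<Longrightarrow> j < k \<Longrightarrow> k \<le> n \<Longrightarrow> \<not> (w i < w k \<and> w k < w j)"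
begin

text \<open>On the positions q < r < s the patterns of w, w0 and w' are 132, 123 and 213. So w and
  w' arise from w0 by exchanging the value \<open>w s\<close> with the next larger and the next
  smaller of the three.\<close>

definition w0 where "w0 = swap (w s) (w r) \<circ> w"
definition w' where "w' = swap (w q) (w s) \<circ> w0"

lemma w_eq_iff: "w i = w j \<longleftrightarrow> i = j" using permutes_inj[OF w] by (simp add: inj_eq)

lemma w0_apply: "w0 q = w q" "w0 r = w s" "w0 s = w r" "i \<noteq> r \<Longrightarrow> i \<noteq> s \<Longrightarrow> w0 i = w i"
  using ord w_eq_iff by (auto simp: w0_def Transposition.transpose_def)

lemma w'_apply: "w' q = w s" "w' r = w q" "w' s = w r" "i \<noteq> q \<Longrightarrow> i \<noteq> r \<Longrightarrow> i \<noteq> s \<Longrightarrow> w' i = w i"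
  using ord w_eq_iff by (auto simp: w'_def w0_def Transposition.transpose_def)

lemma in_range: "q \<in> {1..n}" "r \<in> {1..n}" "s \<in> {1..n}" "w q \<in> {1..n}" "w r \<in> {1..n}" "w s \<in> {1..n}"
  using q1 sn ord permutes_in_image[OF w, of q] permutes_in_image[OF w, of r] permutes_in_image[OF w, of
      s] by auto

lemma w0_permutes: "w0 permutes {1..n}"
  unfolding w0_def using in_range by (intro permutes_compose[OF w] permutes_swap_id)

lemma w'_permutes: "w' permutes {1..n}"
  unfolding w'_def using in_range by (intro permutes_compose[OF w0_permutes] permutes_swap_id)

lemma inv_w0: "inv w0 (w0 i) = i" "w0 (inv w0 i) = i"
  using permutes_inverses[OF w0_permutes] by auto

text \<open>An instance of \<open>counts_transition\<close> for the lift of \<open>inv w0\<close>.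
  Inversion turns values into positions, so the fixed position is \<open>w s\<close>, with
  neighbours \<open>w q\<close> and \<open>w r\<close>. \<open>H3\<close> and \<open>H4\<close> give
  the condition \<open>NE\<close>, \<open>H1\<close> and \<open>H2\<close> give
  \<open>SW\<close>.\<close>

lemma counts:
  assumes K: "int n < K"
  shows "chain_count K m (lift_int (inv w')) = chain_count K m (lift_int (inv w))"
    and "des_count K m (lift_int (inv w')) = des_count K m (lift_int (inv w))"
proof -
  let ?V = "lift_int (inv w0)"
  have "w = swap (w s) (w r) \<circ> w0" unfolding w0_def by (simp add: o_assoc)
  then have "inv w = inv w0 \<circ> swap (w s) (w r)"
    using permutes_bij[OF w0_permutes] by (metis bij_swap_iff bij_id inv_swap_id o_inv_distrib
        bij_transpose inv_transpose_eq)
  then have 1: "lift_int (inv w) = ?V \<circ> swap (int (w s)) (int (w r))" by (simp add: lift_int_comp lift_int_swap)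
  have "inv w' = inv w0 \<circ> swap (w q) (w s)"
    unfolding w'_def using permutes_bij[OF w0_permutes] by (simp add: o_inv_distrib)
  then have 2: "lift_int (inv w') = ?V \<circ> swap (int (w q)) (int (w s))"
      by (simp add: lift_int_comp lift_int_swap)
  have V: "?V (int (w q)) = int q" "?V (int (w s)) = int r" "?V (int (w r)) = int s"
    using inv_w0(1)[of q] inv_w0(1)[of r] inv_w0(1)[of s] w0_apply by (simp_all add: lift_int_def)
  have Vp: "?V permutes {- int n..int n}" by (rule lift_int_permutes[OF permutes_inv[OF w0_permutes]])
  have NE: "int (w r) \<le> p \<and> int s \<le> ?V p" if p: "int (w s) < p" "int r < ?V p" for p
  proof -
    define t where "t = inv w0 (nat p)"
    have t: "?V p = int t" "p = int (w0 t)" using p(1) inv_w0(2) by (auto simp: lift_int_def t_def)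
    have "r < t" "w s < w0 t" using p t by auto
    then have "s \<le> t \<and> w r \<le> w0 t"
      using w0_apply H3[of t] H4[of t] by (cases "t < s"; cases "t = s") auto
    then show ?thesis using t by auto
  qed
  have SW: "p \<le> int (w q) \<and> ?V p \<le> int q" if p: "p < int (w s)" "?V p < int r" for p
  proof (cases "p < 0")
    case True
    then show ?thesis by (simp add: lift_int_def)
  next
    case False
    define t where "t = inv w0 (nat p)"
    have t: "?V p = int t" "p = int (w0 t)" using False inv_w0(2) by (auto simp: lift_int_def t_def)
    have "t < r" "w0 t < w s" using p t by auto
    then have "t \<le> q \<and> w0 t \<le> w q"
      using w0_apply ord H1[of t] H2[of t] by (cases "t < q"; cases "t = q") auto
    then show ?thesis using t by auto
  qed
  have r: "\<bar>int (w q)\<bar> \<le> int n" "\<bar>int (w s)\<bar> \<le> int n" "\<bar>int (w r)\<bar> \<le> int n"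
    using in_range by auto
  have o: "int (w q) < int (w s)" "int (w s) < int (w r)" "?V (int (w q)) < ?V (int (w s))"
      "?V (int (w s)) < ?V (int (w r))"
    unfolding V using ord by auto
  note C = counts_transition[OF Vp r K o]
  show "chain_count K m (lift_int (inv w')) = chain_count K m (lift_int (inv w))"
    unfolding 1 2 by (rule C(1)[symmetric]) (use NE SW V in auto)
  show "des_count K m (lift_int (inv w')) = des_count K m (lift_int (inv w))"
    unfolding 1 2 by (rule C(2)[symmetric]) (use NE SW V in auto)
qed

text \<open>At a position before q the three entries are merely rearranged further right. Between q
  and r the entry \<open>w s\<close> seen to the right is replaced by \<open>w q\<close>, and both
  are smaller by \<open>H1\<close>. Between r and s neither the old nor the new entry at s is
  smaller, by \<open>H3\<close>. Only the codes at q and r change places.\<close>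

lemma lehmer_code_w': "lehmer n w' = lehmer n w \<circ> swap q r"
proof
  fix i
  \<comment> \<open>Right of r there is no value strictly between \<open>w s\<close> and
    \<open>w r\<close>. So apart from s the same entries count for \<open>w r\<close> at r and for
    \<open>w s\<close> at q.\<close>
  have X: "w j < w s" if "j \<in> {1..n}" "r < j" "j \<noteq> s" "w j < w r" for j
    using H3[of j] H4[of j] that by (cases "j < s") auto
  let ?A = "{j \<in> {1..n}. r < j \<and> j \<noteq> s \<and> w j < w s}"
  have finA: "finite ?A" by simp
  consider "i = q" | "i = r" | "i < q" | "q < i" "i < r" | "r < i" "i \<noteq> s" | "i = s" by linarith
  then show "lehmer n w' i = (lehmer n w \<circ> swap q r) i"
  proof cases
    case 1
    have "{j \<in> {1..n}. q < j \<and> w' j < w' q} = insert r ?A"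
    proof (intro set_eqI iffI)
      fix j assume j: "j \<in> {j \<in> {1..n}. q < j \<and> w' j < w' q}"
      then show "j \<in> insert r ?A"
        using w'_apply ord H1[of j] by (cases "j = r"; cases "j = s"; cases "j < r") auto
    next
      fix j assume "j \<in> insert r ?A"
      then show "j \<in> {j \<in> {1..n}. q < j \<and> w' j < w' q}" using w'_apply ord in_range by auto
    qed
    moreover have "{j \<in> {1..n}. r < j \<and> w j < w r} = insert s ?A"
      using X ord in_range by auto
    ultimately show ?thesis using 1 finA by (simp add: lehmer_def)
  next
    case 2
    have "{j \<in> {1..n}. r < j \<and> w' j < w' r} = {j \<in> {1..n}. q < j \<and> w j < w q}"
    proof (intro set_eqI)
      fix j show "j \<in> {j \<in> {1..n}. r < j \<and> w' j < w' r} \<longleftrightarrow> j \<in> {j \<in> {1..n}. q < j \<and> w j < w q}"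
        using w'_apply ord H1[of j] by (cases "j = r"; cases "j = s"; cases "j < r"; cases "j = q") auto
    qed
    then show ?thesis using 2 by (simp add: lehmer_def)
  next
    case 3
    \<comment> \<open>The cycle of positions with w' = w \<circ> f; it stays to the right of
      i.\<close>
    define f where "f = swap r s \<circ> swap q r"
    have b: "bij f" unfolding f_def by (simp add: bij_comp)
    have f: "f q = s" "f r = q" "f s = r" "j \<noteq> q \<Longrightarrow> j \<noteq> r \<Longrightarrow> j \<noteq> s \<Longrightarrow> f j = j" for j
      using ord by (simp_all add: f_def transpose_apply_other)
    have "w' j = w (f j) \<and> (i < j \<longleftrightarrow> i < f j) \<and> (j \<in> {1..n} \<longleftrightarrow> f j \<in> {1..n})" for j
    proof -
      consider "j = q" | "j = r" | "j = s" | "j \<noteq> q" "j \<noteq> r" "j \<noteq> s" by blast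
      then show ?thesis
      proof cases
        case 1
        then show ?thesis unfolding 1 f w'_apply using 3 ord in_range by simp
      next
        case 2
        then show ?thesis unfolding 2 f w'_apply using 3 ord in_range by simp
      next
        case 3
        then show ?thesis unfolding 3 f w'_apply using \<open>i < q\<close> ord in_range by simp
      next
        case 4
        show ?thesis unfolding f(4)[OF 4] w'_apply(4)[OF 4] by simp
      qed
    qed
    moreover have "w' i = w i" using w'_apply(4)[of i] 3 ord by simp
    ultimately have "lehmer n w' i = lehmer n w i"
      unfolding lehmer_def by (intro card_Collect_bij[OF b]) simp
    then show ?thesis using 3 ord by (simp add: transpose_apply_other)
  next
    case 4
    have b: "bij (swap r s)" by simp
    have "i < j \<and> w' j < w i \<longleftrightarrow> i < swap r s j \<and> w (swap r s j) < w i" for j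
    proof -
      consider "j = q" | "j = r" | "j = s" | "j \<noteq> q" "j \<noteq> r" "j \<noteq> s" by blast
      then show ?thesis
      proof cases
        case 1
        then show ?thesis using 4 ord by (simp add: transpose_apply_other)
      next
        case 2
        then show ?thesis using w'_apply 4 H1[OF 4] ord by simp
      next
        case 3
        then show ?thesis using w'_apply 4 H1[OF 4] ord by simp
      next
        case other: 4
        show ?thesis using w'_apply(4)[OF other] transpose_apply_other[of j r s] other by simp
      qed
    qed
    moreover have "j \<in> {1..n} \<longleftrightarrow> swap r s j \<in> {1..n}" for j
      using in_range by (auto simp: Transposition.transpose_def)
    moreover have "w' i = w i" using w'_apply(4)[of i] 4 ord by simp
    ultimately have "lehmer n w' i = lehmer n w i"
      unfolding lehmer_def by (intro card_Collect_bij[OF b]) simp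
    then show ?thesis using 4 ord by (simp add: transpose_apply_other)
  next
    case 5
    have "i < j \<and> w' j < w i \<longleftrightarrow> i < j \<and> w j < w i" for j
      using w'_apply ord 5 H3[of i] by (cases "j = s"; cases "j > i") auto
    moreover have "w' i = w i" using w'_apply(4)[of i] 5 ord by simp
    ultimately have "lehmer n w' i = lehmer n w i" unfolding lehmer_def by simp
    then show ?thesis using 5 ord by (simp add: transpose_apply_other)
  next
    case 6
    have "s < j \<and> w' j < w' s \<longleftrightarrow> s < j \<and> w j < w s" for j
      using w'_apply ord H4[of j] by (cases "j > s") auto
    then have "lehmer n w' s = lehmer n w s" unfolding lehmer_def by simp
    then show ?thesis using 6 ord by (simp add: transpose_apply_other)
  qed
qed

lemma shape_w': "shape n w' = shape n w"
  by (rule shape_permuted_code[OF permutes_swap_id lehmer_code_w']) (use in_range in auto)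

text \<open>The termination measure of the reduction. By \<open>H1\<close> every smaller entry to
  the right of q lies beyond r and is also counted at r, while s is counted only at r. So the code
  at r is the larger one, and it moves to the left.\<close>

lemma code_decreases:
  "(\<Sum>k\<in>{1..n}. int k * int (lehmer n w' k)) < (\<Sum>k\<in>{1..n}. int k * int (lehmer n w k))"
proof -
  have "{j \<in> {1..n}. q < j \<and> w j < w q} \<subset> {j \<in> {1..n}. r < j \<and> w j < w r}"
  proof (rule psubsetI)
    show "{j \<in> {1..n}. q < j \<and> w j < w q} \<subseteq> {j \<in> {1..n}. r < j \<and> w j < w r}"
    proof
      fix j assume j: "j \<in> {j \<in> {1..n}. q < j \<and> w j < w q}"
      then show "j \<in> {j \<in> {1..n}. r < j \<and> w j < w r}"
        using ord H1[of j] by (cases "j = r"; cases "j < r") auto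
    qed
    have "s \<in> {j \<in> {1..n}. r < j \<and> w j < w r} - {j \<in> {1..n}. q < j \<and> w j < w q}" using ord in_range by auto
    then show "{j \<in> {1..n}. q < j \<and> w j < w q} \<noteq> {j \<in> {1..n}. r < j \<and> w j < w r}" by blast
  qed
  then have lt: "lehmer n w q < lehmer n w r" unfolding lehmer_def by (intro psubset_card_mono) auto
  let ?R = "{1..n} - {q, r}"
  have eq: "{1..n} = insert q (insert r ?R)" using in_range by auto
  have split: "(\<Sum>k\<in>{1..n}. f k) = f q + f r + (\<Sum>k\<in>?R. f k)" for f :: "nat \<Rightarrow> int"
    using ord by (subst eq) simp
  have R: "(\<Sum>k\<in>?R. int k * int (lehmer n w' k)) = (\<Sum>k\<in>?R. int k * int (lehmer n w k))"
    by (rule sum.cong) (auto simp: lehmer_code_w' transpose_apply_other)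
  have "0 < (int r - int q) * (int (lehmer n w r) - int (lehmer n w q))" using lt ord by simp
  then show ?thesis
    unfolding split[of "\<lambda>k. int k * int (lehmer n w' k)"] split[of "\<lambda>k. int k * int (lehmer n w k)"] R
    by (simp add: lehmer_code_w' algebra_simps)
qed

lemma no_2143: "i1 \<in> {1..n} \<Longrightarrow> i4 \<in> {1..n} \<Longrightarrow> i1 < i2 \<Longrightarrow> i2 < i3 \<Longrightarrow> i3 < i4
    \<Longrightarrow> w i2 < w i1 \<Longrightarrow> w i1 < w i4 \<Longrightarrow> w i4 < w i3 \<Longrightarrow> False"
proof -
  assume a: "i1 \<in> {1..n}" "i4 \<in> {1..n}" "i1 < i2" "i2 < i3" "i3 < i4" "w i2 < w i1" "w i1 < w i4" "w i4 < w i3"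
  then have "i2 \<in> {1..n}" "i3 \<in> {1..n}" by auto
  then show False using vex a unfolding vexillary_def by blast
qed

text \<open>In a 2143 pattern of w' the positions of 2, 4 and 3 form a 132 pattern, so by
  \<open>not132\<close> the third position is at most r, and r itself would give a 2143 pattern of
  w. Before r only the entry at q has changed. The cases that survive the comparison of values
  become 2143 patterns of w, where a last position s turns into r because w' s = w r.\<close>

lemma vexillary_w': "vexillary n w'"
  unfolding vexillary_def
proof (rule notI, elim bexE conjE)
  fix i1 i2 i3 i4
  assume i: "i1 \<in> {1..n}" "i2 \<in> {1..n}" "i3 \<in> {1..n}" "i4 \<in> {1..n}" "i1 < i2" "i2 < i3" "i3 < i4"
    and p: "w' i2 < w' i1" "w' i1 < w' i4" "w' i4 < w' i3"
  \<comment> \<open>The positions a, b, r, s would form a 2143 pattern of w.\<close>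
  have Q: False if "a < b" "b < r" "w a < w s" "w b < w a" "1 \<le> a" for a b
    using no_2143[of a s b r] that ord in_range by auto
  have val: "w' j = (if j = q then w s else if j = r then w q else if j = s then w r else w j)" for j
    using w'_apply by auto
  \<comment> \<open>\<open>H5\<close> excludes 132 patterns of w with middle position beyond r, and
    this survives in w'. The delicate middle is s, whose entry has become \<open>w r\<close>: by
    \<open>H4\<close> a smaller later entry is already below \<open>w s\<close>.\<close>
  have not132: False if c: "r < j" "i < j" "j < k" "k \<le> n" "1 \<le> i" "w' i < w' k" "w' k < w' j" for i j k
  proof (cases "j = s")
    case True
    then have k: "w' k = w k" "w k < w s" using c H4[of k] ord val[of k] w'_apply(3) by auto
    have "\<not> (w q < w k \<and> w k < w s)" using H5[of q s k] c True q1 ord by auto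
    moreover have "i \<noteq> q" using c(6) k w'_apply(1) by auto
    moreover have "i \<noteq> r \<Longrightarrow> w' i = w i" using w'_apply(4)[of i] \<open>i \<noteq> q\<close> c True by auto
    moreover have "\<not> (w i < w k \<and> w k < w s)" using H5[of i s k] c True by auto
    ultimately show False using c(6) k w'_apply(2) by (cases "i = r") auto
  next
    case False
    have j: "w' j = w j" using w'_apply(4)[of j] c(1) False ord by simp
    have "k \<noteq> s"
    proof
      assume "k = s"
      then have "w r < w j" "j < s" using c(3,7) j w'_apply(3) by auto
      then show False using H3[OF c(1)] ord by simp
    qed
    then have k: "w' k = w k" using w'_apply(4)[of k] c(1,3) ord by simp
    have "\<not> (w q < w k \<and> w k < w j)" using H5[of q j k] c q1 ord by auto
    moreover have "\<not> (w i < w k \<and> w k < w j)" using H5[of i j k] c by auto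
    moreover have "w' i = w i \<or> w' i = w s \<or> w' i = w q \<or> w' i = w r" using val[of i] by presburger
    ultimately show False using c(6,7) j k ord by auto
  qed
  have "\<not> r < i3" using not132[of i3 i1 i4] i p by auto
  moreover have "i3 \<noteq> r"
  proof
    assume r: "i3 = r"
    have "i4 \<noteq> s" using p r w'_apply ord by auto
    then have 4: "w' i4 = w i4" using w'_apply(4) i r ord by auto
    have "i1 \<noteq> q" "i2 \<noteq> q" using p r w'_apply ord by auto
    then have "w' i1 = w i1" "w' i2 = w i2" using val i r ord by auto
    then show False using no_2143[of i1 i4 i2 r] i p 4 r w'_apply(2) ord by auto
  qed
  ultimately have 3: "i3 < r" by simp
  then have e: "j \<noteq> q \<Longrightarrow> w' j = w j" if "j < r" for j using that val ord by auto
  have 2: "i2 \<noteq> q \<Longrightarrow> w' i2 = w i2" using e i 3 by auto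
  have 1: "i1 \<noteq> q \<Longrightarrow> w' i1 = w i1" using e i 3 by auto
  have bad: False if "i1 \<noteq> q" "i2 \<noteq> q" "w' i1 < w s"
    using Q[of i1 i2] 1 2 that i 3 p by auto
  have "i3 \<noteq> q" using bad i p w'_apply(1) by auto
  then have d: "w' i3 = w i3" using e 3 by simp
  have "i4 \<noteq> q" using bad i p w'_apply(1) by auto
  have "i1 \<noteq> q" using H1[of i2] i 3 p 2 w'_apply(1) by auto
  then have b: "w' i1 = w i1" using 1 by simp
  show False
  proof (cases "i2 = q")
    case True
    consider "i4 = r" | "i4 = s" | "w' i4 = w i4" using w'_apply(4)[of i4] \<open>i4 \<noteq> q\<close> by blast
    then show False
    proof cases
      case 1
      then show False using True p w'_apply ord by auto
    next
      case 2
      then show False using no_2143[of i1 r q i3] True i p 3 b d w'_apply ord in_range by auto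
    next
      case 3
      then show False using no_2143[of i1 i4 q i3] True i p b d w'_apply ord by auto
    qed
  next
    case False
    then have a: "w' i2 = w i2" using 2 by simp
    consider "i4 = r" | "i4 = s" | "w' i4 = w i4" using w'_apply(4)[of i4] \<open>i4 \<noteq> q\<close> by blast
    then show False
    proof cases
      case 1
      then show False using bad \<open>i1 \<noteq> q\<close> False p w'_apply ord by auto
    next
      case 2
      then show False using no_2143[of i1 r i2 i3] i p 3 a b d w'_apply ord in_range by auto
    next
      case 3
      then show False using no_2143[of i1 i4 i2 i3] i p a b d by auto
    qed
  qed
qed

end

text \<open>r is the last middle position of a 132 pattern, s carries the largest value below
  \<open>w r\<close> to the right of r, and q is the last position before r with a value below
  \<open>w s\<close>. \<open>H1\<close>, \<open>H4\<close> and \<open>H5\<close> restate these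
  choices. A violation of \<open>H3\<close> at p gives a 132 pattern q, p, s with a later middle,
  and a violation of \<open>H2\<close> at p gives a 2143 pattern p, q, r, s.\<close>

lemma transition_exists:
  assumes w: "w permutes {1..n}" and vex: "vexillary n w" and nd: "\<not> dominant n w"
  shows "\<exists>q r s. transition n w q r s"
proof -
  have w_eq: "w i = w j \<longleftrightarrow> i = j" for i j using permutes_inj[OF w] by (simp add: inj_eq)
  have mem: "w i \<in> {1..n} \<longleftrightarrow> i \<in> {1..n}" for i using permutes_in_image[OF w] .
  define R where "R = {r \<in> {1..n}. \<exists>i k. 1 \<le> i \<and> i < r \<and> r < k \<and> k \<le> n \<and> w i < w k \<and> w k < w r}"
  have "R \<noteq> {}" using nd unfolding dominant_def R_def by fastforce
  define r where "r = Max R"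
  have rR: "r \<in> R" unfolding r_def by (rule Max_in) (use \<open>R \<noteq> {}\<close> in \<open>auto simp: R_def\<close>)
  have rmax: "j \<le> r" if "j \<in> R" for j unfolding r_def by (rule Max_ge) (use that in \<open>auto simp: R_def\<close>)
  define S where "S = {j \<in> {1..n}. r < j \<and> w j < w r}"
  obtain i k where ik: "1 \<le> i" "i < r" "r < k" "k \<le> n" "w i < w k" "w k < w r" using rR by (auto simp: R_def)
  have "finite S" "k \<in> S" using ik by (auto simp: S_def)
  then obtain s where s: "s \<in> S" "\<And>j. j \<in> S \<Longrightarrow> w j \<le> w s"
    using Max_in[of "w ` S"] Max_ge[of "w ` S"] by (metis (no_types, lifting) empty_is_image equals0D
        finite_imageI imageE imageI)
  have sp: "r < s" "s \<le> n" "w s < w r" using s(1) by (auto simp: S_def)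
  define Q where "Q = {p \<in> {1..n}. p < r \<and> w p < w s}"
  have "i \<in> Q" using ik s(2)[OF \<open>k \<in> S\<close>] by (auto simp: Q_def)
  have "finite Q" by (simp add: Q_def)
  define q where "q = Max Q"
  have qQ: "q \<in> Q" unfolding q_def using \<open>i \<in> Q\<close> \<open>finite Q\<close> by (intro Max_in) auto
  have qmax: "p \<le> q" if "p \<in> Q" for p unfolding q_def using that \<open>finite Q\<close> by simp
  have qp: "1 \<le> q" "q < r" "w q < w s" using qQ by (auto simp: Q_def)
  have H5: "\<not> (w i < w k \<and> w k < w j)" if "1 \<le> i" "r < j" "i < j" "j < k" "k \<le> n" for i j k
  proof
    assume "w i < w k \<and> w k < w j"
    then have "j \<in> R" using that unfolding R_def by auto
    then show False using rmax that by fastforce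
  qed
  have "transition n w q r s"
  proof
    show "w s < w p" if p: "q < p" "p < r" for p
    proof -
      have "p \<notin> Q" using qmax p by fastforce
      then have "w s \<le> w p" using p qp sp by (auto simp: Q_def)
      then show ?thesis using w_eq[of s p] p sp by auto
    qed
    show "w p < w q \<or> w s < w p" if p: "p < q" for p
    proof (rule ccontr)
      assume a: "\<not> ?thesis"
      then have wp: "w q < w p" "w p < w s" using w_eq[of p q] w_eq[of p s] p qp sp by auto
      have "p \<noteq> 0" using wp permutes_not_in[OF w, of 0] by (cases "p = 0") auto
      then have "p \<in> {1..n}" "q \<in> {1..n}" "r \<in> {1..n}" "s \<in> {1..n}" using p qp sp by auto
      then show False using vex p qp sp wp unfolding vexillary_def by blast
    qed
    show "w p < w s" if p: "r < p" "p < s" for p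
    proof (rule ccontr)
      assume "\<not> ?thesis"
      then have "w s < w p" using w_eq[of p s] p by auto
      then show False using H5[of q p s] p qp sp by auto
    qed
    show "w p < w s \<or> w r < w p" if p: "s < p" for p
    proof (cases "p \<le> n")
      case True
      have "w p < w r \<Longrightarrow> p \<in> S" using True p sp by (auto simp: S_def)
      then show ?thesis using s(2)[of p] w_eq[of p r] w_eq[of p s] p sp by force
    next
      case False
      then have "w p = p" using permutes_not_in[OF w, of p] by auto
      moreover have "w r \<le> n" using mem[of r] qp sp by auto
      ultimately show ?thesis using False by auto
    qed
  qed (use w vex qp sp H5 in auto)
  then show ?thesis by blast
qed

lemma reduction_to_dominant:
  assumes "w permutes {1..n}" "vexillary n w"
  shows "\<exists>u. u permutes {1..n} \<and> dominant n u \<and> shape n u = shape n w \<and>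
    (\<forall>K m. int n < K \<longrightarrow> chain_count K m (lift_int (inv u)) = chain_count K m (lift_int (inv w)) \<and>
      des_count K m (lift_int (inv u)) = des_count K m (lift_int (inv w)))"
  using assms
proof (induction "nat (\<Sum>k\<in>{1..n}. int k * int (lehmer n w k))" arbitrary: w rule: less_induct)
  case less
  show ?case
  proof (cases "dominant n w")
    case True
    then show ?thesis using less.prems by blast
  next
    case False
    then obtain q r s where "transition n w q r s" using transition_exists less.prems by blast
    then interpret transition n w q r s .
    have "0 \<le> (\<Sum>k\<in>{1..n}. int k * int (lehmer n w' k))" by (intro sum_nonneg) simp
    then have "nat (\<Sum>k\<in>{1..n}. int k * int (lehmer n w' k)) < nat (\<Sum>k\<in>{1..n}. int k * int (lehmer n w k))"
      using code_decreases by simp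
    from less.hyps[OF this w'_permutes vexillary_w'] show ?thesis
      unfolding shape_w' using counts by auto
  qed
qed

section \<open>Diagrams and order ideals\<close>

definition down_closed :: "(nat \<times> nat) set \<Rightarrow> bool" where
  "down_closed D \<longleftrightarrow> (\<forall>i j i' j'. (i, j) \<in> D \<longrightarrow> i' \<le> i \<longrightarrow> j' \<le> j \<longrightarrow> (i', j') \<in> D)"

lemma down_closedD: "down_closed D \<Longrightarrow> (i, j) \<in> D \<Longrightarrow> i' \<le> i \<Longrightarrow> j' \<le> j \<Longrightarrow> (i', j') \<in> D"
  unfolding down_closed_def by blast

definition ideals :: "(nat \<times> nat) set \<Rightarrow> (nat \<times> nat) set set" where
  "ideals L = {D. D \<subseteq> L \<and> down_closed D}"

definition inclusion :: "'a set set \<Rightarrow> ('a set \<times> 'a set) set" where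
  "inclusion F = {(A, B). A \<in> F \<and> B \<in> F \<and> A \<subseteq> B}"

lemma Field_inclusion: "Field (inclusion F) = F"
  by (auto simp: Field_def inclusion_def)

lemma Partial_order_inclusion: "Partial_order (inclusion F)"
  unfolding partial_order_on_def preorder_on_def refl_on_def trans_def antisym_def Field_inclusion
  by (auto simp: inclusion_def)

definition row_len :: "(nat \<times> nat) set \<Rightarrow> nat \<Rightarrow> nat" where
  "row_len D i = card {j. (i, j) \<in> D}"

lemma down_set_nat:
  fixes S :: "nat set"
  assumes "finite S" "\<And>j j'. j \<in> S \<Longrightarrow> j' \<le> j \<Longrightarrow> j' \<in> S"
  shows "S = {..<card S}"
proof (cases "S = {}")
  case False
  have "S = {..Max S}" using assms False Max_in Max_ge by blast
  then show ?thesis by (metis card_atMost lessThan_Suc_atMost)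
qed simp

lemma row_len_mem:
  assumes "finite D" "down_closed D"
  shows "(i, j) \<in> D \<longleftrightarrow> j < row_len D i"
proof -
  have "finite {j. (i, j) \<in> D}"
    using finite_imageI[OF assms(1), of snd] by (rule rev_finite_subset) force
  then have "{j. (i, j) \<in> D} = {..<row_len D i}"
    unfolding row_len_def by (rule down_set_nat) (use down_closedD[OF assms(2)] in blast)
  then show ?thesis by blast
qed

definition partition_of :: "(nat \<times> nat) set \<Rightarrow> nat list" where
  "partition_of D = map (row_len D) [0..<card {i. (i, 0) \<in> D}]"

lemma
  assumes "finite D" "down_closed D"
  shows row_len_antimono: "i \<le> j \<Longrightarrow> row_len D j \<le> row_len D i"
    and row_len_pos: "0 < row_len D i \<longleftrightarrow> i < card {i. (i, 0) \<in> D}"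
proof -
  have fin: "finite {i. (i, 0) \<in> D}"
    using finite_imageI[OF assms(1), of fst] by (rule rev_finite_subset) force
  then have "{i. (i, 0) \<in> D} = {..<card {i. (i, 0) \<in> D}}"
    by (rule down_set_nat) (use down_closedD[OF assms(2)] in blast)
  then show "0 < row_len D i \<longleftrightarrow> i < card {i. (i, 0) \<in> D}"
    unfolding row_len_mem[OF assms, symmetric] by blast
  show "i \<le> j \<Longrightarrow> row_len D j \<le> row_len D i"
    using row_len_mem[OF assms] down_closedD[OF assms(2)] by (meson le_refl not_le)
qed

lemma partition_of:
  assumes "finite D" "down_closed D"
  shows "is_partition (partition_of D)" "diagram (partition_of D) = D"
proof -
  note pos = row_len_pos[OF assms] and mem = row_len_mem[OF assms]
  have "sorted_wrt (\<ge>) (partition_of D)"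
    unfolding partition_of_def sorted_wrt_map
    by (rule sorted_wrt_mono_rel[OF _ sorted_wrt_upt]) (simp add: row_len_antimono[OF assms])
  moreover have "0 \<notin> set (partition_of D)"
  proof
    assume "0 \<in> set (partition_of D)"
    then obtain i where "i < card {i. (i, 0) \<in> D}" "row_len D i = 0" by (auto simp: partition_of_def)
    then show False using pos[of i] by simp
  qed
  ultimately show "is_partition (partition_of D)" by (simp add: is_partition_def)
  show "diagram (partition_of D) = D"
  proof (intro set_eqI iffI)
    fix c assume "c \<in> diagram (partition_of D)"
    then show "c \<in> D" using mem[of "fst c" "snd c"] by (auto simp: diagram_def partition_of_def)
  next
    fix c assume c: "c \<in> D"
    then have "snd c < row_len D (fst c)" using mem[of "fst c" "snd c"] by simp
    moreover from this have "fst c < card {i. (i, 0) \<in> D}" using pos[of "fst c"] by simp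
    ultimately show "c \<in> diagram (partition_of D)" by (cases c) (simp add: diagram_def partition_of_def)
  qed
qed

lemma down_closed_diagram:
  assumes "is_partition l" shows "down_closed (diagram l)"
proof -
  have "l ! i \<le> l ! i'" if "i' \<le> i" "i < length l" for i i'
    using assms that unfolding is_partition_def sorted_wrt_iff_nth_less by (cases "i' = i") auto
  then show ?thesis unfolding down_closed_def diagram_def by fastforce
qed

lemma finite_diagram: "finite (diagram l)"
proof (rule finite_subset)
  show "diagram l \<subseteq> (SIGMA i:{..<length l}. {..<l ! i})" by (auto simp: diagram_def)
qed simp

lemma diagram_inject:
  assumes "is_partition m" "is_partition l" "diagram m = diagram l" shows "m = l"
  using Partial_order_young assms unfolding partial_order_on_def antisym_def young_def by auto

lemma poset_iso_young:
  assumes l: "is_partition l"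
  shows "poset_iso (interval young [] l) (inclusion (ideals (diagram l))) diagram"
proof -
  have F: "Field (interval young [] l) = {m. is_partition m \<and> diagram m \<subseteq> diagram l}"
    unfolding Field_young_interval[OF l] using l by (auto simp: young_def)
  have "bij_betw diagram (Field (interval young [] l)) (ideals (diagram l))"
    unfolding F bij_betw_def
  proof
    show "inj_on diagram {m. is_partition m \<and> diagram m \<subseteq> diagram l}"
      by (rule inj_onI) (use diagram_inject in auto)
    show "diagram ` {m. is_partition m \<and> diagram m \<subseteq> diagram l} = ideals (diagram l)"
    proof (intro equalityI subsetI)
      fix D assume D: "D \<in> ideals (diagram l)"
      then have d: "finite D" "down_closed D" using finite_subset[OF _ finite_diagram]
          by (auto simp: ideals_def)
      show "D \<in> diagram ` {m. is_partition m \<and> diagram m \<subseteq> diagram l}"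
        using D partition_of[OF d] by (intro image_eqI[of _ _ "partition_of D"]) (auto simp: ideals_def)
    qed (auto simp: ideals_def down_closed_diagram)
  qed
  moreover have "(x, y) \<in> interval young [] l \<longleftrightarrow> (diagram x, diagram y) \<in> inclusion (ideals (diagram l))"
    if "is_partition x" "diagram x \<subseteq> diagram l" "is_partition y" "diagram y \<subseteq> diagram l" for x y
  proof -
    have e: "is_partition []" "diagram [] \<subseteq> A" for A by (auto simp: is_partition_def diagram_def)
    show ?thesis using that l e by (simp add: interval_def young_def inclusion_def ideals_def
        down_closed_diagram)
  qed
  ultimately show ?thesis unfolding poset_iso_def Field_inclusion F by auto
qed

lemma is_partition_shape: "is_partition (shape n w)"
  unfolding is_partition_def shape_def sorted_wrt_rev by (simp add: sorted_sort)

text \<open>As \<open>shape\<close> sorts the code, only a matching \<rho> of positions with rows is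
  required. It is used for dominant permutations, for permutations with a cut and for inverses of
  the latter, each with its own \<rho>.\<close>

lemma diagram_shape:
  assumes D: "finite D" "down_closed D" and A: "A \<subseteq> {1..n}"
    and code: "\<And>i. i \<in> A \<Longrightarrow> lehmer n w i = row_len D (\<rho> i)" "\<And>i. i \<in> {1..n} - A \<Longrightarrow> lehmer n w i = 0"
    and rho: "inj_on \<rho> A" "\<And>i. (i, 0) \<in> D \<Longrightarrow> i \<in> \<rho> ` A"
  shows "diagram (shape n w) = D"
proof -
  let ?N = "card {i. (i, 0) \<in> D}"
  let ?B = "{i \<in> {1..n}. lehmer n w i \<noteq> 0}"
  have BA: "?B \<subseteq> A"
  proof
    fix i assume "i \<in> ?B"
    then show "i \<in> A" using code(2)[of i] by (cases "i \<in> A") auto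
  qed
  have im: "\<rho> ` ?B = {0..<?N}"
  proof (intro equalityI subsetI)
    fix x assume "x \<in> \<rho> ` ?B"
    then obtain i where "i \<in> ?B" "x = \<rho> i" by blast
    then show "x \<in> {0..<?N}" using row_len_pos[OF D, of x] code(1)[of i] BA by auto
  next
    fix x assume "x \<in> {0..<?N}"
    then have p: "0 < row_len D x" using row_len_pos[OF D] by simp
    then have "(x, 0) \<in> D" using row_len_mem[OF D] by simp
    then obtain i where i: "i \<in> A" "x = \<rho> i" using rho(2) by blast
    then have "i \<in> ?B" using code(1) p A by auto
    then show "x \<in> \<rho> ` ?B" using i by blast
  qed
  have "mset (filter (\<lambda>c. c \<noteq> 0) (map (lehmer n w) [1..<n + 1])) = image_mset (lehmer n w) (mset_set ?B)"
    unfolding mset_filter mset_map_interval filter_mset_image_mset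
    by (simp only: filter_mset_mset_set finite_atLeastAtMost)
  also have "\<dots> = image_mset (row_len D) (image_mset \<rho> (mset_set ?B))"
    unfolding multiset.map_comp
    by (rule image_mset_cong) (use code(1) BA in auto)
  also have "image_mset \<rho> (mset_set ?B) = mset_set {0..<?N}"
    using image_mset_mset_set[OF inj_on_subset[OF rho(1) BA]] im by simp
  also have "image_mset (row_len D) (mset_set {0..<?N}) = mset (rev (partition_of D))"
    by (simp add: partition_of_def)
  finally have m: "mset (filter (\<lambda>c. c \<noteq> 0) (map (lehmer n w) [1..<n + 1])) = mset (rev (partition_of D))" .
  have "sorted (rev (partition_of D))"
    using partition_of(1)[OF D] by (simp add: is_partition_def sorted_wrt_rev)
  then have "shape n w = partition_of D"
    unfolding shape_def using properties_for_sort[of "rev (partition_of D)"] m by (metis rev_rev_ident)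
  then show ?thesis using partition_of(2)[OF D] by simp
qed

lemma lehmer_inversions_inv: "w permutes {1..n} \<Longrightarrow> i \<in> {1..n} \<Longrightarrow> lehmer n w i
    = card {j. (i, j) \<in> inversions (inv w)}"
proof -
  assume w: "w permutes {1..n}" and i: "i \<in> {1..n}"
  have "inv (inv w) = w" using permutes_bij[OF w] by (simp add: inv_inv_eq)
  moreover have "j \<in> {1..n}" if "i < j" "w j < w i" for j
  proof (rule ccontr)
    assume j: "j \<notin> {1..n}"
    then have "w j = j" using permutes_not_in[OF w] by blast
    moreover have "w i \<in> {1..n}" using permutes_in_image[OF w] i by blast
    ultimately show False using j that by auto
  qed
  ultimately show ?thesis unfolding lehmer_def inversions_def by (intro arg_cong[of _ _ card]) auto
qed

lemma lehmer_inversions: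
  assumes w: "w permutes {1..n}" and i: "i \<in> {1..n}"
  shows "lehmer n w i = card {a. (a, w i) \<in> inversions w}"
proof -
  have iv: "inv w (w x) = x" and vi: "w (inv w x) = x" for x
    using permutes_inverses[OF w] by auto
  have "{a. (a, w i) \<in> inversions w} = w ` {j. (i, j) \<in> inversions (inv w)}"
  proof (intro equalityI subsetI)
    fix a assume "a \<in> {a. (a, w i) \<in> inversions w}"
    then have "(i, inv w a) \<in> inversions (inv w)"
      using permutes_bij[OF w] by (simp add: mem_inversions iv vi inv_inv_eq)
    then show "a \<in> w ` {j. (i, j) \<in> inversions (inv w)}" using vi by (metis image_eqI mem_Collect_eq)
  next
    fix a assume "a \<in> w ` {j. (i, j) \<in> inversions (inv w)}"
    then show "a \<in> {a. (a, w i) \<in> inversions w}"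
      using permutes_bij[OF w] by (auto simp: mem_inversions iv inv_inv_eq)
  qed
  then show ?thesis
    unfolding lehmer_inversions_inv[OF w i] using card_image inj_on_subset[OF permutes_inj[OF w]]
        by (metis subset_UNIV)
qed

section \<open>Dominant permutations\<close>

text \<open>The Rothe diagram: rows are positions and columns are values, both shifted to start at 0
  as in \<open>diagram\<close>.\<close>

definition rothe :: "(nat \<Rightarrow> nat) \<Rightarrow> (nat \<times> nat) set" where
  "rothe w = {(i, c). Suc c < w (Suc i) \<and> Suc i < inv w (Suc c)}"

lemma rothe_inv:
  assumes "bij w" shows "rothe (inv w) = (rothe w)\<inverse>"
  using assms by (auto simp: rothe_def inv_inv_eq)

lemma rothe_subset:
  assumes w: "w permutes {1..n}" shows "rothe w \<subseteq> {..<n} \<times> {..<n}"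
proof clarify
  fix i c assume a: "(i, c) \<in> rothe w"
  have iv: "inv w (w x) = x" for x using permutes_inverses[OF w] by auto
  have "(Suc c, w (Suc i)) \<in> inversions w" using a by (simp add: rothe_def mem_inversions iv)
  then have c: "Suc c \<in> {1..n}" "w (Suc i) \<in> {1..n}" using inversions_subset[OF w] by auto
  then have "Suc i \<in> {1..n}" using permutes_in_image[OF w] by blast
  then show "i \<in> {..<n} \<and> c \<in> {..<n}" using c by auto
qed

lemma finite_rothe: "w permutes {1..n} \<Longrightarrow> finite (rothe w)"
  by (rule finite_subset[OF rothe_subset]) auto

lemma rothe_inversions: "w permutes {1..n} \<Longrightarrow> (i, c) \<in> rothe w \<longleftrightarrow> (Suc c, w (Suc i)) \<in> inversions w"
  using permutes_inverses(2)[of w] by (simp add: rothe_def mem_inversions)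

text \<open>Positions need no upper bound: a position k beyond n is a fixed point, and no earlier
  position carries a larger value.\<close>

lemma dominantD:
  assumes w: "w permutes {1..n}" and dom: "dominant n w"
    and "1 \<le> i" "i < j" "j < k" "w i < w k" "w k < w j"
  shows False
proof -
  have out: "w x = x" if "x \<notin> {1..n}" for x using permutes_not_in[OF w that] .
  have "k \<le> n"
  proof (rule ccontr)
    assume k: "\<not> k \<le> n"
    then have "w k = k" "w j \<le> n \<or> w j = j"
      using out[of k] out[of j] permutes_in_image[OF w, of j] by auto
    then show False using assms(3-) k by auto
  qed
  then have "i \<in> {1..n}" "j \<in> {1..n}" "k \<in> {1..n}" using assms(3-) by auto
  then show False using dom assms(4-) unfolding dominant_def by blast
qed

text \<open>A missing cell to the left means that the value Suc c' occurs before position Suc i;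
  with Suc i and the position of Suc c this is a 132 pattern. A missing cell above gives one on Suc
  i', Suc i and the position of Suc c'.\<close>

lemma down_closed_rothe:
  assumes w: "w permutes {1..n}" and dom: "dominant n w"
  shows "down_closed (rothe w)"
  unfolding down_closed_def
proof (intro allI impI)
  fix i c i' c' assume a: "(i, c) \<in> rothe w" "i' \<le> i" "c' \<le> c"
  have iv: "inv w (w x) = x" and vi: "w (inv w x) = x" for x using permutes_inverses[OF w] by auto
  have r: "Suc c < w (Suc i)" "Suc i < inv w (Suc c)" using a(1) by (auto simp: rothe_def)
  have w0: "w 0 = 0" using permutes_not_in[OF w] by simp
  have s1: "Suc i < inv w (Suc c')"
  proof (rule ccontr)
    assume n: "\<not> ?thesis"
    then have "c' \<noteq> c" using r by auto
    moreover have "inv w (Suc c') \<noteq> Suc i" using vi[of "Suc c'"] r a by auto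
    moreover have "inv w (Suc c') \<noteq> 0" using vi[of "Suc c'"] w0 by (cases "inv w (Suc c') = 0") auto
    ultimately show False
      using dominantD[OF w dom, of "inv w (Suc c')" "Suc i" "inv w (Suc c)"] n r a by (simp add: vi)
  qed
  have s2: "Suc c' < w (Suc i')"
  proof (rule ccontr)
    assume n: "\<not> ?thesis"
    then have "i' \<noteq> i" using r a by auto
    moreover have "w (Suc i') \<noteq> Suc c'" using iv[of "Suc i'"] s1 a by auto
    ultimately show False
      using dominantD[OF w dom, of "Suc i'" "Suc i" "inv w (Suc c')"] n r a s1 by (simp add: vi)
  qed
  show "(i', c') \<in> rothe w" using s1 s2 a(2) by (simp add: rothe_def)
qed

lemma diagram_shape_dominant:
  assumes w: "w permutes {1..n}" and dom: "dominant n w"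
  shows "diagram (shape n w) = rothe w"
proof (rule diagram_shape[OF finite_rothe[OF w] down_closed_rothe[OF w dom] subset_refl])
  fix i assume i: "i \<in> {1..n}"
  have "{a. (a, w i) \<in> inversions w} = Suc ` {c. (i - 1, c) \<in> rothe w}"
  proof (intro equalityI subsetI)
    fix a assume a: "a \<in> {a. (a, w i) \<in> inversions w}"
    then have "a \<in> {1..n}" using inversions_subset[OF w] by auto
    then show "a \<in> Suc ` {c. (i - 1, c) \<in> rothe w}"
      using a i by (intro image_eqI[of _ _ "a - 1"]) (auto simp: rothe_inversions[OF w])
  next
    fix a assume "a \<in> Suc ` {c. (i - 1, c) \<in> rothe w}"
    then show "a \<in> {a. (a, w i) \<in> inversions w}" using i by (auto simp: rothe_inversions[OF w])
  qed
  then show "lehmer n w i = row_len (rothe w) (i - 1)"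
    unfolding lehmer_inversions[OF w i] row_len_def by (simp add: card_image)
next
  show "inj_on (\<lambda>i. i - 1) {1..n}" by (auto simp: inj_on_def)
  fix i assume "(i, 0) \<in> rothe w"
  then have "i < n" using rothe_subset[OF w] by auto
  then show "i \<in> (\<lambda>i. i - 1) ` {1..n}" by (intro image_eqI[of _ _ "Suc i"]) auto
qed auto

text \<open>At the first position where the two differ, let u have the smaller value. The other
  permutation takes this value only later, so its diagram has a cell in that row and column, while
  the diagram of u does not. The ranges may differ, as permutations from two symmetric groups will
  be compared.\<close>

lemma rothe_inject:
  assumes w1: "w1 permutes {1..n1}" and w2: "w2 permutes {1..n2}" and eq: "rothe w1 = rothe w2"
  shows "w1 = w2"
proof (rule ccontr)
  assume "w1 \<noteq> w2"
  then have ex: "\<exists>i. w1 i \<noteq> w2 i" by auto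
  define i where "i = (LEAST i. w1 i \<noteq> w2 i)"
  have i: "w1 i \<noteq> w2 i" unfolding i_def by (rule LeastI_ex[OF ex])
  have below: "w1 j = w2 j" if "j < i" for j using not_less_Least that unfolding i_def by blast
  have False if u: "u permutes {1..m}" and v: "v permutes {1..m'}" and e: "rothe u = rothe v"
    and b: "\<And>j. j < i \<Longrightarrow> u j = v j" and lt: "u i < v i" for u v :: "nat \<Rightarrow> nat" and m m'
  proof -
    have z: "u 0 = 0" "v 0 = 0" using permutes_not_in[OF u] permutes_not_in[OF v] by simp_all
    then have "i \<noteq> 0" using lt by (cases "i = 0") auto
    moreover have "u i \<noteq> 0" using z(1) permutes_inj[OF u] \<open>i \<noteq> 0\<close> by (metis inj_eq)
    ultimately obtain i' c where ic: "i = Suc i'" "u i = Suc c" by (metis not0_implies_Suc)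
    define p where "p = inv v (u i)"
    have p: "v p = u i" using permutes_inverses(1)[OF v] by (simp add: p_def)
    have "p \<noteq> i" using p lt by auto
    moreover have "\<not> p < i" using b[of p] p permutes_inj[OF u] by (metis inj_eq less_irrefl)
    ultimately have "(i', c) \<in> rothe v" using lt ic by (auto simp: rothe_def p_def)
    then have "(i', c) \<in> rothe u" using e by simp
    then show False using ic by (simp add: rothe_def)
  qed
  from this[OF w1 w2 eq] this[OF w2 w1 eq[symmetric]] show False
    using i below by (metis linorder_neqE_nat)
qed

section \<open>Permutations with a cut\<close>

text \<open>\<open>inv u\<close> is the rank function of the given linear order.\<close>

lemma exists_permutation:
  fixes before :: "nat \<Rightarrow> nat \<Rightarrow> bool"
  assumes tot: "\<And>x y. x \<in> {1..n} \<Longrightarrow> y \<in> {1..n} \<Longrightarrow> x \<noteq> y \<Longrightarrow> before x y \<or> before y x"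
    and irr: "\<And>x. \<not> before x x"
    and tr: "\<And>x y z. x \<in> {1..n} \<Longrightarrow> y \<in> {1..n} \<Longrightarrow> z \<in> {1..n} \<Longrightarrow> before x y \<Longrightarrow> before y z \<Longrightarrow> before x z"
  shows "\<exists>u. u permutes {1..n} \<and> (\<forall>x\<in>{1..n}. \<forall>y\<in>{1..n}. before x y \<longleftrightarrow> inv u x < inv u y)"
proof -
  define P where "P x = (if x \<in> {1..n} then Suc (card {y \<in> {1..n}. before y x}) else x)" for x
  have less: "P x < P y" if "x \<in> {1..n}" "y \<in> {1..n}" "before x y" for x y
  proof -
    have "{z \<in> {1..n}. before z x} \<subset> {z \<in> {1..n}. before z y}"
      using that tr irr by blast
    then have "card {z \<in> {1..n}. before z x} < card {z \<in> {1..n}. before z y}"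
      by (intro psubset_card_mono) auto
    then show ?thesis using that by (simp add: P_def)
  qed
  have iff: "before x y \<longleftrightarrow> P x < P y" if "x \<in> {1..n}" "y \<in> {1..n}" for x y
    using less[OF that] less[OF that(2,1)] tot[OF that] irr by (cases "x = y") auto
  have inj: "inj_on P {1..n}"
    by (rule inj_onI) (metis less tot less_irrefl)
  have "P x \<in> {1..n}" if x: "x \<in> {1..n}" for x
  proof -
    have "{y \<in> {1..n}. before y x} \<subset> {1..n}" using x irr by blast
    then have "card {y \<in> {1..n}. before y x} < n" using psubset_card_mono[of "{1..n}"] by simp
    then show ?thesis using x by (simp add: P_def)
  qed
  then have "P ` {1..n} = {1..n}" using inj by (intro endo_inj_surj) auto
  then have "bij_betw P {1..n} {1..n}" using inj by (simp add: bij_betw_def)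
  then have P: "P permutes {1..n}" by (rule bij_imp_permutes) (simp only: P_def if_False)
  have "inv (inv P) = P" using permutes_bij[OF P] by (simp add: inv_inv_eq)
  then show ?thesis using permutes_inv[OF P] iff by (intro exI[of _ "inv P"]) simp
qed

text \<open>If I and its complement among the increasing pairs are both transitive, reversing the
  natural order exactly on I gives a linear order of the letters.\<close>

lemma exists_inversion_set:
  assumes I: "I \<subseteq> {1..n} \<times> {1..n}" "\<And>a b. (a, b) \<in> I \<Longrightarrow> a < b"
    and closed: "\<And>a b c. (a, b) \<in> I \<Longrightarrow> (b, c) \<in> I \<Longrightarrow> (a, c) \<in> I"
    and coclosed: "\<And>a b c. a < b \<Longrightarrow> b < c \<Longrightarrow> (a, c) \<in> I \<Longrightarrow> (a, b) \<in> I \<or> (b, c) \<in> I"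
  shows "\<exists>u. u permutes {1..n} \<and> inversions u = I"
proof -
  let ?b = "\<lambda>x y. (x < y \<and> (x, y) \<notin> I) \<or> (y < x \<and> (y, x) \<in> I)"
  have "\<exists>u. u permutes {1..n} \<and> (\<forall>x\<in>{1..n}. \<forall>y\<in>{1..n}. ?b x y \<longleftrightarrow> inv u x < inv u y)"
  proof (rule exists_permutation)
    fix x y z assume b: "?b x y" "?b y z"
    consider "x < y" "y < z" | "x < y" "z < y" "x < z" | "x < y" "z < x" | "x < y" "x = z"
      | "y < x" "y < z" "x < z" | "y < x" "z < x" "y < z" | "y < x" "y < z" "x = z" | "y < x" "z < y"
      using b by (metis linorder_neqE_nat)
    then show "?b x z"
    proof cases
      case 1 then show ?thesis using b coclosed[of x y z] by auto
    next
      case 2 then show ?thesis using b closed[of x z y] by auto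
    next
      case 3 then show ?thesis using b coclosed[of z x y] by auto
    next
      case 4 then show ?thesis using b by auto
    next
      case 5 then show ?thesis using b closed[of y x z] by auto
    next
      case 6 then show ?thesis using b coclosed[of y z x] by auto
    next
      case 7 then show ?thesis using b by auto
    next
      case 8 then show ?thesis using b closed[of z y x] by auto
    qed
  qed auto
  then obtain u where u: "u permutes {1..n}" "\<And>x y. x \<in> {1..n} \<Longrightarrow> y \<in> {1..n} \<Longrightarrow> ?b x y \<longleftrightarrow> inv u x < inv u y"
    by blast
  have "(a, b) \<in> inversions u \<longleftrightarrow> (a, b) \<in> I" for a b
  proof (cases "a \<in> {1..n} \<and> b \<in> {1..n}")
    case True
    then show ?thesis using u(2)[of b a] I(2)[of a b] unfolding mem_inversions by auto
  next
    case False
    then show ?thesis using inversions_subset[OF u(1)] I(1) by blast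
  qed
  then show ?thesis using u(1) by auto
qed

text \<open>The inverse Grassmannian permutations: all inversions cross the cut, so the values up to
  k and the values above k each occur in increasing order.\<close>

locale cut_permutation =
  fixes n k :: nat and w :: "nat \<Rightarrow> nat"
  assumes w: "w permutes {1..n}" and cut: "inversions w \<subseteq> {1..k} \<times> {k+1..n}" and kn: "k \<le> n"
begin

text \<open>The smallest value above the cut gives the first row, the largest value up to the cut the first column.\<close>

definition cell :: "nat \<times> nat \<Rightarrow> nat \<times> nat" where
  "cell p = (snd p - k - 1, k - fst p)"

definition uncell :: "nat \<times> nat \<Rightarrow> nat \<times> nat" where
  "uncell c = (k - snd c, k + 1 + fst c)"

lemma uncell_cell: "p \<in> {1..k} \<times> {k+1..n} \<Longrightarrow> uncell (cell p) = p"
  by (auto simp: cell_def uncell_def)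

lemma cell_uncell: "snd c < k \<Longrightarrow> cell (uncell c) = c"
  by (auto simp: cell_def uncell_def)

lemma inj_cell: "inj_on cell ({1..k} \<times> {k+1..n})"
  by (rule inj_on_inverseI[of _ uncell]) (rule uncell_cell)

abbreviation "dia \<equiv> cell ` inversions w"

lemma finite_dia: "finite dia" using finite_inversions[OF w] by simp

text \<open>No inversion of u lies on one side of the cut, so raising the smaller value x moves it
  to a later position and lowering the larger value y to an earlier one. Hence the pair stays
  inverted.\<close>

lemma down_closed_cells:
  assumes u: "u permutes {1..n}" and sub: "inversions u \<subseteq> inversions w"
  shows "down_closed (cell ` inversions u)"
  unfolding down_closed_def
proof (intro allI impI)
  fix i j i' j' assume a: "(i, j) \<in> cell ` inversions u" "i' \<le> i" "j' \<le> j"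
  obtain x y where xy: "(x, y) \<in> inversions u" "i = y - k - 1" "j = k - x"
    using a(1) by (auto simp: cell_def)
  have r: "x \<in> {1..k}" "y \<in> {k+1..n}" using xy(1) sub cut by auto
  define x' y' where "x' = k - j'" and "y' = i' + k + 1"
  have r': "x \<le> x'" "x' \<le> k" "y' \<le> y" "k < y'" using a r xy by (auto simp: x'_def y'_def)
  have 1: "inv u x \<le> inv u x'"
  proof (rule ccontr)
    assume "\<not> ?thesis"
    then have "(x, x') \<in> inversions u" using r' by (cases "x = x'") (auto simp: mem_inversions)
    then show False using sub cut r' by fastforce
  qed
  have 2: "inv u y' \<le> inv u y"
  proof (rule ccontr)
    assume "\<not> ?thesis"
    then have "(y', y) \<in> inversions u" using r' by (cases "y = y'") (auto simp: mem_inversions)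
    then show False using sub cut r' by fastforce
  qed
  have "(x', y') \<in> inversions u" using xy(1) 1 2 r' by (auto simp: mem_inversions)
  moreover have "cell (x', y') = (i', j')" using a(3) xy r by (auto simp: cell_def x'_def y'_def)
  ultimately show "(i', j') \<in> cell ` inversions u" by (metis image_eqI)
qed

lemma down_closed_dia: "down_closed dia"
  using down_closed_cells[OF w] by blast

text \<open>The pulled back set is vacuously transitive, since no pair ends up to k or starts above
  k. For its complement, b lies on one side of the cut, and down-closedness of D gives (b, c) or (a,
  b) accordingly.\<close>

lemma cells_surj:
  assumes D: "D \<in> ideals dia"
  shows "\<exists>u. u permutes {1..n} \<and> inversions u \<subseteq> inversions w \<and> cell ` inversions u = D"
proof -
  have dc: "down_closed D" and sub: "D \<subseteq> dia" using D by (auto simp: ideals_def)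
  have Iw: "uncell ` D \<subseteq> inversions w"
  proof
    fix p assume "p \<in> uncell ` D"
    then obtain c where "c \<in> D" "p = uncell c" by (rule imageE)
    moreover from this obtain p' where "p' \<in> inversions w" "c = cell p'" using sub by blast
    ultimately show "p \<in> inversions w" using uncell_cell[of p'] subsetD[OF cut, of p'] by simp
  qed
  have c: "cell ` uncell ` D = D"
  proof -
    have "cell (uncell c) = c" if c: "c \<in> D" for c
    proof (rule cell_uncell)
      obtain p where p: "p \<in> inversions w" "c = cell p" using subsetD[OF sub c] by (rule imageE)
      show "snd c < k" using subsetD[OF cut p(1)] by (auto simp: p(2) cell_def)
    qed
    then show ?thesis by (simp add: image_image)
  qed
  have mem: "(a, b) \<in> uncell ` D \<longleftrightarrow> a \<in> {1..k} \<and> b \<in> {k+1..n} \<and> (b - k - 1, k - a) \<in> D" for a b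
  proof
    assume x: "(a, b) \<in> uncell ` D"
    then have r: "(a, b) \<in> {1..k} \<times> {k+1..n}" using Iw cut by blast
    have "cell (a, b) \<in> D" using x c by blast
    then show "a \<in> {1..k} \<and> b \<in> {k+1..n} \<and> (b - k - 1, k - a) \<in> D" using r by (auto simp: cell_def)
  next
    assume x: "a \<in> {1..k} \<and> b \<in> {k+1..n} \<and> (b - k - 1, k - a) \<in> D"
    then show "(a, b) \<in> uncell ` D" by (intro image_eqI[of _ _ "(b - k - 1, k - a)"]) (auto simp: uncell_def)
  qed
  define I where "I = uncell ` D"
  note mem = mem[folded I_def]
  have "\<exists>u. u permutes {1..n} \<and> inversions u = I"
  proof (rule exists_inversion_set)
    show "I \<subseteq> {1..n} \<times> {1..n}" using Iw inversions_subset[OF w] by (simp add: I_def)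
    fix a b c
    show "(a, b) \<in> I \<Longrightarrow> a < b" using mem by auto
    show "(a, b) \<in> I \<Longrightarrow> (b, c) \<in> I \<Longrightarrow> (a, c) \<in> I" using mem by auto
    show "(a, b) \<in> I \<or> (b, c) \<in> I" if o: "a < b" "b < c" "(a, c) \<in> I"
    proof -
      have ac: "1 \<le> a" "a \<le> k" "k < c" "c \<le> n" "(c - k - 1, k - a) \<in> D" using o(3) mem[of a c] by auto
      show ?thesis
      proof (cases "b \<le> k")
        case True
        have "(c - k - 1, k - b) \<in> D" by (rule down_closedD[OF dc ac(5)]) (use o in auto)
        then show ?thesis using mem[of b c] ac o True by simp
      next
        case False
        have "(b - k - 1, k - a) \<in> D" by (rule down_closedD[OF dc ac(5)]) (use o in auto)
        then show ?thesis using mem[of a b] ac o False by simp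
      qed
    qed
  qed
  then show ?thesis using Iw c unfolding I_def by metis
qed

lemma Field_weak: "Field (interval (weak_order n) id w) = {u. u permutes {1..n} \<and> inversions u \<subseteq> inversions w}"
  unfolding Field_interval[OF Partial_order_weak_order] id_weak_order weak_order_iff
      using w by (auto simp: inversions_id permutes_id)

lemma poset_iso_weak:
  "poset_iso (interval (weak_order n) id w) (inclusion (ideals dia)) (\<lambda>u. cell ` inversions u)"
proof -
  have inj: "cell ` inversions u \<subseteq> cell ` inversions v \<longleftrightarrow> inversions u \<subseteq> inversions v"
    if "inversions u \<subseteq> inversions w" "inversions v \<subseteq> inversions w" for u v
    using inj_on_image_subset_iff[OF inj_cell] that cut by (meson subset_trans)
  have id: "cell ` inversions u \<in> ideals dia" if "u permutes {1..n}" "inversions u \<subseteq> inversions w" for u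
    using down_closed_cells[OF that] that(2) by (auto simp: ideals_def)
  have "bij_betw (\<lambda>u. cell ` inversions u) (Field (interval (weak_order n) id w)) (ideals dia)"
    unfolding Field_weak bij_betw_def
  proof
    show "inj_on (\<lambda>u. cell ` inversions u) {u. u permutes {1..n} \<and> inversions u \<subseteq> inversions w}"
    proof (rule inj_onI)
      fix u v assume uv: "u \<in> {u. u permutes {1..n} \<and> inversions u \<subseteq> inversions w}"
        "v \<in> {u. u permutes {1..n} \<and> inversions u \<subseteq> inversions w}" "cell ` inversions u = cell ` inversions v"
      then have "inversions u = inversions v" using inj[of u v] inj[of v u] by auto
      then show "u = v" using inversions_inject uv by blast
    qed
    show "(\<lambda>u. cell ` inversions u) ` {u. u permutes {1..n} \<and> inversions u \<subseteq> inversions w} = ideals dia"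
    proof (intro equalityI subsetI)
      fix D assume "D \<in> ideals dia"
      then show "D \<in> (\<lambda>u. cell ` inversions u) ` {u. u permutes {1..n} \<and> inversions u \<subseteq> inversions w}"
        using cells_surj[of D] by blast
    qed (use id in auto)
  qed
  moreover have "(u, v) \<in> interval (weak_order n) id w \<longleftrightarrow> (cell ` inversions u, cell ` inversions v) \<in>
      inclusion (ideals dia)"
    if "u permutes {1..n}" "inversions u \<subseteq> inversions w" "v permutes {1..n}"
        "inversions v \<subseteq> inversions w" for u v
    using that w id inj[of u v] by (simp add: interval_def weak_order_iff inclusion_def inversions_id
        permutes_id)
  ultimately show ?thesis unfolding poset_iso_def Field_inclusion Field_weak by blast
qed

text \<open>A 2143 pattern contains two inversions, the values of one lying entirely below those of
  the other; both cannot cross the same cut.\<close>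

lemma vexillary: "vexillary n w"
  unfolding vexillary_def
proof (rule notI, elim bexE conjE)
  fix i1 i2 i3 i4 assume i: "i1 < i2" "i2 < i3" "i3 < i4" "w i2 < w i1" "w i1 < w i4" "w i4 < w i3"
  have iv: "inv w (w x) = x" for x using permutes_inverses[OF w] by auto
  have "(w i2, w i1) \<in> inversions w" "(w i4, w i3) \<in> inversions w" using i by (auto simp: mem_inversions iv)
  then have "k < w i1" "w i4 \<le> k" using cut by auto
  then show False using i by simp
qed

text \<open>Only entries above the cut have a nonzero code, and the code of such an entry counts the
  cells in its row.\<close>

lemma diagram_shape_cut: "diagram (shape n w) = dia"
proof (rule diagram_shape[OF finite_dia down_closed_dia, of "{i \<in> {1..n}. k < w i}" n w "\<lambda>i. w i - k - 1"])
  fix i assume i: "i \<in> {i \<in> {1..n}. k < w i}"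
  have "{j. (w i - k - 1, j) \<in> dia} = (\<lambda>a. k - a) ` {a. (a, w i) \<in> inversions w}"
  proof (intro equalityI subsetI)
    fix j assume "j \<in> {j. (w i - k - 1, j) \<in> dia}"
    then obtain a b where ab: "(a, b) \<in> inversions w" "w i - k - 1 = b - k - 1" "j
        = k - a" by (auto simp: cell_def)
    then have "b = w i" using subsetD[OF cut ab(1)] i by auto
    then show "j \<in> (\<lambda>a. k - a) ` {a. (a, w i) \<in> inversions w}" using ab by auto
  qed (force simp: cell_def)
  moreover have "inj_on (\<lambda>a. k - a) {a. (a, w i) \<in> inversions w}"
  proof (rule inj_onI)
    fix x y assume "x \<in> {a. (a, w i) \<in> inversions w}" "y \<in> {a. (a, w i) \<in> inversions w}" "k - x = k - y"
    then show "x = y" using subsetD[OF cut, of "(x, w i)"] subsetD[OF cut, of "(y, w i)"] by auto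
  qed
  ultimately show "lehmer n w i = row_len dia (w i - k - 1)"
    using lehmer_inversions[OF w] i by (simp add: row_len_def card_image)
next
  fix i assume i: "i \<in> {1..n} - {i \<in> {1..n}. k < w i}"
  then have "{a. (a, w i) \<in> inversions w} = {}" using cut by auto
  then show "lehmer n w i = 0" using lehmer_inversions[OF w, of i] i by simp
next
  have wi: "w x = w y \<longleftrightarrow> x = y" for x y using permutes_inj[OF w] by (simp add: inj_eq)
  show "inj_on (\<lambda>i. w i - k - 1) {i \<in> {1..n}. k < w i}"
  proof (rule inj_onI)
    fix x y assume "x \<in> {i \<in> {1..n}. k < w i}" "y \<in> {i \<in> {1..n}. k < w i}" "w x - k - 1 = w y - k - 1"
    then have "w x = w y" by auto
    then show "x = y" using wi by simp
  qed
  fix i assume "(i, 0) \<in> dia"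
  then obtain a b where ab: "(a, b) \<in> inversions w" "i = b - k - 1" by (auto simp: cell_def)
  then have b: "b \<in> {k+1..n}" using cut by auto
  have "inv w b \<in> {1..n}" using permutes_in_image[OF permutes_inv[OF w], of b] b by auto
  moreover have "w (inv w b) = b" using permutes_inverses(1)[OF w] by simp
  ultimately show "i \<in> (\<lambda>i. w i - k - 1) ` {i \<in> {1..n}. k < w i}"
    using b ab by (intro image_eqI[of _ _ "inv w b"]) auto
qed auto

text \<open>For \<open>inv w\<close> the positions with nonzero code are the values of w up to k.
  These index the columns of the diagram, hence the transposition.\<close>

lemma diagram_shape_inv: "diagram (shape n (inv w)) = dia\<inverse>"
proof -
  have wi: "inv w permutes {1..n}" using w by (rule permutes_inv)
  have dc: "down_closed (dia\<inverse>)" using down_closed_dia unfolding down_closed_def by blast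
  show ?thesis
  proof (rule diagram_shape[OF _ dc, of "{1..k}" n "inv w" "\<lambda>i. k - i"])
    show "finite (dia\<inverse>)" using finite_dia by simp
    show "{1..k} \<subseteq> {1..n}" using kn by auto
    fix i assume i: "i \<in> {1..k}"
    have ii: "inv (inv w) = w" using permutes_bij[OF w] by (simp add: inv_inv_eq)
    have "{j. (k - i, j) \<in> dia\<inverse>} = (\<lambda>b. b - k - 1) ` {b. (i, b) \<in> inversions w}"
    proof (intro equalityI subsetI)
      fix j assume "j \<in> {j. (k - i, j) \<in> dia\<inverse>}"
      then obtain a b where ab: "(a, b) \<in> inversions w" "j = b - k - 1" "k - i = k - a" by (auto simp: cell_def)
      then have "a = i" using subsetD[OF cut ab(1)] i by auto
      then show "j \<in> (\<lambda>b. b - k - 1) ` {b. (i, b) \<in> inversions w}" using ab by auto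
    qed (force simp: cell_def)
    moreover have "inj_on (\<lambda>b. b - k - 1) {b. (i, b) \<in> inversions w}"
    proof (rule inj_onI)
      fix x y assume "x \<in> {b. (i, b) \<in> inversions w}" "y \<in> {b. (i, b) \<in> inversions w}" "x - k - 1 = y - k - 1"
      then show "x = y" using subsetD[OF cut, of "(i, x)"] subsetD[OF cut, of "(i, y)"] by auto
    qed
    moreover have "lehmer n (inv w) i = card {b. (i, b) \<in> inversions w}"
      using lehmer_inversions_inv[OF wi, of i] i kn ii by simp
    ultimately show "lehmer n (inv w) i = row_len (dia\<inverse>) (k - i)"
      unfolding row_len_def by (simp only: card_image)
  next
    fix i assume i: "i \<in> {1..n} - {1..k}"
    have ii: "inv (inv w) = w" using permutes_bij[OF w] by (simp add: inv_inv_eq)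
    have "{b. (i, b) \<in> inversions w} = {}" using cut i by auto
    then show "lehmer n (inv w) i = 0" using lehmer_inversions_inv[OF wi, of i] i ii by simp
  next
    show "inj_on (\<lambda>i. k - i) {1..k}" by (auto simp: inj_on_def)
    fix i assume "(i, 0) \<in> dia\<inverse>"
    then obtain a b where ab: "(a, b) \<in> inversions w" "i = k - a" by (auto simp: cell_def)
    then have "a \<in> {1..k}" using cut by auto
    then show "i \<in> (\<lambda>i. k - i) ` {1..k}" using ab by blast
  qed
qed

end

text \<open>For every inversion (a, b) of w there is a descent of \<open>inv w\<close> from some i
  to Suc i with a \<le> i < b. As there is at most one such descent, it is crossed by all
  inversions.\<close>

lemma cut_of_inv_grassmannian:
  assumes w: "w permutes {1..n}" and g: "inv_grassmannian n w"
  shows "\<exists>k. cut_permutation n k w"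
proof -
  let ?D = "{i \<in> {1..<n}. inv w i > inv w (i + 1)}"
  have c: "card ?D \<le> 1" using g by (simp add: inv_grassmannian_def grassmannian_def)
  have fin: "finite ?D" by simp
  obtain k where k: "?D \<subseteq> {k}" "k \<le> n"
  proof (cases "?D = {}")
    case False
    then have "0 < card ?D" using fin unfolding card_gt_0_iff by (intro conjI)
    then have "card ?D = 1" using c by linarith
    then obtain k where k: "?D = {k}" by (rule card_1_singletonE)
    then have "k \<in> ?D" by (simp only: singletonI)
    then have "k \<le> n" by simp
    then show ?thesis by (rule that[OF equalityD1[OF k]])
  next
    case True
    \<comment> \<open>Without descents of \<open>inv w\<close> there are no inversions, and any k
      would do.\<close>
    then show ?thesis by (intro that[of 0]) (simp_all only: empty_subsetI le0)
  qed
  have D: "\<exists>i. a \<le> i \<and> i < b \<and> inv w (Suc i) < inv w i" if ab: "a < b" "inv w b < inv w a" for a b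
  proof (rule ccontr)
    assume n: "\<not> ?thesis"
    have "j \<le> b \<longrightarrow> inv w a \<le> inv w j" if "a \<le> j" for j
      using that
    proof (induction j rule: dec_induct)
      case (step j)
      have "j < b \<Longrightarrow> inv w j \<le> inv w (Suc j)" using n step.hyps not_less by blast
      then show ?case using step.IH Suc_le_lessD less_imp_le order_trans by metis
    qed simp
    from this[of b] show False using ab by simp
  qed
  have "inversions w \<subseteq> {1..k} \<times> {k+1..n}"
  proof clarify
    fix a b assume ab: "(a, b) \<in> inversions w"
    then have r: "a \<in> {1..n}" "b \<in> {1..n}" "a < b" "inv w b < inv w a"
      using subsetD[OF inversions_subset[OF w] ab] ab by (auto simp: mem_inversions)
    obtain i where i: "a \<le> i" "i < b" "inv w (Suc i) < inv w i" using D[OF r(3,4)] by blast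
    then have "i \<in> ?D" using r by auto
    then have "i = k" using k by blast
    then show "a \<in> {1..k} \<and> b \<in> {k+1..n}" using i r by auto
  qed
  then have "cut_permutation n k w" using w k(2) by unfold_locales
  then show ?thesis by blast
qed

text \<open>If the diagram fits into an N by N square, the cut N in the symmetric group on 2N
  letters leaves room for all rows and columns.\<close>

lemma exists_cut_permutation:
  assumes l: "is_partition l"
  shows "\<exists>n k w. cut_permutation n k w \<and> shape n w = l"
proof -
  obtain N where N: "diagram l \<subseteq> {..<N} \<times> {..<N}"
  proof -
    have "diagram l \<subseteq> {..<Suc (Max (insert 0 (fst ` diagram l \<union> snd ` diagram l)))} \<times> {..<Suc (Max
        (insert 0 (fst ` diagram l \<union> snd ` diagram l)))}"
      (is "_ \<subseteq> {..<Suc (Max ?S)} \<times> _")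
    proof clarify
      fix i j assume "(i, j) \<in> diagram l"
      then have "i \<in> ?S" "j \<in> ?S" by force+
      moreover have "finite ?S" by (simp add: finite_diagram)
      ultimately have "i \<le> Max ?S" "j \<le> Max ?S" by (auto intro: Max_ge)
      then show "i \<in> {..<Suc (Max ?S)} \<and> j \<in> {..<Suc (Max ?S)}" by auto
    qed
    then show ?thesis using that by blast
  qed
  \<comment> \<open>The cells of the diagram read as pairs of values, with the coordinates of
    \<open>cell\<close> for the cut N.\<close>
  define I where "I = {(a, b). a \<in> {1..N} \<and> b \<in> {N+1..2*N} \<and> (b - N - 1, N - a) \<in> diagram l}"
  note dc = down_closed_diagram[OF l]
  have "\<exists>w. w permutes {1..2*N} \<and> inversions w = I"
  proof (rule exists_inversion_set)
    show "I \<subseteq> {1..2*N} \<times> {1..2*N}" by (auto simp: I_def)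
    fix a b c
    show "(a, b) \<in> I \<Longrightarrow> a < b" by (auto simp: I_def)
    show "(a, b) \<in> I \<Longrightarrow> (b, c) \<in> I \<Longrightarrow> (a, c) \<in> I" by (auto simp: I_def)
    show "(a, b) \<in> I \<or> (b, c) \<in> I" if o: "a < b" "b < c" "(a, c) \<in> I"
    proof -
      have ac: "1 \<le> a" "a \<le> N" "N < c" "c \<le> 2 * N" "(c - N - 1, N
          - a) \<in> diagram l" using o(3) by (auto simp: I_def)
      show ?thesis
      proof (cases "b \<le> N")
        case True
        have "(c - N - 1, N - b) \<in> diagram l" by (rule down_closedD[OF dc ac(5)]) (use o in auto)
        then show ?thesis using ac o True by (simp add: I_def)
      next
        case False
        have "(b - N - 1, N - a) \<in> diagram l" by (rule down_closedD[OF dc ac(5)]) (use o in auto)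
        then show ?thesis using ac o False by (simp add: I_def)
      qed
    qed
  qed
  then obtain w where wI: "w permutes {1..2*N}" "inversions w = I" by blast
  interpret cut_permutation "2 * N" N w
    by unfold_locales (use wI in \<open>auto simp: I_def\<close>)
  have "dia = diagram l"
  proof (intro equalityI subsetI)
    fix c assume "c \<in> dia"
    then show "c \<in> diagram l" unfolding wI(2) by (auto simp: I_def cell_def)
  next
    fix c assume c: "c \<in> diagram l"
    then have "fst c < N" "snd c < N" using N by auto
    then have "uncell c \<in> I" "cell (uncell c) = c" using c by (auto simp: I_def uncell_def cell_def)
    then show "c \<in> dia" unfolding wI(2) by (metis image_eqI)
  qed
  then have "shape (2 * N) w = l" using diagram_inject[OF is_partition_shape l] diagram_shape_cut by simp
  then show ?thesis using cut_permutation_axioms by blast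
qed

section \<open>Toggle symmetry\<close>

definition addable :: "(nat \<times> nat) set \<Rightarrow> nat \<times> nat \<Rightarrow> (nat \<times> nat) set \<Rightarrow> bool" where
  "addable L p D \<longleftrightarrow> p \<in> L \<and> p \<notin> D \<and> insert p D \<in> ideals L"

definition removable :: "(nat \<times> nat) set \<Rightarrow> nat \<times> nat \<Rightarrow> (nat \<times> nat) set \<Rightarrow> bool" where
  "removable L p D \<longleftrightarrow> p \<in> D \<and> D - {p} \<in> ideals L"

lemma ideals_Un: "A \<in> ideals L \<Longrightarrow> B \<in> ideals L \<Longrightarrow> A \<union> B \<in> ideals L"
  unfolding ideals_def down_closed_def by blast

lemma ideals_Int: "A \<in> ideals L \<Longrightarrow> B \<in> ideals L \<Longrightarrow> A \<inter> B \<in> ideals L"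
  unfolding ideals_def down_closed_def by blast

text \<open>A cell of B - A with least coordinate sum has all smaller cells already in A.\<close>

lemma exists_addable:
  assumes A: "A \<in> ideals L" and B: "B \<in> ideals L" and AB: "A \<subset> B"
  shows "\<exists>p\<in>B - A. insert p A \<in> ideals L"
proof -
  obtain p0 where "p0 \<in> B - A" using AB by blast
  from ex_has_least_nat[of "\<lambda>p. p \<in> B - A", OF this, of "\<lambda>p. fst p + snd p"]
  obtain p where p: "p \<in> B - A" "\<And>y. y \<in> B - A \<Longrightarrow> fst p + snd p \<le> fst y + snd y" by blast
  have dA: "down_closed A" and dB: "down_closed B" and AL: "A \<subseteq> L" "B \<subseteq> L" using A B by (auto simp: ideals_def)
  have "down_closed (insert p A)"
    unfolding down_closed_def
  proof (intro allI impI)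
    fix i j i' j' assume a: "(i, j) \<in> insert p A" "i' \<le> i" "j' \<le> j"
    show "(i', j') \<in> insert p A"
    proof (cases "(i, j) \<in> A")
      case True
      then show ?thesis using down_closedD[OF dA True a(2,3)] by simp
    next
      case False
      then have e: "p = (i, j)" using a(1) by simp
      then have "(i', j') \<in> B" using down_closedD[OF dB _ a(2,3)] p(1) by simp
      then show ?thesis using p(2)[of "(i', j')"] a(2,3) e by (cases "(i', j') \<in> A") auto
    qed
  qed
  then show ?thesis using p(1) AL by (auto simp: ideals_def)
qed

lemma covered_ideals:
  "covered (inclusion (ideals L)) A B \<longleftrightarrow> A \<in> ideals L \<and> B \<in> ideals L \<and> (\<exists>p. p \<notin> A \<and> B = insert p A)"
proof
  assume c: "covered (inclusion (ideals L)) A B"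
  then have AB: "A \<in> ideals L" "B \<in> ideals L" "A \<subset> B" by (auto simp: covered_def inclusion_def)
  obtain p where p: "p \<in> B - A" "insert p A \<in> ideals L" using exists_addable[OF AB] by blast
  have "insert p A = B"
    using c AB p unfolding covered_def inclusion_def by blast
  then show "A \<in> ideals L \<and> B \<in> ideals L \<and> (\<exists>p. p \<notin> A \<and> B = insert p A)" using AB p by blast
next
  assume a: "A \<in> ideals L \<and> B \<in> ideals L \<and> (\<exists>p. p \<notin> A \<and> B = insert p A)"
  then obtain p where "p \<notin> A" "B = insert p A" by blast
  then show "covered (inclusion (ideals L)) A B"
    using a unfolding covered_def inclusion_def by auto
qed

text \<open>The weight \<omega> need not be normalised, so counts can be used directly.\<close>

definition toggle_symmetric :: "(nat \<times> nat) set \<Rightarrow> ((nat \<times> nat) set \<Rightarrow> real) \<Rightarrow> bool" where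
  "toggle_symmetric L \<omega> \<longleftrightarrow> (\<forall>p. (\<Sum>D\<in>{D \<in> ideals L. addable L p D}. \<omega> D)
      = (\<Sum>D\<in>{D \<in> ideals L. removable L p D}. \<omega> D))"

locale diagram_poset =
  fixes L :: "(nat \<times> nat) set"
  assumes finite_L: "finite L" and dcL: "down_closed L"
begin

lemma finite_ideals: "finite (ideals L)"
  by (rule finite_subset[of _ "Pow L"]) (auto simp: ideals_def finite_L)

lemma L_ideal: "L \<in> ideals L" and empty_ideal: "{} \<in> ideals L"
  using dcL by (auto simp: ideals_def down_closed_def)

sublocale finite_poset "inclusion (ideals L)"
  by unfold_locales (rule Partial_order_inclusion, simp add: Field_inclusion finite_ideals)

lemma mem_r: "(A, B) \<in> inclusion (ideals L) \<longleftrightarrow> A \<in> ideals L \<and> B \<in> ideals L \<and> A \<subseteq> B"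
  by (simp add: inclusion_def)

lemma ideal_subset: "D \<in> ideals L \<Longrightarrow> D \<subseteq> L" and ideal_closed: "D \<in> ideals L \<Longrightarrow> down_closed D"
  by (simp_all add: ideals_def)

lemma bij_toggle:
  "bij_betw (insert p) {D \<in> ideals L. addable L p D} {D \<in> ideals L. removable L p D}"
proof (rule bij_betwI[where g = "\<lambda>D. D - {p}"])
  show "insert p \<in> {D \<in> ideals L. addable L p D} \<rightarrow> {D \<in> ideals L. removable L p D}"
    by (auto simp: addable_def removable_def)
  show "(\<lambda>D. D - {p}) \<in> {D \<in> ideals L. removable L p D} \<rightarrow> {D \<in> ideals L. addable L p D}"
    using ideal_subset by (auto simp: addable_def removable_def insert_absorb)
qed (auto simp: addable_def removable_def)

lemma toggle_symmetric_uniform: "toggle_symmetric L (\<lambda>_. 1)"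
  unfolding toggle_symmetric_def using bij_betw_same_card[OF bij_toggle] by simp

definition chain_wt :: "(nat \<times> nat) set \<Rightarrow> real" where
  "chain_wt D = real (chain_num (inclusion (ideals L)) {} D * chain_num (inclusion (ideals L)) D L)"

text \<open>
  Ideals to which \<open>p\<close> can be added are left upwards only by adding \<open>p\<close>, and those from which it can be
      removed are
  entered upwards only by adding \<open>p\<close>.  So with \<open>E\<close> and \<open>E'\<close> counting chains below \<open>D \<union> {p}\<close> and above \<open>D\<close>, both
  total weights equal the sum of \<open>E D * E' D\<close> minus that of \<open>E D * E' D'\<close> over the covers \<open>D < D'\<close>.
\<close>

lemma toggle_symmetric_chain: "toggle_symmetric L chain_wt"
  unfolding toggle_symmetric_def
proof
  fix p
  let ?r = "inclusion (ideals L)"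
  define J where "J = {D \<in> ideals L. addable L p D}"
  define R where "R = (\<lambda>(D :: (nat \<times> nat) set) D'. \<exists>q. q \<notin> D \<and> D' = insert q D)"
  define E where "E = (\<lambda>D. real (chain_num ?r {} (insert p D)))"
  define E' where "E' = (\<lambda>D. real (chain_num ?r D L))"
  have finJ: "finite J" using finite_ideals by (simp add: J_def)
  have J: "D \<in> ideals L" "p \<in> L" "p \<notin> D" "insert p D \<in> ideals L" if "D \<in> J" for D
    using that by (auto simp: J_def addable_def)
  have JI: "D \<in> J" if "D \<in> ideals L" "p \<in> L" "p \<notin> D" "insert p D \<in> ideals L" for D
    using that by (auto simp: J_def addable_def)
  have up: "E' D = real (chain_num ?r (insert p D) L) + (\<Sum>D'\<in>{D'\<in>J. R D D'}. E' D')" if D: "D \<in> J" for D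
  proof -
    have "{z. covered ?r D z \<and> (z, L) \<in> ?r} = insert (insert p D) {D'\<in>J. R D D'}"
    proof (intro equalityI subsetI)
      fix z assume "z \<in> {z. covered ?r D z \<and> (z, L) \<in> ?r}"
      then obtain q where q: "z \<in> ideals L" "q \<notin> D" "z = insert q D" by (auto simp: covered_ideals)
      show "z \<in> insert (insert p D) {D'\<in>J. R D D'}"
      proof (cases "q = p")
        case False
        \<comment> \<open>Ideals are closed under union, so p remains addable after any other cell
          has been added.\<close>
        have "insert p D \<union> z \<in> ideals L" by (rule ideals_Un[OF J(4)[OF D] q(1)])
        then have "insert p z \<in> ideals L" unfolding q(3) by (simp add: insert_commute)
        then have "z \<in> J" using q J(2,3)[OF D] False by (intro JI) auto
        moreover have "R D z" unfolding R_def using q(2,3) by blast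
        ultimately show ?thesis by blast
      qed (use q in auto)
    next
      fix z assume z: "z \<in> insert (insert p D) {D'\<in>J. R D D'}"
      have "z \<in> ideals L \<and> (\<exists>q. q \<notin> D \<and> z = insert q D)"
      proof (cases "z = insert p D")
        case True
        then show ?thesis using J(3,4)[OF D] by blast
      next
        case False
        then show ?thesis using z J(1)[of z] unfolding R_def by blast
      qed
      then show "z \<in> {z. covered ?r D z \<and> (z, L) \<in> ?r}"
        using J(1)[OF D] ideal_subset L_ideal by (simp add: covered_ideals mem_r)
    qed
    moreover have "insert p D \<notin> {D'\<in>J. R D D'}" using J(3)[of "insert p D"] by auto
    moreover have "(D, L) \<in> ?r" "D \<noteq> L" using J[OF D] ideal_subset L_ideal by (auto simp: mem_r)
    ultimately show ?thesis using chain_num_rec_up[of D L] finJ by (simp add: E'_def)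
  qed
  have down: "E D = real (chain_num ?r {} D) + (\<Sum>D'\<in>{D'\<in>J. R D' D}. E D')" if D: "D \<in> J" for D
  proof -
    have eq: "{z. covered ?r z (insert p D) \<and> ({}, z) \<in> ?r} = insert D (insert p ` {D'\<in>J. R D' D})"
    proof (intro equalityI subsetI)
      fix z assume "z \<in> {z. covered ?r z (insert p D) \<and> ({}, z) \<in> ?r}"
      then obtain q where q: "z \<in> ideals L" "q \<notin> z" "insert p D = insert q z" by (auto simp: covered_ideals)
      show "z \<in> insert D (insert p ` {D'\<in>J. R D' D})"
      proof (cases "q = p")
        case True
        then have "z = D" using q J(3)[OF D] insert_ident[of p D z] by simp
        then show ?thesis by simp
      next
        case False
        have z: "z = insert p D - {q}" unfolding q(3) using q(2) by simp
        have "q \<in> insert p D" unfolding q(3) by simp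
        then have qD: "q \<in> D" using False by simp
        have zD: "z \<inter> D = D - {q}" unfolding z by blast
        have zD2: "insert q (z \<inter> D) = D" unfolding zD using qD by blast
        have zD3: "insert p (z \<inter> D) = z" unfolding zD z using False by blast
        \<comment> \<open>Dually, closure under intersection shows that q can already be removed
          before p is added.\<close>
        have "z \<inter> D \<in> ideals L" by (rule ideals_Int[OF q(1) J(1)[OF D]])
        then have "z \<inter> D \<in> J" using zD3 q(1) J(2,3)[OF D] by (intro JI) simp_all
        moreover have "R (z \<inter> D) D" unfolding R_def using zD2 q(2) by (intro exI[of _ q]) simp
        ultimately have "insert p (z \<inter> D) \<in> insert p ` {D'\<in>J. R D' D}" by (intro imageI) simp
        then show ?thesis unfolding zD3 by simp
      qed
    next
      fix z assume z: "z \<in> insert D (insert p ` {D'\<in>J. R D' D})"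
      have "z \<in> ideals L \<and> (\<exists>q. q \<notin> z \<and> insert p D = insert q z)"
      proof (cases "z = D")
        case True
        then show ?thesis using J[OF D] by blast
      next
        case False
        then obtain D' q where d: "D' \<in> J" "q \<notin> D'" "D = insert q D'" "z
            = insert p D'" using z unfolding R_def by blast
        then have "q \<noteq> p" using J(3)[OF D] by blast
        then have "q \<notin> z \<and> insert p D = insert q z" unfolding d(3,4) using d(2) by (simp add: insert_commute)
        then show ?thesis using J(4)[OF d(1)] d(4) by blast
      qed
      then show "z \<in> {z. covered ?r z (insert p D) \<and> ({}, z) \<in> ?r}"
        using J(4)[OF D] empty_ideal by (simp add: covered_ideals mem_r)
    qed
    have inj: "inj_on (insert p) {D'\<in>J. R D' D}"
    proof (rule inj_onI)
      fix A B assume "A \<in> {D'\<in>J. R D' D}" "B \<in> {D'\<in>J. R D' D}" "insert p A = insert p B"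
      then show "A = B" using insert_ident[of p A B] J(3) by simp
    qed
    have "D \<notin> insert p ` {D'\<in>J. R D' D}" using J(3)[OF D] by blast
    moreover have "({}, insert p D) \<in> ?r" "{} \<noteq> insert p D" using J[OF D] empty_ideal by (auto simp: mem_r)
    ultimately show ?thesis using chain_num_rec[of "{}" "insert p D"] finJ
      unfolding eq by (simp add: E_def sum.reindex[OF inj])
  qed
  have "(\<Sum>D\<in>J. chain_wt D) = (\<Sum>D\<in>J. E D * E' D - (\<Sum>D'\<in>{D'\<in>J. R D' D}. E D' * E' D))"
  proof (rule sum.cong[OF refl])
    fix D assume D: "D \<in> J"
    have "chain_wt D = real (chain_num ?r {} D) * E' D" by (simp add: chain_wt_def E'_def)
    also have "real (chain_num ?r {} D) = E D - (\<Sum>D'\<in>{D'\<in>J. R D' D}. E D')" using down[OF D] by simp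
    finally show "chain_wt D = E D * E' D - (\<Sum>D'\<in>{D'\<in>J. R D' D}. E D' * E' D)"
      by (simp add: left_diff_distrib sum_distrib_right)
  qed
  also have "\<dots> = (\<Sum>D\<in>J. E D * E' D) - (\<Sum>D\<in>J. \<Sum>D'\<in>{D'\<in>J. R D' D}. E D' * E' D)"
    by (rule sum_subtractf)
  also have "(\<Sum>D\<in>J. \<Sum>D'\<in>{D'\<in>J. R D' D}. E D' * E' D) = (\<Sum>D'\<in>J. \<Sum>D\<in>{D\<in>J. R D' D}. E D' * E' D)"
    by (rule sum.swap_restrict[OF finJ finJ])
  also have "(\<Sum>D\<in>J. E D * E' D) - \<dots> = (\<Sum>D\<in>J. E D * E' D - (\<Sum>D'\<in>{D'\<in>J. R D D'}. E D * E' D'))"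
    by (rule sum_subtractf[symmetric])
  also have "\<dots> = (\<Sum>D\<in>J. chain_wt (insert p D))"
  proof (rule sum.cong[OF refl])
    fix D assume D: "D \<in> J"
    have "chain_wt (insert p D) = E D * real (chain_num ?r (insert p D) L)" by (simp add: chain_wt_def E_def)
    also have "real (chain_num ?r (insert p D) L) = E' D - (\<Sum>D'\<in>{D'\<in>J. R D D'}. E' D')" using up[OF D] by simp
    finally show "E D * E' D - (\<Sum>D'\<in>{D'\<in>J. R D D'}. E D * E' D') = chain_wt (insert p D)"
      by (simp add: right_diff_distrib sum_distrib_left)
  qed
  also have "\<dots> = (\<Sum>D\<in>{D \<in> ideals L. removable L p D}. chain_wt D)"
    unfolding J_def by (rule sum.reindex_bij_betw[OF bij_toggle])
  finally show "(\<Sum>D\<in>{D \<in> ideals L. addable L p D}. chain_wt D)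
      = (\<Sum>D\<in>{D \<in> ideals L. removable L p D}. chain_wt D)"
    unfolding J_def .
qed

text \<open>For toggle-symmetric \<omega> this is also the weight of the ideals to which the cell
  can be added.\<close>

definition toggle_sum :: "((nat \<times> nat) set \<Rightarrow> real) \<Rightarrow> nat \<Rightarrow> nat \<Rightarrow> real" where
  "toggle_sum \<omega> i j = (\<Sum>D\<in>{D \<in> ideals L. removable L (i, j) D}. \<omega> D)"

lemma down_degree_ideals:
  assumes D: "D \<in> ideals L"
  shows "down_degree (inclusion (ideals L)) D = card {p \<in> L. removable L p D}"
    and "down_degree ((inclusion (ideals L))\<inverse>) D = card {p \<in> L. addable L p D}"
proof -
  have "{q \<in> ideals L. covered (inclusion (ideals L)) q D} = (\<lambda>p. D - {p}) ` {p \<in> L. removable L p D}"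
  proof (intro equalityI subsetI)
    fix q assume "q \<in> {q \<in> ideals L. covered (inclusion (ideals L)) q D}"
    then obtain p where p: "q \<in> ideals L" "p \<notin> q" "D = insert p q" by (auto simp: covered_ideals)
    then have e: "q = D - {p}" "p \<in> L" using ideal_subset[OF D] by auto
    have "p \<in> D" unfolding p(3) by simp
    moreover have "D - {p} \<in> ideals L" using p(1) unfolding e(1) .
    ultimately have "p \<in> {p \<in> L. removable L p D}" using e(2) by (simp add: removable_def)
    then show "q \<in> (\<lambda>p. D - {p}) ` {p \<in> L. removable L p D}" unfolding e(1) by (rule imageI)
  next
    fix q assume "q \<in> (\<lambda>p. D - {p}) ` {p \<in> L. removable L p D}"
    then obtain p where p: "p \<in> D" "D - {p} \<in> ideals L" "q = D - {p}" unfolding removable_def by blast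
    moreover have "p \<notin> D - {p}" "D = insert p (D - {p})" using p(1) by blast+
    ultimately show "q \<in> {q \<in> ideals L. covered (inclusion (ideals L)) q D}"
      using D unfolding covered_ideals by blast
  qed
  moreover have "inj_on (\<lambda>p. D - {p}) {p \<in> L. removable L p D}"
    by (rule inj_onI) (unfold removable_def, blast)
  ultimately show "down_degree (inclusion (ideals L)) D = card {p \<in> L. removable L p D}"
    by (simp add: down_degree_def Field_inclusion card_image)
  have "{q \<in> ideals L. covered (inclusion (ideals L)) D q} = (\<lambda>p. insert p D) ` {p \<in> L. addable L p D}"
  proof (intro equalityI subsetI)
    fix q assume "q \<in> {q \<in> ideals L. covered (inclusion (ideals L)) D q}"
    then obtain p where p: "q \<in> ideals L" "p \<notin> D" "q = insert p D" by (auto simp: covered_ideals)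
    then have "p \<in> L" using ideal_subset[of q] by auto
    then have "addable L p D" using p by (simp add: addable_def)
    then show "q \<in> (\<lambda>p. insert p D) ` {p \<in> L. addable L p D}" using p(3) \<open>p \<in> L\<close> by blast
  next
    fix q assume "q \<in> (\<lambda>p. insert p D) ` {p \<in> L. addable L p D}"
    then show "q \<in> {q \<in> ideals L. covered (inclusion (ideals L)) D q}"
      using D unfolding addable_def covered_ideals by blast
  qed
  moreover have "inj_on (\<lambda>p. insert p D) {p \<in> L. addable L p D}"
    by (rule inj_onI) (unfold addable_def, blast)
  ultimately show "down_degree ((inclusion (ideals L))\<inverse>) D = card {p \<in> L. addable L p D}"
    by (simp add: down_degree_def Field_inclusion covered_converse card_image)
qed

text \<open>Both degree sums are collected cell by cell. The second one counts addable cells, which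
  toggle symmetry turns into removable ones, so the dual poset gets the same value.\<close>

lemma sum_degree:
  assumes "toggle_symmetric L \<omega>"
  shows "(\<Sum>D\<in>ideals L. \<omega> D * real (down_degree (inclusion (ideals L)) D))
      = (\<Sum>p\<in>L. toggle_sum \<omega> (fst p) (snd p))"
    and "(\<Sum>D\<in>ideals L. \<omega> D * real (down_degree ((inclusion (ideals L))\<inverse>) D))
        = (\<Sum>p\<in>L. toggle_sum \<omega> (fst p) (snd p))"
proof -
  have swap: "(\<Sum>D\<in>ideals L. \<omega> D * real (card {p \<in> L. Q p D})) = (\<Sum>p\<in>L. \<Sum>D\<in>{D \<in> ideals L. Q p D}. \<omega> D)" for Q
  proof -
    have "(\<Sum>D\<in>ideals L. \<omega> D * real (card {p \<in> L. Q p D})) = (\<Sum>D\<in>ideals L. \<Sum>p\<in>{p \<in> L. Q p D}. \<omega> D)"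
      by (intro sum.cong refl) simp
    also have "\<dots> = (\<Sum>p\<in>L. \<Sum>D\<in>{D \<in> ideals L. Q p D}. \<omega> D)"
      by (rule sum.swap_restrict[OF finite_ideals finite_L])
    finally show ?thesis .
  qed
  show "(\<Sum>D\<in>ideals L. \<omega> D * real (down_degree (inclusion (ideals L)) D)) = (\<Sum>p\<in>L. toggle_sum \<omega> (fst p) (snd p))"
    using swap[of "removable L"] by (simp add: down_degree_ideals(1) toggle_sum_def cong: sum.cong)
  show "(\<Sum>D\<in>ideals L. \<omega> D * real (down_degree ((inclusion (ideals L))\<inverse>) D))
      = (\<Sum>p\<in>L. toggle_sum \<omega> (fst p) (snd p))"
    using swap[of "addable L"] assms unfolding toggle_symmetric_def
    by (simp add: down_degree_ideals(2) toggle_sum_def cong: sum.cong)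
qed

section \<open>Rooks\<close>

text \<open>The indicator of D shifted by one, with a border row and a border column that count as
  belonging to D.\<close>

abbreviation chi :: "(nat \<times> nat) set \<Rightarrow> nat \<Rightarrow> nat \<Rightarrow> real" where
  "chi D i j \<equiv> of_bool (i = 0 \<or> j = 0 \<or> (i - 1, j - 1) \<in> D)"

abbreviation add_cell :: "(nat \<times> nat) set \<Rightarrow> nat \<Rightarrow> nat \<Rightarrow> real" where
  "add_cell D i j \<equiv> of_bool (addable L (i, j) D)"

abbreviation rem_cell :: "(nat \<times> nat) set \<Rightarrow> nat \<Rightarrow> nat \<Rightarrow> real" where
  "rem_cell D i j \<equiv> of_bool (removable L (i, j) D)"

lemma addable_iff:
  assumes D: "D \<in> ideals L"
  shows "addable L (i, j) D \<longleftrightarrow> (i, j) \<in> L \<and> (i, j) \<notin> D \<and> (i = 0 \<or> (i - 1, j) \<in> D) \<and> (j = 0 \<or> (i, j - 1) \<in> D)"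
proof
  assume a: "addable L (i, j) D"
  then have dc: "down_closed (insert (i, j) D)" and n: "(i, j) \<notin> D"
      "(i, j) \<in> L" by (auto simp: addable_def ideals_def)
  have "(i - 1, j) \<in> insert (i, j) D" by (rule down_closedD[OF dc, of i j]) simp_all
  moreover have "(i, j - 1) \<in> insert (i, j) D" by (rule down_closedD[OF dc, of i j]) simp_all
  ultimately show "(i, j) \<in> L \<and> (i, j) \<notin> D \<and> (i = 0 \<or> (i - 1, j) \<in> D) \<and> (j = 0 \<or> (i, j - 1) \<in> D)"
    using n by (cases i; cases j) auto
next
  assume a: "(i, j) \<in> L \<and> (i, j) \<notin> D \<and> (i = 0 \<or> (i - 1, j) \<in> D) \<and> (j = 0 \<or> (i, j - 1) \<in> D)"
  have dD: "down_closed D" using ideal_closed[OF D] .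
  have "(i', j') \<in> insert (i, j) D" if "i' \<le> i" "j' \<le> j" for i' j'
  proof -
    consider "i' = i" "j' = j" | "i' < i" | "j' < j" using \<open>i' \<le> i\<close> \<open>j' \<le> j\<close> by linarith
    then show ?thesis
    proof cases
      case 2
      then have "(i - 1, j) \<in> D" using a by simp
      from down_closedD[OF dD this, of i' j'] show ?thesis using 2 that by simp
    next
      case 3
      then have "(i, j - 1) \<in> D" using a by simp
      from down_closedD[OF dD this, of i' j'] show ?thesis using 3 that by simp
    qed simp
  qed
  then have "down_closed (insert (i, j) D)" using down_closedD[OF dD] unfolding down_closed_def by blast
  then show "addable L (i, j) D" using a ideal_subset[OF D] by (simp add: addable_def ideals_def)
qed

lemma removable_iff:
  assumes D: "D \<in> ideals L"
  shows "removable L (i, j) D \<longleftrightarrow> (i, j) \<in> D \<and> (Suc i, j) \<notin> D \<and> (i, Suc j) \<notin> D"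
proof
  assume a: "removable L (i, j) D"
  then have dc: "down_closed (D - {(i, j)})" and m: "(i, j) \<in> D" by (auto simp: removable_def ideals_def)
  have "(Suc i, j) \<notin> D"
    using down_closedD[OF dc, of "Suc i" j i j] by auto
  moreover have "(i, Suc j) \<notin> D"
    using down_closedD[OF dc, of i "Suc j" i j] by auto
  ultimately show "(i, j) \<in> D \<and> (Suc i, j) \<notin> D \<and> (i, Suc j) \<notin> D" using m by simp
next
  assume a: "(i, j) \<in> D \<and> (Suc i, j) \<notin> D \<and> (i, Suc j) \<notin> D"
  have dD: "down_closed D" using ideal_closed[OF D] .
  have "down_closed (D - {(i, j)})"
    unfolding down_closed_def
  proof (intro allI impI)
    fix x y x' y' assume b: "(x, y) \<in> D - {(i, j)}" "x' \<le> x" "y' \<le> y"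
    have "(x', y') \<in> D" using down_closedD[OF dD _ b(2,3)] b(1) by simp
    moreover have "(x', y') \<noteq> (i, j)"
    proof
      assume e: "(x', y') = (i, j)"
      then consider "Suc i \<le> x" "j \<le> y" | "i \<le> x" "Suc j \<le> y" using b by fastforce
      then show False using down_closedD[OF dD, of x y] b(1) a by cases auto
    qed
    ultimately show "(x', y') \<in> D - {(i, j)}" by simp
  qed
  then show "removable L (i, j) D" using a ideal_subset[OF D] by (auto simp: removable_def ideals_def)
qed

text \<open>The right side is a mixed second difference over the cells (i - 1, j - 1), (i - 1, j),
  (i, j - 1) and (i, j). In a down-closed set it is 1 if only (i, j) is missing, -1 if only (i - 1,
  j - 1) is present, and 0 otherwise. The assumptions on L ensure that in the first case (i, j) is a
  cell of L.\<close>

lemma corner_difference: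
  assumes D: "D \<in> ideals L" and L: "(i, j) \<in> L \<or> (i - 1, j) \<notin> D \<or> (i, j - 1) \<notin> D \<and> i \<noteq> 0 \<and> j \<noteq> 0"
    and L0: "i = 0 \<or> j = 0 \<Longrightarrow> (i, j) \<in> L"
  shows "add_cell D i j - (if i = 0 \<or> j = 0 then 0 else rem_cell D (i - 1) (j - 1))
    = chi D i (Suc j) + chi D (Suc i) j - chi D i j - chi D (Suc i) (Suc j)"
proof -
  note dc = down_closedD[OF ideal_closed[OF D]]
  have 1: "(i, j) \<in> D \<Longrightarrow> (i - 1, j) \<in> D" "(i, j) \<in> D \<Longrightarrow> (i, j - 1) \<in> D"
    "(i - 1, j) \<in> D \<Longrightarrow> (i - 1, j - 1) \<in> D" "(i, j - 1) \<in> D \<Longrightarrow> (i - 1, j - 1) \<in> D"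
    by (erule dc; simp)+
  show ?thesis
  proof (cases "i = 0 \<or> j = 0")
    case True
    then show ?thesis using 1 L0 unfolding addable_iff[OF D] by (cases i; cases j) auto
  next
    case False
    then obtain i' j' where ij: "i = Suc i'" "j = Suc j'" by (meson not0_implies_Suc)
    show ?thesis using 1 L unfolding addable_iff[OF D] removable_iff[OF D] ij by auto
  qed
qed

end

lemma telescope2:
  fixes f :: "nat \<Rightarrow> nat \<Rightarrow> real"
  shows "(\<Sum>i<m. \<Sum>j<n. f i (Suc j) + f (Suc i) j - f i j - f (Suc i) (Suc j)) = f 0 n + f m 0 - f 0 0 - f m n"
proof -
  have "(\<Sum>j<n. f i (Suc j) + f (Suc i) j - f i j - f (Suc i) (Suc j))
      = (f i n - f (Suc i) n) - (f i 0 - f (Suc i) 0)" for i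
    by (induction n) (simp_all add: algebra_simps)
  then have "(\<Sum>i<m. \<Sum>j<n. f i (Suc j) + f (Suc i) j - f i j - f (Suc i) (Suc j))
    = (\<Sum>i<m. (f i n - f (Suc i) n) - (f i 0 - f (Suc i) 0))" by simp
  also have "\<dots> = f 0 n + f m 0 - f 0 0 - f m n"
    by (induction m) (simp_all add: algebra_simps)
  finally show ?thesis .
qed

context diagram_poset
begin

text \<open>The second differences telescope over the rectangle north-west of the rook. Three of its
  corners are on the border, where \<open>chi\<close> is 1.\<close>

lemma rook_nw:
  assumes D: "D \<in> ideals L" and IJ: "(I, J) \<in> L"
  shows "(\<Sum>i<Suc I. \<Sum>j<Suc J. add_cell D i j) - (\<Sum>i<I. \<Sum>j<J. rem_cell D i j) = 1 - of_bool ((I, J) \<in> D)"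
proof -
  let ?r = "\<lambda>i j. if i = 0 \<or> j = 0 then 0 else rem_cell D (i - 1) (j - 1)"
  have "(\<Sum>i<Suc I. \<Sum>j<Suc J. ?r i j) = (\<Sum>i<I. \<Sum>j<J. rem_cell D i j)"
    by (simp only: sum.lessThan_Suc_shift) simp
  then have "(\<Sum>i<Suc I. \<Sum>j<Suc J. add_cell D i j) - (\<Sum>i<I. \<Sum>j<J. rem_cell D i j)
    = (\<Sum>i<Suc I. \<Sum>j<Suc J. add_cell D i j - ?r i j)" by (simp only: sum_subtractf)
  also have "\<dots> = (\<Sum>i<Suc I. \<Sum>j<Suc J. chi D i (Suc j) + chi D (Suc i) j - chi D i j - chi D (Suc i) (Suc j))"
  proof (intro sum.cong refl)
    fix i j assume "i \<in> {..<Suc I}" "j \<in> {..<Suc J}"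
    then have "(i, j) \<in> L" by (intro down_closedD[OF dcL IJ]) auto
    then show "add_cell D i j - ?r i j = chi D i (Suc j) + chi D (Suc i) j - chi D i j - chi D (Suc i) (Suc j)"
      by (intro corner_difference[OF D]) auto
  qed
  also have "\<dots> = chi D 0 (Suc J) + chi D (Suc I) 0 - chi D 0 0 - chi D (Suc I) (Suc J)"
    by (rule telescope2)
  also have "\<dots> = 1 - of_bool ((I, J) \<in> D)" by simp
  finally show ?thesis .
qed

text \<open>Row I ends at J + n, column J ends at I + m, and the opposite corner is still in L, so
  the part of L south-east of the rook is a full rectangle. Three corners of the telescoping sum now
  lie outside L, where \<open>chi\<close> is 0.\<close>

lemma rook_se:
  assumes D: "D \<in> ideals L" and IJ: "(I + m, J + n) \<in> L" and out: "(I + Suc m, J) \<notin> L" "(I, J + Suc n) \<notin> L"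
  shows "(\<Sum>i<Suc m. \<Sum>j<Suc n. rem_cell D (I + i) (J + j)) - (\<Sum>i<m. \<Sum>j<n. add_cell D (I + Suc i) (J
      + Suc j)) = of_bool ((I, J) \<in> D)"
proof -
  note DL = subsetD[OF ideal_subset[OF D]]
  have oL: "(x, y) \<notin> L" if "I + Suc m \<le> x \<and> J \<le> y \<or> I \<le> x \<and> J + Suc n \<le> y" for x y
    using down_closedD[OF dcL, of x y] out that by blast
  \<comment> \<open>These cells lie outside L, so the sum of addable cells may be extended by one
    row and one column to match the sum of removable ones.\<close>
  have z: "add_cell D (I + Suc m) (J + Suc j) = 0" "add_cell D (I + Suc i) (J + Suc n) = 0" for i j
    using oL[of "I + Suc m" "J + Suc j"] oL[of "I + Suc i" "J + Suc n"] by (auto simp: addable_def)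
  have "(\<Sum>i<m. \<Sum>j<n. add_cell D (I + Suc i) (J + Suc j)) = (\<Sum>i<Suc m. \<Sum>j<Suc n. add_cell D (I
      + Suc i) (J + Suc j))"
    by (simp only: sum.lessThan_Suc z) simp
  then have "(\<Sum>i<m. \<Sum>j<n. add_cell D (I + Suc i) (J + Suc j)) - (\<Sum>i<Suc m. \<Sum>j<Suc n. rem_cell D (I + i) (J + j))
    = (\<Sum>i<Suc m. \<Sum>j<Suc n. add_cell D (I + Suc i) (J + Suc j) - rem_cell D (I + i) (J + j))"
    by (simp only: sum_subtractf)
  also have "\<dots> = (\<Sum>i<Suc m. \<Sum>j<Suc n. chi D (Suc I + i) (Suc J + Suc j) + chi D (Suc I + Suc i) (Suc J + j)
      - chi D (Suc I + i) (Suc J + j) - chi D (Suc I + Suc i) (Suc J + Suc j))"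
  proof (intro sum.cong refl)
    fix i j assume ij: "i \<in> {..<Suc m}" "j \<in> {..<Suc n}"
    have "(I + Suc i, J + Suc j) \<in> L \<or> (I + i, J + Suc j) \<notin> D \<or> (I + Suc i, J + j) \<notin> D"
    proof (cases "i < m \<and> j < n")
      case True
      then have "(I + Suc i, J + Suc j) \<in> L" by (intro down_closedD[OF dcL IJ]) auto
      then show ?thesis by simp
    next
      case False
      then have "i = m \<or> j = n" using ij by auto
      then show ?thesis using oL[of "I + i" "J + Suc j"] oL[of "I + Suc i" "J + j"] DL by auto
    qed
    then show "add_cell D (I + Suc i) (J + Suc j) - rem_cell D (I + i) (J + j)
      = chi D (Suc I + i) (Suc J + Suc j) + chi D (Suc I + Suc i) (Suc J + j)
      - chi D (Suc I + i) (Suc J + j) - chi D (Suc I + Suc i) (Suc J + Suc j)"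
      using corner_difference[OF D, of "I + Suc i" "J + Suc j"] by simp
  qed
  also have "\<dots> = chi D (Suc I) (Suc J + Suc n) + chi D (Suc I
      + Suc m) (Suc J) - chi D (Suc I) (Suc J) - chi D (Suc I + Suc m) (Suc J + Suc n)"
    using telescope2[of "\<lambda>i j. chi D (Suc I + i) (Suc J + j)" "Suc n" "Suc m"] by simp
  also have "\<dots> = - of_bool ((I, J) \<in> D)"
    using oL[of I "J + Suc n"] oL[of "I + Suc m" J] oL[of "I + Suc m" "J + Suc n"] DL by auto
  finally show ?thesis by linarith
qed

lemma sum_split_at:
  fixes f :: "nat \<Rightarrow> real"
  shows "(\<Sum>j<Suc (J + n). f j) = (\<Sum>j<J. f j) + f J + (\<Sum>j<n. f (J + Suc j))"
  by (induction n) simp_all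

text \<open>For each D the identities of \<open>rook_nw\<close> and \<open>rook_se\<close> add up to
  1. After averaging, addable and removable cells have the same weight, so the interiors of the two
  rectangles cancel. Row I and column J remain, with the rook's own cell counted in both.\<close>

lemma rook_sum:
  assumes sym: "toggle_symmetric L \<omega>"
    and IJ: "(I + m, J + n) \<in> L" and out: "(I + Suc m, J) \<notin> L" "(I, J + Suc n) \<notin> L"
  shows "(\<Sum>j<Suc (J + n). toggle_sum \<omega> I j) + (\<Sum>i<Suc (I + m). toggle_sum \<omega> i J) = (\<Sum>D\<in>ideals L. \<omega> D)"
proof -
  let ?T = "toggle_sum \<omega>"
  have R: "(\<Sum>D\<in>ideals L. \<omega> D * rem_cell D i j) = ?T i j" for i j
    unfolding toggle_sum_def sum.inter_filter[OF finite_ideals] by (intro sum.cong refl) simp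
  have A: "(\<Sum>D\<in>ideals L. \<omega> D * add_cell D i j) = ?T i j" for i j
  proof -
    have "(\<Sum>D\<in>ideals L. \<omega> D * add_cell D i j) = (\<Sum>D\<in>{D \<in> ideals L. addable L (i, j) D}. \<omega> D)"
      unfolding sum.inter_filter[OF finite_ideals] by (intro sum.cong refl) simp
    then show ?thesis using sym by (simp add: toggle_symmetric_def toggle_sum_def)
  qed
  have S: "(\<Sum>D\<in>ideals L. \<omega> D * (\<Sum>i<a. \<Sum>j<b. F D i j)) = (\<Sum>i<a. \<Sum>j<b. \<Sum>D\<in>ideals L. \<omega> D * F D i j)" for a b F
  proof -
    have "(\<Sum>D\<in>ideals L. \<omega> D * (\<Sum>i<a. \<Sum>j<b. F D i j)) = (\<Sum>D\<in>ideals L. \<Sum>i<a. \<Sum>j<b. \<omega> D * F D i j)"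
      by (simp only: sum_distrib_left)
    also have "\<dots> = (\<Sum>i<a. \<Sum>D\<in>ideals L. \<Sum>j<b. \<omega> D * F D i j)" by (rule sum.swap)
    also have "\<dots> = (\<Sum>i<a. \<Sum>j<b. \<Sum>D\<in>ideals L. \<omega> D * F D i j)" by (intro sum.cong refl sum.swap)
    finally show ?thesis .
  qed
  have IJL: "(I, J) \<in> L" by (rule down_closedD[OF dcL IJ]) auto
  have "(\<Sum>D\<in>ideals L. \<omega> D) = (\<Sum>D\<in>ideals L. \<omega> D * (((\<Sum>i<Suc I. \<Sum>j<Suc J. add_cell D i j)
      - (\<Sum>i<I. \<Sum>j<J. rem_cell D i j))
     + ((\<Sum>i<Suc m. \<Sum>j<Suc n. rem_cell D (I + i) (J + j)) - (\<Sum>i<m. \<Sum>j<n. add_cell D (I + Suc i) (J + Suc j)))))"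
  proof (rule sum.cong[OF refl])
    fix D assume D: "D \<in> ideals L"
    show "\<omega> D = \<omega> D * (((\<Sum>i<Suc I. \<Sum>j<Suc J. add_cell D i j) - (\<Sum>i<I. \<Sum>j<J. rem_cell D i j))
     + ((\<Sum>i<Suc m. \<Sum>j<Suc n. rem_cell D (I + i) (J + j)) - (\<Sum>i<m. \<Sum>j<n. add_cell D (I + Suc i) (J + Suc j))))"
      unfolding rook_nw[OF D IJL] rook_se[OF D IJ out] by simp
  qed
  also have "\<dots> = ((\<Sum>i<Suc I. \<Sum>j<Suc J. ?T i j) - (\<Sum>i<I. \<Sum>j<J. ?T i j))
     + ((\<Sum>i<Suc m. \<Sum>j<Suc n. ?T (I + i) (J + j)) - (\<Sum>i<m. \<Sum>j<n. ?T (I + Suc i) (J + Suc j)))"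
    unfolding distrib_left right_diff_distrib sum.distrib sum_subtractf S R A ..
  also have "(\<Sum>i<Suc I. \<Sum>j<Suc J. ?T i j) - (\<Sum>i<I. \<Sum>j<J. ?T i j) = (\<Sum>j<J. ?T I j) + ?T I J + (\<Sum>i<I. ?T i J)"
    by (simp add: sum.distrib)
  also have "(\<Sum>i<Suc m. \<Sum>j<Suc n. ?T (I + i) (J + j)) - (\<Sum>i<m. \<Sum>j<n. ?T (I + Suc i) (J + Suc j))
    = ?T I J + (\<Sum>j<n. ?T I (J + Suc j)) + (\<Sum>i<m. ?T (I + Suc i) J)"
    unfolding sum.lessThan_Suc_shift sum.distrib by simp
  finally show ?thesis unfolding sum_split_at by linarith
qed

end

lemma sum_blocks:
  fixes f :: "nat \<Rightarrow> real"
  shows "(\<Sum>k<n. \<Sum>s<a. f (k * a + s)) = (\<Sum>i<n * a. f i)"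
proof (induction n)
  case (Suc n)
  have "(\<Sum>i<n * a + m. f i) = (\<Sum>i<n * a. f i) + (\<Sum>s<m. f (n * a + s))" for m
    by (induction m) simp_all
  from this[of a] show ?case using Suc by (simp add: add.commute)
qed simp

text \<open>Any row of block row k may be paired with any column of block column d - Suc k, as they
  meet in an outer block. Among the d * a * b pairs each row occurs b times and each column a times,
  and the rows and the columns have the same total.\<close>

lemma staircase_total:
  fixes T :: "nat \<Rightarrow> nat \<Rightarrow> real"
  assumes rook: "\<And>I J. I div a + J div b + 2 = Suc d \<Longrightarrow>
      (\<Sum>j<(J div b + 1) * b. T I j) + (\<Sum>i<(I div a + 1) * a. T i J) = W"
    and ab: "0 < a" "0 < b"
    and zero: "\<And>i j. \<not> i div a + j div b + 1 < Suc d \<Longrightarrow> T i j = 0"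
  shows "(real a + real b) * (\<Sum>i<d * a. \<Sum>j<d * b. T i j) = real d * real a * real b * W"
proof -
  let ?row = "\<lambda>i. \<Sum>j<d * b. T i j" and ?col = "\<lambda>j. \<Sum>i<d * a. T i j"
  have cell: "?row (k * a + s) + ?col ((d - Suc k) * b + t) = W" if k: "k < d" "s < a" "t < b" for k s t
  proof -
    let ?I = "k * a + s" and ?J = "(d - Suc k) * b + t"
    have dv: "?I div a = k" "?J div b = d - Suc k" using k by simp_all
    have r: "(\<Sum>j<(?J div b + 1) * b. T ?I j) = ?row ?I"
    proof (rule sum.mono_neutral_left)
      show "{..<(?J div b + 1) * b} \<subseteq> {..<d * b}"
        unfolding dv using k mult_le_mono1[of "d - Suc k + 1" d b] by auto
      show "\<forall>j\<in>{..<d * b} - {..<(?J div b + 1) * b}. T ?I j = 0"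
      proof
        fix j assume "j \<in> {..<d * b} - {..<(?J div b + 1) * b}"
        then have "(d - Suc k + 1) * b \<le> j" unfolding dv by simp
        then have "d - Suc k + 1 \<le> j div b" using ab(2) by (simp add: less_eq_div_iff_mult_less_eq)
        then show "T ?I j = 0" using k dv by (intro zero) linarith
      qed
    qed simp
    have c: "(\<Sum>i<(?I div a + 1) * a. T i ?J) = ?col ?J"
    proof (rule sum.mono_neutral_left)
      show "{..<(?I div a + 1) * a} \<subseteq> {..<d * a}"
        unfolding dv using k mult_le_mono1[of "k + 1" d a] by auto
      show "\<forall>i\<in>{..<d * a} - {..<(?I div a + 1) * a}. T i ?J = 0"
      proof
        fix i assume "i \<in> {..<d * a} - {..<(?I div a + 1) * a}"
        then have "(k + 1) * a \<le> i" unfolding dv by simp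
        then have "k + 1 \<le> i div a" using ab(1) by (simp add: less_eq_div_iff_mult_less_eq)
        then show "T i ?J = 0" using k dv by (intro zero) linarith
      qed
    qed simp
    have "?I div a + ?J div b + 2 = Suc d" unfolding dv using k by simp
    from rook[OF this] show ?thesis unfolding r c .
  qed
  have "real d * real a * real b * W = (\<Sum>k<d. \<Sum>s<a. \<Sum>t<b. W)" by simp
  also have "\<dots> = (\<Sum>k<d. \<Sum>s<a. \<Sum>t<b. ?row (k * a + s) + ?col ((d - Suc k) * b + t))"
    using cell by (intro sum.cong refl) auto
  also have "\<dots> = real b * (\<Sum>k<d. \<Sum>s<a. ?row (k * a + s)) + real a * (\<Sum>k<d. \<Sum>t<b. ?col ((d - Suc k) * b + t))"
    by (simp add: sum.distrib sum_distrib_left)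
  also have "(\<Sum>k<d. \<Sum>t<b. ?col ((d - Suc k) * b + t)) = (\<Sum>k<d. \<Sum>t<b. ?col (k * b + t))"
    by (rule sum.nat_diff_reindex)
  also have "(\<Sum>k<d. \<Sum>t<b. ?col (k * b + t)) = (\<Sum>j<d * b. ?col j)" by (rule sum_blocks)
  also have "(\<Sum>k<d. \<Sum>s<a. ?row (k * a + s)) = (\<Sum>i<d * a. ?row i)" by (rule sum_blocks)
  also have "(\<Sum>j<d * b. ?col j) = (\<Sum>i<d * a. ?row i)" by (rule sum.swap)
  finally show ?thesis by (simp add: algebra_simps)
qed

section \<open>The down-degree expectation for dominant permutations\<close>

definition below :: "nat \<Rightarrow> (nat \<Rightarrow> nat) \<Rightarrow> (nat \<Rightarrow> nat) set" where
  "below n w = {u. u permutes {1..n} \<and> inversions u \<subseteq> inversions w}"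

lemma Field_weak_interval:
  assumes "w permutes {1..n}" shows "Field (interval (weak_order n) id w) = below n w"
  unfolding Field_interval[OF Partial_order_weak_order] id_weak_order weak_order_iff below_def using assms
  by (auto simp: inversions_id permutes_id)

lemma finite_below: "finite (below n w)"
  by (rule finite_subset[of _ "{u. u permutes {1..n}}"]) (auto simp: below_def finite_permutations)

lemma weak_interval_iff:
  assumes "w permutes {1..n}" "x \<in> below n w" "y \<in> below n w"
  shows "(x, y) \<in> interval (weak_order n) id w \<longleftrightarrow> inversions x \<subseteq> inversions y"
  using assms by (simp add: interval_def weak_order_iff inversions_id permutes_id below_def)

text \<open>The letter y directly follows x in the word u.\<close>

definition adjacent :: "(nat \<Rightarrow> nat) \<Rightarrow> nat \<Rightarrow> nat \<Rightarrow> bool" where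
  "adjacent u x y \<longleftrightarrow> inv u y = Suc (inv u x)"

text \<open>The analogue of \<open>toggle_sum\<close> for words: for l < h it counts the words below
  w with a descent from h to l.\<close>

definition descent_num :: "nat \<Rightarrow> (nat \<Rightarrow> nat) \<Rightarrow> nat \<Rightarrow> nat \<Rightarrow> real" where
  "descent_num n w l h = real (card {u \<in> below n w. adjacent u h l})"

lemma inversions_swap_values:
  assumes u: "u permutes {1..n}" and lh: "l < h" and adj: "adjacent u l h"
  shows "inversions (swap l h \<circ> u) = insert (l, h) (inversions u)"
proof -
  define i where "i = inv u l"
  have i: "u i = l" "u (i + 1) = h"
    using adj permutes_inverses(1)[OF u] by (simp_all add: i_def adjacent_def) (metis)
  have inj: "u x = u y \<longleftrightarrow> x = y" for x y using permutes_inj[OF u] by (simp add: inj_eq)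
  have "swap l h \<circ> u = u \<circ> swap i (i + 1)"
  proof
    fix x show "(swap l h \<circ> u) x = (u \<circ> swap i (i + 1)) x"
      using i inj[of x i] inj[of x "i + 1"] by (auto simp: Transposition.transpose_def)
  qed
  then show ?thesis using inversions_swap(1)[OF permutes_bij[OF u], of i] lh i by simp
qed

lemma inv_swap_values:
  assumes "u permutes {1..n}" shows "inv (swap l h \<circ> u) x = inv u (swap l h x)"
  using permutes_bij[OF assms] by (simp add: o_inv_distrib)

text \<open>The analogue of \<open>bij_toggle\<close>: exchanging adjacent letters l and h changes
  only the pair (l, h), which is an inversion of w, so the word stays below w.\<close>

lemma bij_swap_values:
  assumes w: "w permutes {1..n}" and lh: "(l, h) \<in> inversions w"
  shows "bij_betw (\<lambda>u. swap l h \<circ> u) {u \<in> below n w. adjacent u l h} {u \<in> below n w. adjacent u h l}"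
proof (rule bij_betwI[where g = "\<lambda>u. swap l h \<circ> u"])
  have l: "l < h" using lh by (simp add: mem_inversions)
  have r: "l \<in> {1..n}" "h \<in> {1..n}" using subsetD[OF inversions_subset[OF w] lh] by auto
  have p: "swap l h \<circ> u permutes {1..n}" if "u permutes {1..n}" for u
    using r by (intro permutes_compose[OF that] permutes_swap_id)
  have invol: "swap l h \<circ> (swap l h \<circ> u) = u" for u by (simp add: o_assoc)
  show "(\<lambda>u. swap l h \<circ> u) \<in> {u \<in> below n w. adjacent u l h} \<rightarrow> {u \<in> below n w. adjacent u h l}"
  proof
    fix u assume "u \<in> {u \<in> below n w. adjacent u l h}"
    then have u: "u permutes {1..n}" "inversions u \<subseteq> inversions w" "adjacent u l h" by (auto simp: below_def)
    show "swap l h \<circ> u \<in> {u \<in> below n w. adjacent u h l}"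
      using p[OF u(1)] inversions_swap_values[OF u(1) l u(3)] u lh
      by (simp add: below_def adjacent_def inv_swap_values[OF u(1)])
  qed
  show "(\<lambda>u. swap l h \<circ> u) \<in> {u \<in> below n w. adjacent u h l} \<rightarrow> {u \<in> below n w. adjacent u l h}"
  proof
    fix u assume "u \<in> {u \<in> below n w. adjacent u h l}"
    then have u: "u permutes {1..n}" "inversions u \<subseteq> inversions w" "adjacent u h l" by (auto simp: below_def)
    have a: "adjacent (swap l h \<circ> u) l h" using u(3) by (simp add: adjacent_def inv_swap_values[OF u(1)])
    have "inversions u = insert (l, h) (inversions (swap l h \<circ> u))"
      using inversions_swap_values[OF p[OF u(1)] l a] unfolding invol .
    then show "swap l h \<circ> u \<in> {u \<in> below n w. adjacent u l h}"
      using p[OF u(1)] u(2) a by (auto simp: below_def)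
  qed
qed (simp_all add: o_assoc)

text \<open>The signed adjacencies between \<open>j\<close> and \<open>z\<close> in the word \<open>u\<close>: they add up to one as soon as
  every letter between \<open>j\<close> and \<open>z\<close> is of one of two kinds, with \<open>j\<close> and \<open>z\<close> of different kinds.\<close>

definition rook_sign :: "nat \<Rightarrow> nat \<Rightarrow> (nat \<Rightarrow> nat) \<Rightarrow> nat \<Rightarrow> nat \<Rightarrow> real" where
  "rook_sign j z u l h =
    (if inv u j < inv u z
     then of_bool (adjacent u l h \<and> inv u j \<le> inv u l \<and> inv u l < inv u z)
        - of_bool (adjacent u h l \<and> inv u j \<le> inv u h \<and> inv u h < inv u z)
     else of_bool (adjacent u h l \<and> inv u z \<le> inv u h \<and> inv u h < inv u j)
        - of_bool (adjacent u l h \<and> inv u z \<le> inv u l \<and> inv u l < inv u j))"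

text \<open>The exchange reverses the sign of the adjacency and cancels it, unless it moves j or z.
  With exactly one of them moved, the adjacency lies in the range between j and z for one of the two
  words only, with sign +1; with both moved it counts +1 in each word.\<close>

lemma rook_sign_swap:
  assumes u: "u permutes {1..n}" and a: "adjacent u l h" and ne: "j \<noteq> h" "z \<noteq> l" "l \<noteq> h"
  shows "rook_sign j z u l h + rook_sign j z (swap l h \<circ> u) l h = of_bool (l = j) + of_bool (h = z)"
proof -
  define P where "P = inv u"
  have inj: "P x = P y \<longleftrightarrow> x = y" for x y
    using permutes_inj[OF permutes_inv[OF u]] by (simp add: P_def inj_eq)
  have P: "inv u = P" "inv (swap l h \<circ> u) x = P (swap l h x)" for x
    by (simp_all add: P_def inv_swap_values[OF u])
  define k where "k = P l"
  have k: "P l = k" "P h = Suc k" using a by (simp_all add: adjacent_def P k_def)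
  have sw: "swap l h l = h" "swap l h h = l" by simp_all
  consider "l = j" "h = z" | "l = j" "h \<noteq> z" | "l \<noteq> j" "h = z" | "l \<noteq> j" "h \<noteq> z" by blast
  then show ?thesis
  proof cases
    case 1
    then show ?thesis using k unfolding rook_sign_def adjacent_def P 1[symmetric] sw by simp
  next
    case 2
    have z: "swap l h z = z" using 2 ne by (simp add: transpose_apply_other)
    have "P z \<noteq> k" "P z \<noteq> Suc k" using inj[of z l] inj[of z h] k 2 ne by auto
    then show ?thesis using k 2(2) unfolding rook_sign_def adjacent_def P 2(1)[symmetric] sw z by auto
  next
    case 3
    have j: "swap l h j = j" using 3 ne by (simp add: transpose_apply_other)
    have "P j \<noteq> k" "P j \<noteq> Suc k" using inj[of j l] inj[of j h] k 3 ne by auto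
    then show ?thesis using k 3(1) unfolding rook_sign_def adjacent_def P 3(2)[symmetric] sw j by auto
  next
    case 4
    have jz: "swap l h j = j" "swap l h z = z" using 4 ne by (simp_all add: transpose_apply_other)
    show ?thesis using k 4 unfolding rook_sign_def adjacent_def P sw jz by auto
  qed
qed

lemma sum_rook_sign:
  assumes w: "w permutes {1..n}" and lh: "(l, h) \<in> inversions w" and ne: "j \<noteq> h" "z \<noteq> l"
  shows "(\<Sum>u\<in>below n w. rook_sign j z u l h) = (of_bool (l = j) + of_bool (h = z)) * descent_num n w l h"
proof -
  let ?P = "{u \<in> below n w. adjacent u l h}" and ?M = "{u \<in> below n w. adjacent u h l}"
  have l: "l \<noteq> h" using lh by (auto simp: mem_inversions)
  have "(\<Sum>u\<in>below n w. rook_sign j z u l h) = (\<Sum>u\<in>?P \<union> ?M. rook_sign j z u l h)"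
    using finite_below by (intro sum.mono_neutral_right) (auto simp: rook_sign_def)
  also have "\<dots> = (\<Sum>u\<in>?P. rook_sign j z u l h) + (\<Sum>u\<in>?M. rook_sign j z u l h)"
    using finite_below by (intro sum.union_disjoint) (auto simp: adjacent_def)
  also have "(\<Sum>u\<in>?M. rook_sign j z u l h) = (\<Sum>u\<in>?P. rook_sign j z (swap l h \<circ> u) l h)"
    by (rule sum.reindex_bij_betw[OF bij_swap_values[OF w lh], symmetric])
  also have "(\<Sum>u\<in>?P. rook_sign j z u l h) + \<dots> = (\<Sum>u\<in>?P. of_bool (l = j) + of_bool (h = z))"
    unfolding sum.distrib[symmetric]
    by (intro sum.cong refl rook_sign_swap[OF _ _ ne l]) (auto simp: below_def)
  also have "\<dots> = (of_bool (l = j) + of_bool (h = z)) * real (card ?P)" by simp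
  also have "card ?P = card ?M" by (rule bij_betw_same_card[OF bij_swap_values[OF w lh]])
  finally show ?thesis by (simp add: descent_num_def)
qed

lemma sum_step:
  fixes f :: "nat \<Rightarrow> real"
  assumes "a \<le> b" shows "(\<Sum>k\<in>{a..<b}. f (Suc k) - f k) = f b - f a"
  by (rule sum_Suc_diff'[OF assms])

lemma sum_rook_sign_letters:
  assumes u: "u permutes {1..n}" and fin: "finite Lo" "finite Hi" and disj: "Lo \<inter> Hi = {}"
    and j: "j \<in> Lo" and z: "z \<in> Hi"
    and between: "\<And>x. inv u x \<le> max (inv u j) (inv u z) \<Longrightarrow> min (inv u j) (inv u z) \<le> inv u x \<Longrightarrow> x \<in> Lo \<union> Hi"
  shows "(\<Sum>l\<in>Lo. \<Sum>h\<in>Hi. rook_sign j z u l h) = 1"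
proof -
  have iv: "inv u (u k) = k" for k using permutes_inverses(2)[OF u] .
  have vi: "u (inv u x) = x" for x using permutes_inverses(1)[OF u] .
  \<comment> \<open>An adjacent pair is determined by the position of its first letter. Indexed by
    positions, the signs become differences of the indicator of \<open>Hi\<close> or
    \<open>Lo\<close>.\<close>
  have letters: "(\<Sum>x\<in>A. \<Sum>y\<in>B. of_bool (adjacent u x y \<and> a \<le> inv u x \<and> inv u x < b))
    = (\<Sum>k\<in>{a..<b}. of_bool (u k \<in> A \<and> u (Suc k) \<in> B) :: real)" if AB: "finite A" "finite B" for A B a b
  proof -
    have e: "adjacent u x y \<longleftrightarrow> y = u (Suc (inv u x))" for x y
      unfolding adjacent_def using iv vi by metis
    have "(\<Sum>x\<in>A. \<Sum>y\<in>B. of_bool (adjacent u x y \<and> a \<le> inv u x \<and> inv u x < b))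
      = (\<Sum>x\<in>A. of_bool (u (Suc (inv u x)) \<in> B \<and> inv u x \<in> {a..<b}) :: real)"
    proof (rule sum.cong[OF refl])
      fix x
      show "(\<Sum>y\<in>B. of_bool (adjacent u x y \<and> a \<le> inv u x \<and> inv u x < b))
        = (of_bool (u (Suc (inv u x)) \<in> B \<and> inv u x \<in> {a..<b}) :: real)"
        unfolding e using AB(2)
        by (cases "inv u x \<in> {a..<b}") (auto simp: of_bool_def sum.delta)
    qed
    also have "\<dots> = (\<Sum>x\<in>{x \<in> A. inv u x \<in> {a..<b}}. of_bool (u (Suc (inv u x)) \<in> B))"
      unfolding sum.inter_filter[OF AB(1)] by (intro sum.cong refl) simp
    also have "\<dots> = (\<Sum>k\<in>{k \<in> {a..<b}. u k \<in> A}. of_bool (u (Suc k) \<in> B))"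
      by (rule sum.reindex_bij_witness[of _ u "inv u"]) (auto simp: iv vi)
    also have "\<dots> = (\<Sum>k\<in>{a..<b}. of_bool (u k \<in> A \<and> u (Suc k) \<in> B))"
      unfolding sum.inter_filter[OF finite_atLeastLessThan] by (intro sum.cong refl) simp
    finally show ?thesis .
  qed
  have swap: "(\<Sum>l\<in>Lo. \<Sum>h\<in>Hi. f l h) = (\<Sum>h\<in>Hi. \<Sum>l\<in>Lo. f l h)" for f :: "nat \<Rightarrow> nat \<Rightarrow> real"
    by (rule sum.swap)
  have zj: "z \<notin> Lo" "j \<notin> Hi" using disj j z by auto
  show ?thesis
  proof (cases "inv u j < inv u z")
    case True
    have "(\<Sum>l\<in>Lo. \<Sum>h\<in>Hi. rook_sign j z u l h)
      = (\<Sum>k\<in>{inv u j..<inv u z}. of_bool (u k \<in> Lo \<and> u (Suc k) \<in> Hi) - of_bool (u k \<in> Hi \<and> u (Suc k) \<in> Lo))"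
      unfolding rook_sign_def if_P[OF True] sum_subtractf letters[OF fin(1) fin(2)]
      by (subst swap, subst letters[OF fin(2) fin(1)], rule refl)
    also have "\<dots> = (\<Sum>k\<in>{inv u j..<inv u z}. of_bool (u (Suc k) \<in> Hi) - of_bool (u k \<in> Hi))"
    proof (rule sum.cong[OF refl])
      fix k assume k: "k \<in> {inv u j..<inv u z}"
      have "u k \<in> Lo \<union> Hi" by (rule between) (use k in \<open>auto simp: iv\<close>)
      moreover have "u (Suc k) \<in> Lo \<union> Hi" by (rule between) (use k in \<open>auto simp: iv\<close>)
      ultimately show "of_bool (u k \<in> Lo \<and> u (Suc k) \<in> Hi) - of_bool (u k \<in> Hi \<and> u (Suc k) \<in> Lo)
        = (of_bool (u (Suc k) \<in> Hi) - of_bool (u k \<in> Hi) :: real)" using disj by auto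
    qed
    also have "\<dots> = 1" using sum_step[of "inv u j" "inv u z" "\<lambda>k. of_bool (u k \<in> Hi)"] True zj z
        by (simp add: vi)
    finally show ?thesis .
  next
    case False
    have "(\<Sum>l\<in>Lo. \<Sum>h\<in>Hi. rook_sign j z u l h)
      = (\<Sum>k\<in>{inv u z..<inv u j}. of_bool (u k \<in> Hi \<and> u (Suc k) \<in> Lo) - of_bool (u k \<in> Lo \<and> u (Suc k) \<in> Hi))"
      unfolding rook_sign_def if_not_P[OF False] sum_subtractf letters[OF fin(1) fin(2)]
      by (subst swap, subst letters[OF fin(2) fin(1)], rule refl)
    also have "\<dots> = (\<Sum>k\<in>{inv u z..<inv u j}. of_bool (u (Suc k) \<in> Lo) - of_bool (u k \<in> Lo))"
    proof (rule sum.cong[OF refl])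
      fix k assume k: "k \<in> {inv u z..<inv u j}"
      have "u k \<in> Lo \<union> Hi" by (rule between) (use k in \<open>auto simp: iv\<close>)
      moreover have "u (Suc k) \<in> Lo \<union> Hi" by (rule between) (use k in \<open>auto simp: iv\<close>)
      ultimately show "of_bool (u k \<in> Hi \<and> u (Suc k) \<in> Lo) - of_bool (u k \<in> Lo \<and> u (Suc k) \<in> Hi)
        = (of_bool (u (Suc k) \<in> Lo) - of_bool (u k \<in> Lo) :: real)" using disj by auto
    qed
    also have "\<dots> = 1" using sum_step[of "inv u z" "inv u j" "\<lambda>k. of_bool (u k \<in> Lo)"] False zj j
        by (simp add: vi)
    finally show ?thesis .
  qed
qed

text \<open>Cell (i, c) stands for the inversion (Suc c, w (Suc i)); the extension by 0 fits the
  form of \<open>staircase_value\<close>.\<close>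

definition cell_num :: "nat \<Rightarrow> (nat \<Rightarrow> nat) \<Rightarrow> nat \<Rightarrow> nat \<Rightarrow> real" where
  "cell_num n w i c = (if (i, c) \<in> rothe w then descent_num n w (Suc c) (w (Suc i)) else 0)"

text \<open>\<open>Lo\<close> holds the values of the columns and \<open>Hi\<close> those of the
  rows of a rectangle inside the diagram, so every pair from \<open>Lo\<close> and \<open>Hi\<close>
  is an inversion of w. In words below w only such letters occur between Suc J and w (Suc I), so the
  signs of each word add up to 1. Summed over all words, only the pairs with l = Suc J or h = w (Suc
  I) survive, which are column J and row I.\<close>

lemma dominant_rook:
  assumes w: "w permutes {1..n}" and dom: "dominant n w"
    and IJ: "(I + m, J + m') \<in> rothe w" and out: "(I + Suc m, J) \<notin> rothe w" "(I, J + Suc m') \<notin> rothe w"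
  shows "(\<Sum>c<Suc (J + m'). cell_num n w I c) + (\<Sum>i<Suc (I + m). cell_num n w i J) = real (card (below n w))"
proof -
  let ?A = "Suc (I + m)" and ?B = "Suc (J + m')"
  let ?Lo = "Suc ` {..<?B}" and ?Hi = "(\<lambda>i. w (Suc i)) ` {..<?A}"
  note dc = down_closedD[OF down_closed_rothe[OF w dom]]
  have iv: "inv w (w x) = x" and vi: "w (inv w x) = x" for x using permutes_inverses[OF w] by auto
  have winj: "w x = w y \<longleftrightarrow> x = y" for x y using permutes_inj[OF w] by (simp add: inj_eq)
  have w0: "w 0 = 0" using permutes_not_in[OF w] by simp
  have in_rothe: "(i, c) \<in> rothe w" if "i < ?A" "c < ?B" for i c using that by (intro dc[OF IJ]) auto
  have inv_lh: "(l, h) \<in> inversions w" if "l \<in> ?Lo" "h \<in> ?Hi" for l h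
    using that in_rothe by (auto simp: rothe_inversions[OF w, symmetric])
  have lt: "l < h" if "l \<in> ?Lo" "h \<in> ?Hi" for l h using inv_lh[OF that] by (simp add: mem_inversions)
  let ?j = "Suc J" and ?z = "w (Suc I)"
  have j: "?j \<in> ?Lo" and z: "?z \<in> ?Hi" by auto
  have disj: "?Lo \<inter> ?Hi = {}" using lt by blast
  \<comment> \<open>A letter outside the rectangle exceeds both Suc J and w (Suc I), and as row I
    and column J end with the rectangle, it forms no inversion of w with either. Hence it follows
    both of them in every word below w.\<close>
  have rest: "inv u ?z < inv u x" "inv u ?j < inv u x"
    if u: "u \<in> below n w" and x: "x \<notin> ?Lo \<union> ?Hi" "x \<noteq> 0" for u x
  proof -
    have sub: "inversions u \<subseteq> inversions w" and up: "u permutes {1..n}" using u by (auto simp: below_def)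
    have uinj: "inv u a = inv u b \<longleftrightarrow> a = b" for a b using permutes_inj[OF permutes_inv[OF up]]
        by (simp add: inj_eq)
    have xB: "?B < x"
    proof (rule ccontr)
      assume "\<not> ?B < x"
      then have "x \<in> ?Lo" using x(2) by (intro image_eqI[of _ _ "x - 1"]) auto
      then show False using x by simp
    qed
    define p where "p = inv w x"
    have p: "w p = x" by (simp add: p_def vi)
    have p0: "p \<noteq> 0" using p w0 x(2) by (cases "p = 0") auto
    have pA: "?A < p"
    proof (rule ccontr)
      assume "\<not> ?A < p"
      then have "x \<in> ?Hi" using p p0 by (intro image_eqI[of _ _ "p - 1"]) auto
      then show False using x by simp
    qed
    have "J + Suc m' \<le> x - 1" using xB by linarith
    then have "(I, x - 1) \<notin> rothe w" using dc[of I "x - 1" I "J + Suc m'"] out(2) by blast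
    then have "\<not> x < ?z" using pA xB by (auto simp: rothe_def p_def)
    moreover have "x \<noteq> ?z" using x z by auto
    ultimately have "?z < x" by simp
    moreover have "(?z, x) \<notin> inversions u"
    proof
      assume "(?z, x) \<in> inversions u"
      then have "(?z, x) \<in> inversions w" using sub by blast
      then show False using pA by (simp add: mem_inversions iv p_def)
    qed
    ultimately show "inv u ?z < inv u x" using uinj[of ?z x] by (auto simp: mem_inversions)
    have "I + Suc m \<le> p - 1" using pA by linarith
    then have "(p - 1, J) \<notin> rothe w" using dc[of "p - 1" J "I + Suc m" J] out(1) by blast
    then have "inv w ?j \<le> p" using p p0 xB by (auto simp: rothe_def not_less)
    then have "(?j, x) \<notin> inversions w" by (simp add: mem_inversions p_def)
    then have "(?j, x) \<notin> inversions u" using sub by blast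
    then show "inv u ?j < inv u x" using uinj[of ?j x] xB by (auto simp: mem_inversions)
  qed
  have one: "(\<Sum>l\<in>?Lo. \<Sum>h\<in>?Hi. rook_sign ?j ?z u l h) = 1" if u: "u \<in> below n w" for u
  proof (rule sum_rook_sign_letters[OF _ _ _ disj j z])
    have up: "u permutes {1..n}" using u by (simp add: below_def)
    then show "u permutes {1..n}" .
    fix x assume x: "inv u x \<le> max (inv u ?j) (inv u ?z)" "min (inv u ?j) (inv u ?z) \<le> inv u x"
    \<comment> \<open>Words are functions on all naturals, so 0 is a letter as well; it sits at
      position 0, ahead of both letters.\<close>
    have u0: "inv u 0 = 0" using permutes_not_in[OF permutes_inv[OF up]] by simp
    have uinj: "inv u a = inv u b \<longleftrightarrow> a = b" for a b using permutes_inj[OF permutes_inv[OF up]]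
        by (simp add: inj_eq)
    have "?z \<noteq> 0" using winj[of "Suc I" 0] w0 by auto
    then have "inv u ?z \<noteq> 0" "inv u ?j \<noteq> 0" using uinj[of ?z 0] uinj[of ?j 0] u0 by auto
    then have "x \<noteq> 0" using x(2) u0 by (cases "x = 0") auto
    then show "x \<in> ?Lo \<union> ?Hi" using rest[OF u, of x] x(1) by (cases "x \<in> ?Lo \<union> ?Hi") auto
  qed auto
  have "real (card (below n w)) = (\<Sum>u\<in>below n w. \<Sum>l\<in>?Lo. \<Sum>h\<in>?Hi. rook_sign ?j ?z u l h)"
    using one by simp
  also have "\<dots> = (\<Sum>l\<in>?Lo. \<Sum>u\<in>below n w. \<Sum>h\<in>?Hi. rook_sign ?j ?z u l h)" by (rule sum.swap)
  also have "\<dots> = (\<Sum>l\<in>?Lo. \<Sum>h\<in>?Hi. \<Sum>u\<in>below n w. rook_sign ?j ?z u l h)" by (intro sum.cong refl sum.swap)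
  also have "\<dots> = (\<Sum>l\<in>?Lo. \<Sum>h\<in>?Hi. (of_bool (l = ?j) + of_bool (h = ?z)) * descent_num n w l h)"
  proof (intro sum.cong refl)
    fix l h assume lh: "l \<in> ?Lo" "h \<in> ?Hi"
    have "?j \<noteq> h" "?z \<noteq> l" using disj j z lh by blast+
    then show "(\<Sum>u\<in>below n w. rook_sign ?j ?z u l h) = (of_bool (l = ?j) + of_bool (h
        = ?z)) * descent_num n w l h"
      by (rule sum_rook_sign[OF w inv_lh[OF lh]])
  qed
  also have "\<dots> = (\<Sum>l\<in>?Lo. \<Sum>h\<in>?Hi. of_bool (l = ?j) * descent_num n w l h) + (\<Sum>l\<in>?Lo. \<Sum>h\<in>?Hi. of_bool (h
      = ?z) * descent_num n w l h)"
    by (simp only: distrib_right sum.distrib)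
  also have "(\<Sum>l\<in>?Lo. \<Sum>h\<in>?Hi. of_bool (l = ?j) * descent_num n w l h) = (\<Sum>h\<in>?Hi. descent_num n w ?j h)"
    unfolding sum_distrib_left[symmetric] using j by (subst sum.mono_neutral_right[of _ "{?j}"]) auto
  also have "(\<Sum>l\<in>?Lo. \<Sum>h\<in>?Hi. of_bool (h = ?z) * descent_num n w l h) = (\<Sum>l\<in>?Lo. descent_num n w l ?z)"
    using z by (intro sum.cong refl, subst sum.mono_neutral_right[of _ "{?z}"]) auto
  also have "(\<Sum>h\<in>?Hi. descent_num n w ?j h) = (\<Sum>i<?A. cell_num n w i J)"
    using in_rothe by (subst sum.reindex) (auto simp: inj_on_def winj cell_num_def intro!: sum.cong)
  also have "(\<Sum>l\<in>?Lo. descent_num n w l ?z) = (\<Sum>c<?B. cell_num n w I c)"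
    using in_rothe by (subst sum.reindex) (auto simp: cell_num_def intro!: sum.cong)
  finally show ?thesis by simp
qed

text \<open>A descent of u is a pair of values inverted in u and hence in w, so the descents can be
  sorted by the cells of the Rothe diagram.\<close>

lemma sum_descents:
  assumes w: "w permutes {1..n}"
  shows "(\<Sum>u\<in>below n w. real (card (descents n u))) = (\<Sum>p\<in>rothe w. cell_num n w (fst p) (snd p))"
proof -
  have iv: "inv w (w x) = x" and vi: "w (inv w x) = x" for x using permutes_inverses[OF w] by auto
  have d: "card (descents n u) = card {p \<in> inversions w. adjacent u (snd p) (fst p)}" if u:
      "u \<in> below n w" for u
  proof -
    have sub: "inversions u \<subseteq> inversions w" and up: "u permutes {1..n}" using u by (auto simp: below_def)
    have uv: "inv u (u x) = x" and vu: "u (inv u x) = x" for x using permutes_inverses[OF up] by auto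
    have "bij_betw (\<lambda>i. (u (i + 1), u i)) (descents n u) {p \<in> inversions w. adjacent u (snd p) (fst p)}"
    proof (rule bij_betwI[where g = "\<lambda>p. inv u (snd p)"])
      show "(\<lambda>i. (u (i + 1), u i)) \<in> descents n u \<rightarrow> {p \<in> inversions w. adjacent u (snd p) (fst p)}"
      proof
        fix i assume "i \<in> descents n u"
        then have "(u (i + 1), u i) \<in> inversions u" by (simp add: descents_def mem_inversions uv)
        then show "(u (i + 1), u i) \<in> {p \<in> inversions w. adjacent u (snd p) (fst p)}"
          using sub by (auto simp: adjacent_def uv)
      qed
      show "(\<lambda>p. inv u (snd p)) \<in> {p \<in> inversions w. adjacent u (snd p) (fst p)} \<rightarrow> descents n u"
      proof
        fix p assume p: "p \<in> {p \<in> inversions w. adjacent u (snd p) (fst p)}"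
        obtain l h where lh: "p = (l, h)" by force
        have a: "inv u l = Suc (inv u h)" "l < h" using p unfolding lh
            by (auto simp: adjacent_def mem_inversions)
        have r: "l \<in> {1..n}" "h \<in> {1..n}" using p subsetD[OF inversions_subset[OF w], of p] unfolding lh by auto
        have "inv u l \<in> {1..n}" "inv u h \<in> {1..n}" using r permutes_in_image[OF permutes_inv[OF up]] by blast+
        moreover have "u (Suc (inv u h)) < u (inv u h)" using a vu[of l] vu[of h] by simp
        ultimately show "inv u (snd p) \<in> descents n u" using a(1) unfolding lh descents_def by simp
      qed
      fix p assume p: "p \<in> {p \<in> inversions w. adjacent u (snd p) (fst p)}"
      have "u (inv u (snd p) + 1) = fst p" using p vu[of "fst p"] by (simp add: adjacent_def)
      then show "(u (inv u (snd p) + 1), u (inv u (snd p))) = p" by (simp add: vu)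
    qed (simp add: uv)
    then show ?thesis by (rule bij_betw_same_card)
  qed
  have b: "bij_betw (\<lambda>p. (Suc (snd p), w (Suc (fst p)))) (rothe w) (inversions w)"
  proof (rule bij_betwI[where g = "\<lambda>p. (inv w (snd p) - 1, fst p - 1)"])
    show "(\<lambda>p. (Suc (snd p), w (Suc (fst p)))) \<in> rothe w \<rightarrow> inversions w"
      using rothe_inversions[OF w] by auto
    have g: "Suc (fst p - 1) = fst p" "Suc (inv w (snd p) - 1) = inv w (snd p)" if p: "p \<in> inversions w" for p
    proof -
      have r: "fst p \<in> {1..n}" "snd p \<in> {1..n}" using subsetD[OF inversions_subset[OF w] p] by auto
      then have "inv w (snd p) \<in> {1..n}" using permutes_in_image[OF permutes_inv[OF w]] by blast
      then show "Suc (fst p - 1) = fst p" "Suc (inv w (snd p) - 1) = inv w (snd p)" using r by auto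
    qed
    show "(\<lambda>p. (inv w (snd p) - 1, fst p - 1)) \<in> inversions w \<rightarrow> rothe w"
    proof
      fix p assume p: "p \<in> inversions w"
      show "(inv w (snd p) - 1, fst p - 1) \<in> rothe w"
        unfolding rothe_inversions[OF w] g[OF p] vi using p by simp
    qed
    fix p assume "p \<in> inversions w"
    then show "(Suc (snd (inv w (snd p) - 1, fst p - 1)), w (Suc (fst (inv w (snd p) - 1, fst p - 1)))) = p"
      using g[of p] by (simp add: vi)
  qed (simp add: iv)
  have "(\<Sum>u\<in>below n w. real (card (descents n u))) = (\<Sum>u\<in>below n w. \<Sum>p\<in>{p \<in> inversions w. adjacent u
      (snd p) (fst p)}. 1)"
    using d by simp
  also have "\<dots> = (\<Sum>p\<in>inversions w. \<Sum>u\<in>{u \<in> below n w. adjacent u (snd p) (fst p)}. 1)"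
    by (rule sum.swap_restrict[OF finite_below finite_inversions[OF w]])
  also have "\<dots> = (\<Sum>p\<in>inversions w. descent_num n w (fst p) (snd p))" by (simp add: descent_num_def)
  also have "\<dots> = (\<Sum>p\<in>rothe w. descent_num n w (Suc (snd p)) (w (Suc (fst p))))"
    by (subst sum.reindex_bij_betw[OF b, symmetric]) simp
  also have "\<dots> = (\<Sum>p\<in>rothe w. cell_num n w (fst p) (snd p))" by (rule sum.cong) (simp_all add: cell_num_def)
  finally show ?thesis .
qed

lemma expect_X_weak:
  assumes w: "w permutes {1..n}"
  shows "expect_X (interval (weak_order n) id w) = (\<Sum>u\<in>below n w. real (card (descents n u))) / real
      (card (below n w))"
proof -
  interpret finite_poset "weak_order n" by (rule finite_poset_weak_order)
  note F = Field_weak_interval[OF w]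
  have "id \<in> below n w" by (simp add: below_def inversions_id permutes_id)
  then have ne: "Field (interval (weak_order n) id w) \<noteq> {}" unfolding F by blast
  have "down_degree (interval (weak_order n) id w) u = card (descents n u)" if u: "u \<in> below n w" for u
  proof -
    have up: "u permutes {1..n}" and "(id, u) \<in> weak_order n" "(u, w) \<in> weak_order n"
      using u w by (auto simp: below_def weak_order_iff inversions_id permutes_id)
    then show ?thesis using down_degree_interval card_lower_covers_weak_order[OF up] by simp
  qed
  then show ?thesis unfolding expect_X_eq[OF finite_interval ne] F by simp
qed

section \<open>Isomorphisms and values of the expectations\<close>

lemma poset_iso_expect_all:
  assumes f: "poset_iso r s f" and fin: "finite (Field r)" and ne: "Field r \<noteq> {}"
    and po: "Partial_order r" "Partial_order s"
  shows "expect_X s = expect_X r" "expect_Y s = expect_Y r"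
    "expect_X (s\<inverse>) = expect_X (r\<inverse>)" "expect_Y (s\<inverse>) = expect_Y (r\<inverse>)"
  using poset_iso_expect[OF f fin ne po] poset_iso_expect[OF poset_iso_converse[OF f]] fin ne po
  by simp_all

lemma young_expect:
  assumes l: "is_partition l"
  shows "expect_X (inclusion (ideals (diagram l))) = expect_X (interval young [] l)"
    "expect_Y (inclusion (ideals (diagram l))) = expect_Y (interval young [] l)"
    "expect_X ((inclusion (ideals (diagram l)))\<inverse>) = expect_X ((interval young [] l)\<inverse>)"
    "expect_Y ((inclusion (ideals (diagram l)))\<inverse>) = expect_Y ((interval young [] l)\<inverse>)"
proof -
  have ne: "Field (interval young [] l) \<noteq> {}"
    unfolding Field_young_interval[OF l] using l by (auto simp: young_def)
  note all = poset_iso_expect_all[OF poset_iso_young[OF l] finite_young_interval[OF l] ne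
      Partial_order_interval[OF Partial_order_young] Partial_order_inclusion]
  show "expect_X (inclusion (ideals (diagram l))) = expect_X (interval young [] l)"
    "expect_Y (inclusion (ideals (diagram l))) = expect_Y (interval young [] l)"
    "expect_X ((inclusion (ideals (diagram l)))\<inverse>) = expect_X ((interval young [] l)\<inverse>)"
    "expect_Y ((inclusion (ideals (diagram l)))\<inverse>) = expect_Y ((interval young [] l)\<inverse>)"
    by (rule all)+
qed

lemma id_below: "id \<in> below n w"
  by (simp add: below_def inversions_id permutes_id)

lemma weak_interval_nonempty:
  assumes "w permutes {1..n}" shows "Field (interval (weak_order n) id w) \<noteq> {}"
  unfolding Field_weak_interval[OF assms] using id_below by blast

lemma (in cut_permutation) weak_expect:
  "expect_X (interval (weak_order n) id w) = expect_X (inclusion (ideals dia))"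
  "expect_Y (interval (weak_order n) id w) = expect_Y (inclusion (ideals dia))"
  "expect_X ((interval (weak_order n) id w)\<inverse>) = expect_X ((inclusion (ideals dia))\<inverse>)"
  "expect_Y ((interval (weak_order n) id w)\<inverse>) = expect_Y ((inclusion (ideals dia))\<inverse>)"
proof -
  note all = poset_iso_expect_all[OF poset_iso_weak finite_weak_interval weak_interval_nonempty[OF w]
      Partial_order_interval[OF Partial_order_weak_order] Partial_order_inclusion, symmetric]
  show "expect_X (interval (weak_order n) id w) = expect_X (inclusion (ideals dia))"
    "expect_Y (interval (weak_order n) id w) = expect_Y (inclusion (ideals dia))"
    "expect_X ((interval (weak_order n) id w)\<inverse>) = expect_X ((inclusion (ideals dia))\<inverse>)"
    "expect_Y ((interval (weak_order n) id w)\<inverse>) = expect_Y ((inclusion (ideals dia))\<inverse>)"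
    by (rule all)+
qed

section \<open>Duality of weak intervals\<close>

lemma inversions_quotient:
  assumes w: "w permutes {1..n}" and p: "p permutes {1..n}" and sub: "inversions p \<subseteq> inversions w"
  shows "(a, b) \<in> inversions (inv w \<circ> p) \<longleftrightarrow> a < b \<and> (w b, w a) \<in> inversions w \<and> (w b, w a) \<notin> inversions p"
proof -
  have iv: "inv w (w x) = x" for x using permutes_inverses[OF w] by auto
  have q: "inv (inv w \<circ> p) x = inv p (w x)" for x
    using permutes_bij[OF w] permutes_bij[OF p] by (simp add: o_inv_distrib bij_imp_bij_inv inv_inv_eq)
  have pinj: "inv p x = inv p y \<longleftrightarrow> x = y" for x y using permutes_inj[OF permutes_inv[OF p]] by (simp add: inj_eq)
  have winj: "w x = w y \<longleftrightarrow> x = y" for x y using permutes_inj[OF w] by (simp add: inj_eq)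
  show ?thesis
  proof (cases "w b < w a")
    case True
    then show ?thesis using pinj[of "w a" "w b"] unfolding mem_inversions q iv by auto
  next
    case False
    have "\<not> (a < b \<and> inv p (w b) < inv p (w a))"
    proof
      assume ab: "a < b \<and> inv p (w b) < inv p (w a)"
      then have "w a < w b" using False winj[of a b] by auto
      then have "(w a, w b) \<in> inversions p" using ab by (simp add: mem_inversions)
      then have "(w a, w b) \<in> inversions w" using sub by blast
      then show False using ab by (simp add: mem_inversions iv)
    qed
    then show ?thesis using False unfolding mem_inversions q by auto
  qed
qed

lemma quotient_below:
  assumes w: "w permutes {1..n}" and p: "p \<in> below n w"
  shows "inv w \<circ> p \<in> below n (inv w)"
proof -
  have pp: "p permutes {1..n}" "inversions p \<subseteq> inversions w" using p by (auto simp: below_def)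
  have "inversions (inv w \<circ> p) \<subseteq> inversions (inv w)"
  proof clarify
    fix a b assume "(a, b) \<in> inversions (inv w \<circ> p)"
    then show "(a, b) \<in> inversions (inv w)"
      unfolding inversions_quotient[OF w pp] using permutes_bij[OF w] by (simp add: mem_inversions inv_inv_eq)
  qed
  then show ?thesis using permutes_compose[OF pp(1) permutes_inv[OF w]] by (simp add: below_def)
qed

text \<open>Multiplication by \<open>inv w\<close> replaces the inversions of p by the inversions of
  w that p lacks, renamed through \<open>inv w\<close>. Complementation reverses
  containment.\<close>

lemma poset_iso_weak_converse:
  assumes w: "w permutes {1..n}"
  shows "poset_iso ((interval (weak_order n) id w)\<inverse>) (interval (weak_order n) id (inv w)) (\<lambda>p. inv w \<circ> p)"
proof -
  have wi: "inv w permutes {1..n}" using w by (rule permutes_inv)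
  have ii: "inv (inv w) = w" using permutes_bij[OF w] by (simp add: inv_inv_eq)
  have iv: "inv w (w x) = x" and vi: "w (inv w x) = x" for x using permutes_inverses[OF w] by auto
  have "bij_betw (\<lambda>p. inv w \<circ> p) (below n w) (below n (inv w))"
  proof (rule bij_betwI[where g = "\<lambda>z. w \<circ> z"])
    show "(\<lambda>p. inv w \<circ> p) \<in> below n w \<rightarrow> below n (inv w)" using quotient_below[OF w] by blast
    show "(\<lambda>z. w \<circ> z) \<in> below n (inv w) \<rightarrow> below n w" using quotient_below[OF wi] unfolding ii by blast
  qed (simp_all add: fun_eq_iff iv vi)
  moreover have "(y, x) \<in> interval (weak_order n) id w \<longleftrightarrow> (inv w \<circ> x, inv w \<circ> y) \<in> interval (weak_order
      n) id (inv w)"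
    if x: "x \<in> below n w" and y: "y \<in> below n w" for x y
  proof -
    have xp: "x permutes {1..n}" "inversions x \<subseteq> inversions w" and yp: "y permutes {1..n}"
        "inversions y \<subseteq> inversions w"
      using x y by (auto simp: below_def)
    have "inversions y \<subseteq> inversions x \<longleftrightarrow> inversions (inv w \<circ> x) \<subseteq> inversions (inv w \<circ> y)"
    proof
      assume a: "inversions y \<subseteq> inversions x"
      show "inversions (inv w \<circ> x) \<subseteq> inversions (inv w \<circ> y)"
      proof clarify
        fix a b assume "(a, b) \<in> inversions (inv w \<circ> x)"
        then show "(a, b) \<in> inversions (inv w \<circ> y)"
          unfolding inversions_quotient[OF w xp] inversions_quotient[OF w yp] using a by blast
      qed
    next
      assume a: "inversions (inv w \<circ> x) \<subseteq> inversions (inv w \<circ> y)"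
      show "inversions y \<subseteq> inversions x"
      proof (clarify, rule ccontr)
        fix l h assume lh: "(l, h) \<in> inversions y" "(l, h) \<notin> inversions x"
        then have "(l, h) \<in> inversions w" using yp(2) by blast
        then have "(inv w h, inv w l) \<in> inversions (inv w \<circ> x)"
          unfolding inversions_quotient[OF w xp] vi using lh(2) by (simp add: mem_inversions)
        then have "(inv w h, inv w l) \<in> inversions (inv w \<circ> y)" using a by blast
        then show False unfolding inversions_quotient[OF w yp] vi using lh(1) by blast
      qed
    qed
    then show ?thesis
      unfolding weak_interval_iff[OF w y x] weak_interval_iff[OF wi quotient_below[OF w x]
          quotient_below[OF w y]] .
  qed
  ultimately show ?thesis
    unfolding poset_iso_def Field_converse Field_weak_interval[OF w] Field_weak_interval[OF wi] by blast
qed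

lemma weak_expect_inv:
  assumes w: "w permutes {1..n}"
  shows "expect_X ((interval (weak_order n) id w)\<inverse>) = expect_X (interval (weak_order n) id (inv w))"
    "expect_Y ((interval (weak_order n) id w)\<inverse>) = expect_Y (interval (weak_order n) id (inv w))"
    "expect_X (interval (weak_order n) id w) = expect_X ((interval (weak_order n) id (inv w))\<inverse>)"
    "expect_Y (interval (weak_order n) id w) = expect_Y ((interval (weak_order n) id (inv w))\<inverse>)"
proof -
  have fin: "finite (Field ((interval (weak_order n) id w)\<inverse>))" "Field ((interval (weak_order n) id w)\<inverse>) \<noteq> {}"
    "Partial_order ((interval (weak_order n) id w)\<inverse>)"
    using finite_weak_interval weak_interval_nonempty[OF w] Partial_order_interval[OF
        Partial_order_weak_order] by auto
  note all = poset_iso_expect_all[OF poset_iso_weak_converse[OF w] fin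
      Partial_order_interval[OF Partial_order_weak_order], symmetric, unfolded converse_converse]
  show "expect_X ((interval (weak_order n) id w)\<inverse>) = expect_X (interval (weak_order n) id (inv w))"
    "expect_Y ((interval (weak_order n) id w)\<inverse>) = expect_Y (interval (weak_order n) id (inv w))"
    "expect_X (interval (weak_order n) id w) = expect_X ((interval (weak_order n) id (inv w))\<inverse>)"
    "expect_Y (interval (weak_order n) id w) = expect_Y ((interval (weak_order n) id (inv w))\<inverse>)"
    by (rule all)+
qed

text \<open>w is compared with a cut permutation of the same shape, possibly in another symmetric
  group. Both reduce to dominant permutations with the same Rothe diagram, hence to the same
  function on the naturals. Equal shapes also give equal numbers of inversions, the remaining
  ingredient of the expectation.\<close>

lemma expect_Y_vexillary:
  assumes w: "w permutes {1..n}" and vex: "vexillary n w"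
  shows "expect_Y (interval (weak_order n) id w) = expect_Y (interval young [] (shape n w))"
proof -
  obtain n' k w' where cut: "cut_permutation n' k w'" and sh: "shape n' w' = shape n w"
    using exists_cut_permutation[OF is_partition_shape] by blast
  interpret c: cut_permutation n' k w' by (rule cut)
  obtain u where u: "u permutes {1..n}" "dominant n u" "shape n u = shape n w"
    "\<And>K m. int n < K \<Longrightarrow> chain_count K m (lift_int (inv u)) = chain_count K m (lift_int (inv w))"
    "\<And>K m. int n < K \<Longrightarrow> des_count K m (lift_int (inv u)) = des_count K m (lift_int (inv w))"
    using reduction_to_dominant[OF w vex] by blast
  obtain u' where u': "u' permutes {1..n'}" "dominant n' u'" "shape n' u' = shape n w"
    "\<And>K m. int n' < K \<Longrightarrow> chain_count K m (lift_int (inv u')) = chain_count K m (lift_int (inv w'))"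
    "\<And>K m. int n' < K \<Longrightarrow> des_count K m (lift_int (inv u')) = des_count K m (lift_int (inv w'))"
    using reduction_to_dominant[OF c.w c.vexillary] sh by auto
  have "rothe u = rothe u'"
    using diagram_shape_dominant[OF u(1,2)] diagram_shape_dominant[OF u'(1,2)] u(3) u'(3) by simp
  then have uu: "u = u'" by (rule rothe_inject[OF u(1) u'(1)])
  \<comment> \<open>A common window for both symmetric groups.\<close>
  define K where "K = int n + int n' + 1"
  have K: "int n < K" "int n' < K" "int n \<le> K" "int n' \<le> K" by (auto simp: K_def)
  have "card (inversions w) = card (inversions w')"
    unfolding card_inversions_shape[OF w] card_inversions_shape[OF c.w] sh ..
  then have "expect_Y (interval (weak_order n) id w) = expect_Y (interval (weak_order n') id w')"
    unfolding expect_Y_weak_order[OF w K(3)] expect_Y_weak_order[OF c.w K(4)]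
      u(4,5)[OF K(1), symmetric] u'(4,5)[OF K(2), symmetric] uu by simp
  also have "\<dots> = expect_Y (inclusion (ideals c.dia))" by (rule c.weak_expect)
  also have "c.dia = diagram (shape n w)" using c.diagram_shape_cut sh by simp
  also have "expect_Y (inclusion (ideals (diagram (shape n w)))) = expect_Y (interval young [] (shape n w))"
    by (rule young_expect[OF is_partition_shape])
  finally show ?thesis .
qed

section \<open>Transposed diagrams and staircases\<close>

lemma ideals_converse: "D \<in> ideals (L\<inverse>) \<longleftrightarrow> D\<inverse> \<in> ideals L"
  unfolding ideals_def down_closed_def by auto

lemma expect_X_ideals_converse:
  assumes "finite L"
  shows "expect_X (inclusion (ideals (L\<inverse>))) = expect_X (inclusion (ideals L))"
proof (rule poset_iso_expect(1))
  have "bij_betw converse (ideals L) (ideals (L\<inverse>))"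
    by (rule bij_betwI[where g = converse]) (auto simp: ideals_converse)
  then show "poset_iso (inclusion (ideals L)) (inclusion (ideals (L\<inverse>))) converse"
    unfolding poset_iso_def Field_inclusion by (auto simp: inclusion_def ideals_converse)
  have "ideals L \<subseteq> Pow L" by (auto simp: ideals_def)
  then show "finite (Field (inclusion (ideals L)))"
    unfolding Field_inclusion using assms finite_subset by blast
  show "Field (inclusion (ideals L)) \<noteq> {}"
    unfolding Field_inclusion by (auto simp: ideals_def down_closed_def)
qed (rule Partial_order_inclusion)+

text \<open>Here d is the number of blocks in the first row, one less than in
  \<open>rect_staircase\<close>; it becomes the factor d - 1 of the final value.\<close>

definition staircase :: "nat \<Rightarrow> nat \<Rightarrow> nat \<Rightarrow> (nat \<times> nat) set" where
  "staircase d a b = {(i, j). i div a + j div b < d}"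

lemma staircase_converse: "(staircase d a b)\<inverse> = staircase d b a"
  by (auto simp: staircase_def)

lemma div_less_bound: "x div c < d \<Longrightarrow> 0 < c \<Longrightarrow> x < d * (c::nat)"
  by (simp add: div_less_iff_less_mult)

lemma staircase_subset:
  assumes "0 < a" "0 < b" shows "staircase d a b \<subseteq> {..<d * a} \<times> {..<d * b}"
proof clarify
  fix i j assume "(i, j) \<in> staircase d a b"
  then have "i div a < d" "j div b < d" by (auto simp: staircase_def)
  then show "i \<in> {..<d * a} \<and> j \<in> {..<d * b}" using assms div_less_bound by auto
qed

lemma diagram_append:
  "(i, j) \<in> diagram (xs @ ys) \<longleftrightarrow> (if i < length xs then j < xs ! i else (i - length xs, j) \<in> diagram ys)"
  by (auto simp: diagram_def nth_append)

lemma diagram_rect_staircase: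
  assumes "0 < a" "0 < b"
  shows "diagram (rect_staircase (Suc d) a b) = staircase d a b"
proof (induction d)
  case 0
  then show ?case by (simp add: rect_staircase_def diagram_def staircase_def)
next
  case (Suc d)
  have e: "rect_staircase (Suc (Suc d)) a b = replicate a (Suc d * b) @ rect_staircase (Suc d) a b"
    by (simp add: rect_staircase_def)
  have "(i, j) \<in> diagram (rect_staircase (Suc (Suc d)) a b) \<longleftrightarrow> (i, j) \<in> staircase (Suc d) a b" for i j
  proof (cases "i < a")
    case True
    then show ?thesis unfolding e diagram_append using assms
      by (simp add: staircase_def div_less_iff_less_mult)
  next
    case False
    then have "i div a = Suc ((i - a) div a)" using assms by (simp add: le_div_geq)
    then show ?thesis unfolding e diagram_append using False Suc by (simp add: staircase_def)
  qed
  then show ?case by auto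
qed

text \<open>m is the distance from x to the last index of its block of length c.\<close>

lemma corner_block:
  fixes x c :: nat
  assumes "0 < c"
  shows "\<exists>m. Suc (x + m) = (x div c + 1) * c \<and> (x + m) div c = x div c \<and> (x + Suc m) div c = Suc (x div c)"
proof -
  define m where "m = c - 1 - x mod c"
  have "x mod c < c" using assms by simp
  then have "x + m = x div c * c + (c - 1)" using div_mult_mod_eq[of x c] unfolding m_def by linarith
  then have e: "Suc (x + m) = (x div c + 1) * c" "x + m = (c - 1) + x div c * c" using assms by auto
  have "(x + m) div c = x div c + (c - 1) div c"
    unfolding e(2) using assms by (intro div_mult_self1) simp
  then have "(x + m) div c = x div c" using assms by simp
  moreover have "(x + Suc m) div c = Suc (x div c)" using e(1) assms by simp
  ultimately show ?thesis using e(1) by blast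
qed

lemma sum_cells:
  fixes T :: "nat \<Rightarrow> nat \<Rightarrow> real"
  assumes "L \<subseteq> {..<m} \<times> {..<n}" "\<And>i j. (i, j) \<notin> L \<Longrightarrow> T i j = 0"
  shows "(\<Sum>p\<in>L. T (fst p) (snd p)) = (\<Sum>i<m. \<Sum>j<n. T i j)"
proof -
  have "(\<Sum>p\<in>L. T (fst p) (snd p)) = (\<Sum>p\<in>{..<m} \<times> {..<n}. T (fst p) (snd p))"
    using assms by (intro sum.mono_neutral_left) auto
  then show ?thesis by (simp add: sum.cartesian_product split_def)
qed

text \<open>T is left abstract because it stands for \<open>toggle_sum\<close> in the case of order
  ideals and for \<open>cell_num\<close> below a dominant permutation.\<close>

lemma staircase_value:
  fixes T :: "nat \<Rightarrow> nat \<Rightarrow> real"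
  assumes ab: "0 < a" "0 < b" and W: "W > 0"
    and rook: "\<And>I J m m'. (I + m, J + m') \<in> staircase d a b \<Longrightarrow> (I + Suc m, J) \<notin> staircase d a b \<Longrightarrow>
      (I, J + Suc m') \<notin> staircase d a b \<Longrightarrow> (\<Sum>j<Suc (J + m'). T I j) + (\<Sum>i<Suc (I + m). T i J) = W"
    and zero: "\<And>i j. (i, j) \<notin> staircase d a b \<Longrightarrow> T i j = 0"
  shows "(\<Sum>p\<in>staircase d a b. T (fst p) (snd p)) / W = real d * real a * real b / (real a + real b)"
proof -
  have "(real a + real b) * (\<Sum>i<d * a. \<Sum>j<d * b. T i j) = real d * real a * real b * W"
  proof (rule staircase_total[OF _ ab])
    fix I J assume IJ: "I div a + J div b + 2 = Suc d"
    obtain m where m: "Suc (I + m) = (I div a + 1) * a" "(I + m) div a = I div a" "(I + Suc m) div a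
        = Suc (I div a)"
      using corner_block[OF ab(1)] by blast
    obtain m' where m': "Suc (J + m') = (J div b + 1) * b" "(J + m') div b
        = J div b" "(J + Suc m') div b = Suc (J div b)"
      using corner_block[OF ab(2)] by blast
    show "(\<Sum>j<(J div b + 1) * b. T I j) + (\<Sum>i<(I div a + 1) * a. T i J) = W"
      unfolding m(1)[symmetric] m'(1)[symmetric]
    proof (rule rook)
      show "(I + m, J + m') \<in> staircase d a b" using IJ m(2) m'(2) by (simp add: staircase_def)
      show "(I + Suc m, J) \<notin> staircase d a b"
        unfolding staircase_def mem_Collect_eq case_prod_conv m(3) using IJ by linarith
      show "(I, J + Suc m') \<notin> staircase d a b"
        unfolding staircase_def mem_Collect_eq case_prod_conv m'(3) using IJ by linarith
    qed
  next
    fix i j assume "\<not> i div a + j div b + 1 < Suc d"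
    then show "T i j = 0" by (intro zero) (simp add: staircase_def)
  qed
  moreover have "(\<Sum>p\<in>staircase d a b. T (fst p) (snd p)) = (\<Sum>i<d * a. \<Sum>j<d * b. T i j)"
    by (rule sum_cells[OF staircase_subset[OF ab]]) (rule zero)
  ultimately show ?thesis using W ab by (simp add: field_simps)
qed

lemma staircase_down_closed: "down_closed (staircase d a b)"
  unfolding down_closed_def
proof (intro allI impI)
  fix i j i' j' assume "(i, j) \<in> staircase d a b" "i' \<le> i" "j' \<le> j"
  then show "(i', j') \<in> staircase d a b"
    using div_le_mono[of i' i a] div_le_mono[of j' j b] by (simp add: staircase_def)
qed

lemma finite_staircase: "0 < a \<Longrightarrow> 0 < b \<Longrightarrow> finite (staircase d a b)"
  using finite_subset[OF staircase_subset[of a b d]] by simp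

lemma staircase_ideals_expect:
  fixes a b d :: nat
  assumes ab: "0 < a" "0 < b"
  defines "v \<equiv> real d * real a * real b / (real a + real b)"
  shows "expect_X (inclusion (ideals (staircase d a b))) = v"
    "expect_Y (inclusion (ideals (staircase d a b))) = v"
    "expect_X ((inclusion (ideals (staircase d a b)))\<inverse>) = v"
    "expect_Y ((inclusion (ideals (staircase d a b)))\<inverse>) = v"
proof -
  let ?L = "staircase d a b" and ?r = "inclusion (ideals (staircase d a b))"
  interpret diagram_poset ?L
    by unfold_locales (simp_all add: finite_staircase[OF ab] staircase_down_closed)
  have val: "(\<Sum>D\<in>ideals ?L. \<omega> D * real (down_degree ?r D)) / (\<Sum>D\<in>ideals ?L. \<omega> D) = v"
    "(\<Sum>D\<in>ideals ?L. \<omega> D * real (down_degree (?r\<inverse>) D)) / (\<Sum>D\<in>ideals ?L. \<omega> D) = v"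
    if sym: "toggle_symmetric ?L \<omega>" and pos: "(\<Sum>D\<in>ideals ?L. \<omega> D) > 0" for \<omega>
  proof -
    have "toggle_sum \<omega> i j = 0" if "(i, j) \<notin> ?L" for i j
    proof -
      have "{D \<in> ideals ?L. removable ?L (i, j) D} = {}"
        using that ideal_subset by (auto simp: removable_def)
      then show ?thesis unfolding toggle_sum_def by (simp only: sum.empty)
    qed
    then have "(\<Sum>p\<in>?L. toggle_sum \<omega> (fst p) (snd p)) / (\<Sum>D\<in>ideals ?L. \<omega> D) = v"
      unfolding v_def by (intro staircase_value[OF ab pos] rook_sum[OF sym])
    then show "(\<Sum>D\<in>ideals ?L. \<omega> D * real (down_degree ?r D)) / (\<Sum>D\<in>ideals ?L. \<omega> D) = v"
      "(\<Sum>D\<in>ideals ?L. \<omega> D * real (down_degree (?r\<inverse>) D)) / (\<Sum>D\<in>ideals ?L. \<omega> D) = v"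
      unfolding sum_degree[OF sym] by simp_all
  qed
  have F: "Field ?r = ideals ?L" "Field (?r\<inverse>) = ideals ?L" by (simp_all add: Field_inclusion)
  have ne: "Field ?r \<noteq> {}" "Field (?r\<inverse>) \<noteq> {}" unfolding F using empty_ideal by blast+
  have fin: "finite (Field ?r)" "finite (Field (?r\<inverse>))" unfolding F by (rule finite_ideals)+
  have po: "Partial_order ?r" "Partial_order (?r\<inverse>)" using Partial_order_inclusion[of "ideals ?L"] by simp_all
  have card: "(\<Sum>D\<in>ideals ?L. 1) = real (card (ideals ?L))" by simp
  have "0 < card (ideals ?L)" using finite_ideals empty_ideal card_gt_0_iff by blast
  then have "(\<Sum>D\<in>ideals ?L. 1) > (0::real)" by simp
  note u = val[OF toggle_symmetric_uniform this]
  show "expect_X ?r = v" "expect_X (?r\<inverse>) = v"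
    unfolding expect_X_eq[OF fin(1) ne(1)] expect_X_eq[OF fin(2) ne(2)] F using u by simp_all
  \<comment> \<open>The whole poset is an interval, so the product formula for chain weights applies
    to it.\<close>
  have full: "interval ?r {} ?L = ?r"
    using ideal_subset L_ideal empty_ideal by (auto simp: interval_def inclusion_def)
  have cw: "real (chain_weight ?r D) = chain_wt D" "real (chain_weight (?r\<inverse>) D)
      = chain_wt D" if "D \<in> ideals ?L" for D
    using chain_weight_interval[of "{}" D ?L] that ideal_subset L_ideal empty_ideal
    unfolding full by (simp_all add: mem_r chain_wt_def chain_weight_converse)
  have "(\<Sum>D\<in>ideals ?L. real (chain_weight ?r D)) > 0"
    using sum_chain_weight_pos[OF fin(1) po(1) ne(1)] unfolding F .
  then have "(\<Sum>D\<in>ideals ?L. chain_wt D) > 0" using cw(1) by simp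
  note u = val[OF toggle_symmetric_chain this]
  show "expect_Y ?r = v" "expect_Y (?r\<inverse>) = v"
    unfolding expect_Y_eq[OF fin(1) po(1) ne(1)] expect_Y_eq[OF fin(2) po(2) ne(2)] F
    using u cw by simp_all
qed

section \<open>Dominant permutations of staircase shape\<close>

lemma dominant_imp_vexillary: "dominant n w \<Longrightarrow> vexillary n w"
proof -
  assume dom: "dominant n w"
  show "vexillary n w"
    unfolding vexillary_def
  proof (rule notI, elim bexE conjE)
    fix i1 i2 i3 i4
    assume i: "i1 \<in> {1..n}" "i3 \<in> {1..n}" "i4 \<in> {1..n}" "i1 < i2" "i2 < i3" "i3 < i4" "w i1 < w i4"
        "w i4 < w i3"
    have "i1 < i3" using i by simp
    then show False using dom i unfolding dominant_def by blast
  qed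
qed

text \<open>The pattern 132 is its own inverse.\<close>

lemma dominant_inv:
  assumes w: "w permutes {1..n}" and dom: "dominant n w" shows "dominant n (inv w)"
  unfolding dominant_def
proof (rule notI, elim bexE conjE)
  fix i j k assume r: "i \<in> {1..n}" "j \<in> {1..n}" "k \<in> {1..n}"
    and o: "i < j" "j < k" "inv w i < inv w k" "inv w k < inv w j"
  have vi: "w (inv w x) = x" for x using permutes_inverses[OF w] by auto
  have "inv w i \<in> {1..n}" using permutes_in_image[OF permutes_inv[OF w]] r(1) by blast
  then show False using dominantD[OF w dom, of "inv w i" "inv w k" "inv w j"] o by (simp add: vi)
qed

lemma dominant_staircase_expect_X:
  assumes w: "w permutes {1..n}" and dom: "dominant n w" and st: "rothe w
      = staircase d a b" and ab: "0 < a" "0 < b"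
  shows "expect_X (interval (weak_order n) id w) = real d * real a * real b / (real a + real b)"
proof -
  have "0 < card (below n w)" using finite_below id_below card_gt_0_iff by blast
  then have pos: "0 < real (card (below n w))" by simp
  show ?thesis
    unfolding expect_X_weak[OF w] sum_descents[OF w] st
    by (rule staircase_value[OF ab pos])
      (use dominant_rook[OF w dom] in \<open>simp_all add: st cell_num_def\<close>)
qed

theorem theorem1p1:
  fixes lam :: "nat list" and n :: nat and w :: "nat \<Rightarrow> nat"
  assumes "is_partition lam"
    and "w permutes {1..n}"
    and "vexillary n w"
    and "shape n w = lam"
  shows
    "expect_Y (interval young [] lam) = expect_Y (interval (weak_order n) id w)
     \<and>
     (grassmannian n w \<or> inv_grassmannian n w \<longrightarrow>
        expect_X (interval young [] lam) = expect_X (interval (weak_order n) id w))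
     \<and>
     (\<forall>(d::nat) (a::nat) (b::nat).
        d > 0 \<and> a > 0 \<and> b > 0 \<and> lam = rect_staircase d a b \<and>
        (dominant n w \<or> grassmannian n w \<or> inv_grassmannian n w) \<longrightarrow>
          (let L = interval young [] lam;
               W = interval (weak_order n) id w;
               v = (real d - 1) * real a * real b / (real a + real b)
           in CDE L \<and> expect_X L = v \<and> expect_Y L = v \<and>
              CDE W \<and> expect_X W = v \<and> expect_Y W = v \<and>
              CDE (L\<inverse>) \<and> expect_X (L\<inverse>) = v \<and> expect_Y (L\<inverse>) = v \<and>
              CDE (W\<inverse>) \<and> expect_X (W\<inverse>) = v \<and> expect_Y (W\<inverse>) = v))"
proof -
  let ?L = "interval young [] lam" and ?W = "interval (weak_order n) id w"
  note lam = assms(1) and w = assms(2) and vex = assms(3) and sh = assms(4)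
  have wi: "inv w permutes {1..n}" using w by (rule permutes_inv)
  have ii: "inv (inv w) = w" using permutes_bij[OF w] by (simp add: inv_inv_eq)
  have partY: "expect_Y ?L = expect_Y ?W" using expect_Y_vexillary[OF w vex] sh by simp
  have cut: "\<exists>k. cut_permutation n k w" if "inv_grassmannian n w"
    by (rule cut_of_inv_grassmannian[OF w that])
  have cut': "\<exists>k. cut_permutation n k (inv w)" if "grassmannian n w"
    by (rule cut_of_inv_grassmannian[OF wi]) (simp add: inv_grassmannian_def ii that)
  have X_conv: "expect_X (?W\<inverse>) = expect_X ?W"
    by (rule expect_X_converse[OF finite_weak_interval weak_interval_nonempty[OF w]])
  have partX: "expect_X ?L = expect_X ?W" if g: "grassmannian n w \<or> inv_grassmannian n w"
  proof (cases "inv_grassmannian n w")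
    case True
    then obtain k where "cut_permutation n k w" using cut by blast
    then interpret cut_permutation n k w .
    have "dia = diagram lam" using diagram_shape_cut sh by simp
    then show ?thesis using weak_expect(1) young_expect(1)[OF lam] by simp
  next
    case False
    then obtain k where "cut_permutation n k (inv w)" using g cut' by blast
    then interpret c: cut_permutation n k "inv w" .
    \<comment> \<open>The cut describes the interval below \<open>inv w\<close>, which is the dual
      one, and yields the transposed diagram. The uniform expectation is insensitive to both
      changes.\<close>
    have "diagram lam = c.dia\<inverse>" using c.diagram_shape_inv sh ii by simp
    then have "expect_X ?L = expect_X (inclusion (ideals c.dia))"
      using young_expect(1)[OF lam] expect_X_ideals_converse[OF c.finite_dia] by simp
    also have "\<dots> = expect_X (interval (weak_order n) id (inv w))" by (rule c.weak_expect(1)[symmetric])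
    also have "\<dots> = expect_X ?W" using weak_expect_inv(1)[OF w] X_conv by simp
    finally show ?thesis .
  qed
  have partC: "CDE ?L \<and> expect_X ?L = v \<and> expect_Y ?L = v \<and> CDE ?W \<and> expect_X ?W = v \<and> expect_Y ?W = v \<and>
      CDE (?L\<inverse>) \<and> expect_X (?L\<inverse>) = v \<and> expect_Y (?L\<inverse>) = v \<and> CDE (?W\<inverse>) \<and> expect_X (?W\<inverse>) = v \<and> expect_Y (?W\<inverse>) = v"
    if d: "d > 0" "a > 0" "b > 0" and rs: "lam = rect_staircase d a b"
      and cases: "dominant n w \<or> grassmannian n w \<or> inv_grassmannian n w"
      and v: "v = (real d - 1) * real a * real b / (real a + real b)" for d a b v
  proof -
    obtain d' where d': "d = Suc d'" using d(1) gr0_implies_Suc by blast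
    have v': "v = real d' * real a * real b / (real a + real b)" "v = real d' * real b * real a / (real b + real a)"
      unfolding v d' by (simp_all add: ac_simps)
    have dl: "diagram lam = staircase d' a b" unfolding rs d' by (rule diagram_rect_staircase[OF d(2,3)])
    note st = staircase_ideals_expect[OF d(2,3), of d', folded v'(1)]
    \<comment> \<open>The transposed staircase, which belongs to inverses, has the same
      value.\<close>
    note st' = staircase_ideals_expect[OF d(3,2), of d', folded v'(2)]
    have L: "expect_X ?L = v" "expect_Y ?L = v" "expect_X (?L\<inverse>) = v" "expect_Y (?L\<inverse>) = v"
      using st young_expect[OF lam] unfolding dl by simp_all
    \<comment> \<open>The other two values for the weak interval need no cases: the chain
      expectation is part (a), and the uniform expectation of the dual is that of the
      interval.\<close>
    have W: "expect_X ?W = v \<and> expect_Y (?W\<inverse>) = v"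
      using cases
    proof (elim disjE)
      assume dom: "dominant n w"
      have r: "rothe w = staircase d' a b" using diagram_shape_dominant[OF w dom] sh dl by simp
      have "expect_X ?W = v" unfolding v'(1) by (rule dominant_staircase_expect_X[OF w dom r d(2,3)])
      \<comment> \<open>The dual interval is the one below \<open>inv w\<close>, again dominant and
        with the transposed diagram, so part (a) applies to it.\<close>
      moreover have di: "dominant n (inv w)" by (rule dominant_inv[OF w dom])
      have "diagram (shape n (inv w)) = staircase d' b a"
        using diagram_shape_dominant[OF wi di] rothe_inv[OF permutes_bij[OF w]] r by (simp add: staircase_converse)
      then have "expect_Y (interval (weak_order n) id (inv w)) = v"
        using expect_Y_vexillary[OF wi dominant_imp_vexillary[OF di]] young_expect(2)[OF is_partition_shape, of n "inv w"] st'
        by simp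
      then have "expect_Y (?W\<inverse>) = v" using weak_expect_inv(2)[OF w] by simp
      ultimately show ?thesis by simp
    next
      assume g: "grassmannian n w"
      then obtain k where "cut_permutation n k (inv w)" using cut' by blast
      then interpret c: cut_permutation n k "inv w" .
      have "diagram lam = c.dia\<inverse>" using c.diagram_shape_inv sh ii by simp
      then have "c.dia = staircase d' b a" using dl by (metis converse_converse staircase_converse)
      then show ?thesis using partX g L(1) weak_expect_inv(2)[OF w] c.weak_expect(2) st' by simp
    next
      assume g: "inv_grassmannian n w"
      then obtain k where "cut_permutation n k w" using cut by blast
      then interpret cut_permutation n k w .
      have "dia = staircase d' a b" using diagram_shape_cut sh dl by simp
      then show ?thesis using partX g L(1) weak_expect(4) st by simp
    qed
    show ?thesis using L W partY X_conv by (simp add: CDE_def)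
  qed
  show ?thesis unfolding Let_def using partY partX partC by blast
qed

end
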